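(* Let $r_1,\dots,r_m$ be integers with $n>r_i\ge4$ and $$\sum_{i=1}^m r_i=n+3(m-1).$$ Then $\mathcal{A}_n$ is a stellar subdivision of $\mathcal{A}_{r_1}*\mathcal{A}_{r_2}*\cdots*\mathcal{A}_{r_m}$. In particular $\mathcal{A}_n$ and all joins $\mathcal{A}_{r_1}*\mathcal{A}_{r_2}*\cdots*\mathcal{A}_{r_m}$ are stellar subdivisions of the $(n-4)$-dimensional boundary complex of the hyper-octahedron (the join of $S^0$ with itself $n-3$ times). The subdivisions are done by edge starrings and yield intermediate $(n-4)$-spheres whose Stanley--Reisner ring has trivial $T^2$.
   Context: $\mathcal{A}_n$ ($n\ge3$): label the vertices of a convex $n$-gon cyclically by $1,\dots,n$ and let $\delta_{ij}$ be the diagonal joining $i$ and $j$. The vertices of $\mathcal{A}_n$ are the $\tfrac12n(n-3)$ diagonals, and a set of diagonals is a face iff no two of them cross. It is a combinatorial $(n-4)$-sphere; $\mathcal{A}_4=S^0$ is the complex consisting of two vertices and no edge. The join is $\mathcal{K}*\mathcal{L}=\{f\sqcup g:f\in\mathcal{K},g\in\mathcal{L}\}$. For a non-empty face $f$ of a complex $\mathcal{K}$, starring a new vertex $v$ at $f$ gives $\operatorname{star}(f,\mathcal{K})=(\mathcal{K}\setminus(\bar f*\operatorname{lk}(f,\mathcal{K})))\cup(\partial f*\bar v*\operatorname{lk}(f,\mathcal{K}))$, where $\bar f$ is the full simplex on $f$, $\partial f=\bar f\setminus\{f\}$ and $\operatorname{lk}(f,\mathcal{K})=\{g\in\mathcal{K}:g\cap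 f=\emptyset,g\cup f\in\mathcal{K}\}$; it is an edge starring if $f$ is an edge. $\mathcal{K}'$ is a stellar subdivision of $\mathcal{K}$ if there are $\mathcal{K}=\mathcal{K}_0,\dots,\mathcal{K}_r=\mathcal{K}'$ with $\mathcal{K}_i=\operatorname{star}(f_i,\mathcal{K}_{i-1})$ for some face $f_i\in\mathcal{K}_{i-1}$; the $\mathcal{K}_i$ are the intermediate complexes. Isomorphic complexes are not distinguished. The Stanley--Reisner ring of $\mathcal{K}$ is $A_{\mathcal{K}}=\mathbb{C}[x_v:v\in V(\mathcal{K})]/\langle\prod_{v\in p}x_v: p\notin\mathcal{K}\rangle$. $T^2_A=T^2(A/\mathbb{C};A)$ is the second cotangent (André--Quillen) cohomology module; "trivial $T^2$" means $T^2_{A_{\mathcal{K}}}=0$. *)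

theory Defs
  imports
    "HOL-Analysis.Function_Topology"
    "HOL-Algebra.QuotRing"
    "HOL-Algebra.Module"
    "HOL-Library.Poly_Mapping"
begin

section \<open>Finite simplicial complexes\<close>

text \<open>A complex is given by its set of faces (including the empty face);
  its vertex set is the union of the faces.\<close>

definition simplicial_complex :: "'v set set \<Rightarrow> bool" where
  "simplicial_complex K \<longleftrightarrow>
     finite K \<and> {} \<in> K \<and> (\<forall>f\<in>K. finite f) \<and> (\<forall>f\<in>K. \<forall>g. g \<subseteq> f \<longrightarrow> g \<in> K)"

abbreviation vertices :: "'v set set \<Rightarrow> 'v set" where
  "vertices K \<equiv> \<Union>K"

definition complex_iso :: "'v set set \<Rightarrow> 'w set set \<Rightarrow> bool" where
  "complex_iso K L \<longleftrightarrow> (\<exists>\<phi>. inj_on \<phi> (vertices K) \<and> L = (\<lambda>f. \<phi> ` f) ` K)"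

text \<open>The join of an indexed family; the vertices are tagged with the index in order to
  make the vertex sets disjoint.\<close>

definition join_family :: "'i set \<Rightarrow> ('i \<Rightarrow> 'v set set) \<Rightarrow> ('i \<times> 'v) set set" where
  "join_family I K = {\<Union>i\<in>I. Pair i ` F i | F. \<forall>i\<in>I. F i \<in> K i}"

text \<open>The join of complexes whose vertex sets are already disjoint.\<close>

definition disj_join :: "'v set set \<Rightarrow> 'v set set \<Rightarrow> 'v set set" where
  "disj_join K L = {f \<union> g | f g. f \<in> K \<and> g \<in> L}"

definition link :: "'v set \<Rightarrow> 'v set set \<Rightarrow> 'v set set" where
  "link f K = {g \<in> K. g \<inter> f = {} \<and> g \<union> f \<in> K}"

definition boundary_complex :: "'v set \<Rightarrow> 'v set set" where
  "boundary_complex f = Pow f - {f}"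

definition starring :: "'v set \<Rightarrow> 'v \<Rightarrow> 'v set set \<Rightarrow> 'v set set" where
  "starring f v K =
     (K - disj_join (Pow f) (link f K)) \<union>
     disj_join (disj_join (boundary_complex f) (Pow {v})) (link f K)"

text \<open>Complexes are considered up to isomorphism.  The intermediate complexes are finite, so
  they can be taken to have natural numbers as vertices, which leaves room for new ones.\<close>

definition stellar_sequence ::
    "nat \<Rightarrow> (nat \<Rightarrow> nat set set) \<Rightarrow> (nat \<Rightarrow> nat set) \<Rightarrow> 'v set set \<Rightarrow> 'w set set \<Rightarrow> bool" where
  "stellar_sequence N L f K K' \<longleftrightarrow>
     complex_iso K (L 0) \<and> complex_iso (L N) K' \<and>
     (\<forall>i<N. f i \<in> L i \<and> f i \<noteq> {} \<and>
        (\<exists>v. v \<notin> vertices (L i) \<and> L (Suc i) = starring (f i) v (L i)))"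

definition stellar_subdivision :: "'v set set \<Rightarrow> 'w set set \<Rightarrow> bool" where
  "stellar_subdivision K K' \<longleftrightarrow> (\<exists>N L f. stellar_sequence N L f K K')"

definition edge_subdivision_through ::
    "(nat set set \<Rightarrow> bool) \<Rightarrow> 'v set set \<Rightarrow> 'w set set \<Rightarrow> bool" where
  "edge_subdivision_through Q K K' \<longleftrightarrow>
     (\<exists>N L f. stellar_sequence N L f K K' \<and> (\<forall>i<N. card (f i) = 2) \<and> (\<forall>i\<le>N. Q (L i)))"

section \<open>The complexes \<open>\<A>\<^sub>n\<close> and the hyper-octahedron\<close>

text \<open>The diagonal joining the vertices \<open>i < j\<close> of the \<open>n\<close>-gon is the pair \<open>(i, j)\<close>.\<close>

definition diagonals :: "nat \<Rightarrow> (nat \<times> nat) set" where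
  "diagonals n = {(i, j). 1 \<le> i \<and> i + 1 < j \<and> j \<le> n \<and> \<not> (i = 1 \<and> j = n)}"

text \<open>In a convex polygon two diagonals cross iff their end points strictly interleave;
  diagonals with a common end point do not cross.\<close>

fun crossing :: "nat \<times> nat \<Rightarrow> nat \<times> nat \<Rightarrow> bool" where
  "crossing (i, j) (k, l) \<longleftrightarrow> (i < k \<and> k < j \<and> j < l) \<or> (k < i \<and> i < l \<and> l < j)"

definition assoc_complex :: "nat \<Rightarrow> (nat \<times> nat) set set" where
  "assoc_complex n = {F. F \<subseteq> diagonals n \<and> (\<forall>d\<in>F. \<forall>e\<in>F. \<not> crossing d e)}"

definition zero_sphere :: "bool set set" where
  "zero_sphere = {{}, {False}, {True}}"

definition hyperoctahedron_boundary :: "nat \<Rightarrow> (nat \<times> bool) set set" where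
  "hyperoctahedron_boundary k = join_family {1..k} (\<lambda>_. zero_sphere)"

section \<open>Combinatorial spheres\<close>

text \<open>Points of the geometric realisation of a finite complex, in barycentric coordinates.\<close>

definition realization :: "'v set set \<Rightarrow> ('v \<Rightarrow> real) set" where
  "realization K =
     {x. (\<forall>v. 0 \<le> x v) \<and> {v. x v \<noteq> 0} \<in> K \<and> (\<Sum>v\<in>{v. x v \<noteq> 0}. x v) = 1}"

text \<open>Functions into the reals are not an instance of the class of real vector spaces, so
  convex combinations and convex hulls of finite sets are spelled out.\<close>

definition convex_weights :: "'p set \<Rightarrow> ('p \<Rightarrow> real) \<Rightarrow> bool" where
  "convex_weights S c \<longleftrightarrow> (\<forall>p\<in>S. 0 \<le> c p) \<and> sum c S = 1"

definition combination :: "'p set \<Rightarrow> ('p \<Rightarrow> real) \<Rightarrow> ('p \<Rightarrow> 'v \<Rightarrow> real) \<Rightarrow> 'v \<Rightarrow> real" where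
  "combination S c h = (\<lambda>v. \<Sum>p\<in>S. c p * h p v)"

definition finite_hull :: "('v \<Rightarrow> real) set \<Rightarrow> ('v \<Rightarrow> real) set" where
  "finite_hull S = {combination S c (\<lambda>p. p) | c. convex_weights S c}"

definition affine_on_hull ::
    "('v \<Rightarrow> real) set \<Rightarrow> (('v \<Rightarrow> real) \<Rightarrow> ('w \<Rightarrow> real)) \<Rightarrow> bool" where
  "affine_on_hull S h \<longleftrightarrow>
     (\<forall>c. convex_weights S c \<longrightarrow> h (combination S c (\<lambda>p. p)) = combination S c h)"

text \<open>A map on a compact polyhedron \<open>X\<close> is piecewise linear if \<open>X\<close> is a finite union of
  polytopes on each of which the map is affine.\<close>

definition piecewise_linear ::
    "('v \<Rightarrow> real) set \<Rightarrow> (('v \<Rightarrow> real) \<Rightarrow> ('w \<Rightarrow> real)) \<Rightarrow> bool" where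
  "piecewise_linear X h \<longleftrightarrow>
     (\<exists>\<C>. finite \<C> \<and> (\<forall>S\<in>\<C>. finite S) \<and> X = (\<Union>S\<in>\<C>. finite_hull S) \<and>
          (\<forall>S\<in>\<C>. affine_on_hull S h))"

text \<open>The inverse of a piecewise linear homeomorphism is automatically piecewise linear.\<close>

definition pl_homeomorphic :: "'v set set \<Rightarrow> 'w set set \<Rightarrow> bool" where
  "pl_homeomorphic K L \<longleftrightarrow>
     (\<exists>h h'. homeomorphism (realization K) (realization L) h h' \<and>
             piecewise_linear (realization K) h)"

definition combinatorial_sphere :: "nat \<Rightarrow> 'v set set \<Rightarrow> bool" where
  "combinatorial_sphere d K \<longleftrightarrow>
     simplicial_complex K \<and> pl_homeomorphic K (boundary_complex {..<d + 2})"

section \<open>The second cotangent cohomology module\<close>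

text \<open>A submodule is represented by the ambient module with a smaller carrier.
  Linear maps are extensional functions.\<close>

definition linear_maps ::
    "('a, 'r) ring_scheme \<Rightarrow> ('a, 'b, 'm) module_scheme \<Rightarrow> ('a, 'c, 'n) module_scheme
      \<Rightarrow> ('b \<Rightarrow> 'c) set" where
  "linear_maps P M N =
     {\<phi> \<in> carrier M \<rightarrow>\<^sub>E carrier N.
        (\<forall>x\<in>carrier M. \<forall>y\<in>carrier M. \<phi> (x \<oplus>\<^bsub>M\<^esub> y) = \<phi> x \<oplus>\<^bsub>N\<^esub> \<phi> y) \<and>
        (\<forall>a\<in>carrier P. \<forall>x\<in>carrier M. \<phi> (a \<odot>\<^bsub>M\<^esub> x) = a \<odot>\<^bsub>N\<^esub> \<phi> x)}"

text \<open>The free module on a finite set \<open>J\<close>.  Modules are records that extend rings; the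
  multiplicative fields are irrelevant.\<close>

definition free_module :: "('a, 'r) ring_scheme \<Rightarrow> 'j set \<Rightarrow> ('a, 'j \<Rightarrow> 'a) module" where
  "free_module P J =
     \<lparr>carrier = J \<rightarrow>\<^sub>E carrier P, mult = undefined, one = undefined,
      zero = (\<lambda>j\<in>J. \<zero>\<^bsub>P\<^esub>), add = (\<lambda>x y. \<lambda>j\<in>J. x j \<oplus>\<^bsub>P\<^esub> y j),
      smult = (\<lambda>a x. \<lambda>j\<in>J. a \<otimes>\<^bsub>P\<^esub> x j)\<rparr>"

text \<open>The quotient ring \<open>P Quot I\<close>, regarded as a module over \<open>P\<close>.\<close>

definition quotient_module :: "('a, 'r) ring_scheme \<Rightarrow> 'a set \<Rightarrow> ('a, 'a set) module" where
  "quotient_module P I =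
     \<lparr>carrier = carrier (P Quot I), mult = mult (P Quot I), one = one (P Quot I),
      zero = zero (P Quot I), add = add (P Quot I),
      smult = (\<lambda>a x. (I +>\<^bsub>P\<^esub> a) \<otimes>\<^bsub>P Quot I\<^esub> x)\<rparr>"

text \<open>Let \<open>P\<close> be a polynomial ring and let \<open>g\<close> be a finite family of generators, indexed by
  \<open>J\<close>, of the ideal \<open>I\<close> of \<open>A = P/I\<close>.  Put \<open>F = P\<^sup>J\<close>, let \<open>\<gamma> : F \<rightarrow> I\<close> be the surjection
  given by \<open>g\<close>, let \<open>R\<close> be its kernel and let \<open>R\<^sub>0\<close> be the submodule of \<open>R\<close> generated by the
  Koszul relations \<open>\<gamma>(x)y - \<gamma>(y)x\<close>.  With the Lichtenbaum--Schlessinger cotangent complex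
  \<open>R/R\<^sub>0 \<rightarrow> F/IF \<rightarrow> \<Omega>\<^sub>P \<otimes> A\<close>, the second cotangent cohomology \<open>T\<^sup>2\<close> of \<open>A\<close> over the base ring,
  with values in \<open>A\<close>, is the cokernel of \<open>Hom(F, A) \<rightarrow> Hom(R/R\<^sub>0, A)\<close>.  It does not depend
  on the presentation.\<close>

definition gen_map :: "('a, 'r) ring_scheme \<Rightarrow> 'j set \<Rightarrow> ('j \<Rightarrow> 'a) \<Rightarrow> ('j \<Rightarrow> 'a) \<Rightarrow> 'a" where
  "gen_map P J g x = (\<Oplus>\<^bsub>P\<^esub>j\<in>J. x j \<otimes>\<^bsub>P\<^esub> g j)"

definition relation_module ::
    "('a, 'r) ring_scheme \<Rightarrow> 'j set \<Rightarrow> ('j \<Rightarrow> 'a) \<Rightarrow> ('a, 'j \<Rightarrow> 'a) module" where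
  "relation_module P J g =
     (free_module P J)\<lparr>carrier := {x \<in> carrier (free_module P J). gen_map P J g x = \<zero>\<^bsub>P\<^esub>}\<rparr>"

definition koszul_relations :: "('a, 'r) ring_scheme \<Rightarrow> 'j set \<Rightarrow> ('j \<Rightarrow> 'a) \<Rightarrow> ('j \<Rightarrow> 'a) set" where
  "koszul_relations P J g =
     {\<lambda>j\<in>J. gen_map P J g x \<otimes>\<^bsub>P\<^esub> y j \<ominus>\<^bsub>P\<^esub> gen_map P J g y \<otimes>\<^bsub>P\<^esub> x j | x y.
        x \<in> carrier (free_module P J) \<and> y \<in> carrier (free_module P J)}"

text \<open>\<open>Hom(R/R\<^sub>0, A)\<close>, as the group of the linear maps on \<open>R\<close> that vanish on \<open>R\<^sub>0\<close>,
  that is, on its generators.\<close>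

definition T2_cocycles ::
    "('a, 'r) ring_scheme \<Rightarrow> 'j set \<Rightarrow> ('j \<Rightarrow> 'a) \<Rightarrow> (('j \<Rightarrow> 'a) \<Rightarrow> 'a set) monoid" where
  "T2_cocycles P J g =
     (let A = quotient_module P (Idl\<^bsub>P\<^esub> (g ` J)); R = relation_module P J g in
      \<lparr>carrier = {\<phi> \<in> linear_maps P R A. \<forall>k \<in> koszul_relations P J g. \<phi> k = \<zero>\<^bsub>A\<^esub>},
       mult = (\<lambda>\<phi> \<psi>. \<lambda>x\<in>carrier R. \<phi> x \<oplus>\<^bsub>A\<^esub> \<psi> x),
       one = (\<lambda>x\<in>carrier R. \<zero>\<^bsub>A\<^esub>)\<rparr>)"

definition T2_coboundaries ::
    "('a, 'r) ring_scheme \<Rightarrow> 'j set \<Rightarrow> ('j \<Rightarrow> 'a) \<Rightarrow> (('j \<Rightarrow> 'a) \<Rightarrow> 'a set) set" where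
  "T2_coboundaries P J g =
     (\<lambda>\<psi>. restrict \<psi> (carrier (relation_module P J g))) `
       linear_maps P (free_module P J) (quotient_module P (Idl\<^bsub>P\<^esub> (g ` J)))"

text \<open>Only the underlying abelian group of the module \<open>T\<^sup>2\<close> is recorded, since only its
  vanishing is needed.\<close>

definition T2_group ::
    "('a, 'r) ring_scheme \<Rightarrow> 'j set \<Rightarrow> ('j \<Rightarrow> 'a) \<Rightarrow> (('j \<Rightarrow> 'a) \<Rightarrow> 'a set) set monoid" where
  "T2_group P J g = T2_cocycles P J g Mod T2_coboundaries P J g"

section \<open>Stanley--Reisner rings\<close>

type_synonym 'v cpoly = "('v \<Rightarrow>\<^sub>0 nat) \<Rightarrow>\<^sub>0 complex"

text \<open>The ring \<open>\<complex>[x\<^sub>v : v \<in> V]\<close>.\<close>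

definition poly_ring :: "'v set \<Rightarrow> 'v cpoly ring" where
  "poly_ring V =
     \<lparr>carrier = {p. \<forall>m \<in> Poly_Mapping.keys p. Poly_Mapping.keys m \<subseteq> V},
      mult = (*), one = 1, zero = 0, add = (+)\<rparr>"

definition poly_var :: "'v \<Rightarrow> 'v cpoly" where
  "poly_var v = Poly_Mapping.single (Poly_Mapping.single v 1) 1"

definition face_monomial :: "'v set \<Rightarrow> 'v cpoly" where
  "face_monomial p = (\<Prod>v\<in>p. poly_var v)"

definition nonfaces :: "'v set set \<Rightarrow> 'v set set" where
  "nonfaces K = Pow (vertices K) - K"

definition stanley_reisner_ideal :: "'v set set \<Rightarrow> 'v cpoly set" where
  "stanley_reisner_ideal K = Idl\<^bsub>poly_ring (vertices K)\<^esub> (face_monomial ` nonfaces K)"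

definition stanley_reisner_ring :: "'v set set \<Rightarrow> 'v cpoly set ring" where
  "stanley_reisner_ring K = poly_ring (vertices K) Quot stanley_reisner_ideal K"

text \<open>\<open>T\<^sup>2\<close> of the Stanley--Reisner ring, computed from its defining presentation.\<close>

definition stanley_reisner_T2 ::
    "'v set set \<Rightarrow> (('v set \<Rightarrow> 'v cpoly) \<Rightarrow> 'v cpoly set) set monoid" where
  "stanley_reisner_T2 K = T2_group (poly_ring (vertices K)) (nonfaces K) face_monomial"

definition trivial_T2 :: "'v set set \<Rightarrow> bool" where
  "trivial_T2 K \<longleftrightarrow> carrier (stanley_reisner_T2 K) = {\<one>\<^bsub>stanley_reisner_T2 K\<^esub>}"

end

theory Submission
  imports Defs
begin

text \<open>Send the diagonal \<open>(i, j)\<close> to the interval \<open>{i..j - 2}\<close> of \<open>{1..n - 2}\<close>.  Two diagonals cross iff their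
  intervals are not nested and have a union that is an interval, so that \<open>\<A>\<^sub>n\<close> is the nested complex of the
  family of all intervals.  The joins of the \<open>\<A>\<^sub>r\<close> and the hyper-octahedron are the nested complexes of the
  subfamilies in which all but the initial intervals across certain cuts are missing.  If a
  missing set \<open>A \<union> B\<close>, with disjoint members \<open>A\<close> and \<open>B\<close>, is added to such a building set, the
  nested complex undergoes the edge starring at \<open>{A, B}\<close>; adding the missing intervals, the largest ones first,
  leads from the hyper-octahedron to the joins and from these to \<open>\<A>\<^sub>n\<close>.

  Starring does not change the realisation up to a homeomorphism that is the restriction of a linear
  map, and the hyper-octahedron itself arises from the boundary of a simplex by starrings.

  For \<open>T\<^sup>2\<close>, all these complexes are flag, and the fine grading reduces the cocycles to numbers attached to
  the pairs of nonfaces.  They form a coboundary if, in every link, the non-neighbours of a vertex are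
  empty or have a cone point, and the vertices that are not adjacent to both of two non-adjacent
  vertices form a connected graph.  Both properties pass to nested complexes of building sets of intervals by
  induction over the face, since the link of \<open>M\<close> is the join of the complexes of the restriction to
  \<open>M\<close> and of the contraction of \<open>M\<close>.\<close>

section \<open>Polynomial rings and squarefree monomial ideals\<close>

text \<open>Initial intervals survive all cuts because they are the diagonals at the vertex 1, which
  the polygons of a join share. With cuts everywhere only they and the single points are left, and
  \<open>{1..y}\<close> is incompatible with \<open>{y + 1}\<close> alone: this is the
  hyper-octahedron. Each stage of adding intervals must again be a building set, so unions of
  overlapping members must be present; adding the largest ones first ensures this.

  Composing piecewise linear maps would call for common refinements. Keeping each forward map linear
  on the whole function space makes composition trivial, and the simplices of the source are the
  polytopes required.

  For the cocycles, a degree is written \<alpha> - \<open>b\<close> with disjoint supports. Unless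
  \<open>b\<close> is a vertex or a non-edge, each admissible nonface containing \<open>b\<close>
  contains a nonface that does not, and comparison with the latter gives a coboundary at once. The
  two remaining kinds of degree are the origin of the two conditions on links. Removing one
  neighbour from a cone can destroy it, so the interval structure has to supply a second cone
  point.\<close>

abbreviation coefficient :: "'v cpoly \<Rightarrow> ('v \<Rightarrow>\<^sub>0 nat) \<Rightarrow> complex" where
  "coefficient \<equiv> Poly_Mapping.lookup"

abbreviation support :: "('v \<Rightarrow>\<^sub>0 nat) \<Rightarrow> 'v set" where
  "support \<equiv> Poly_Mapping.keys"

lemma support_add: "support (m + k) = support m \<union> support k"
  by (auto simp: in_keys_iff lookup_add)

definition indicator_monomial :: "'v set \<Rightarrow> ('v \<Rightarrow>\<^sub>0 nat)" where
  "indicator_monomial s = (\<Sum>v\<in>s. Poly_Mapping.single v 1)"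

lemma lookup_indicator_monomial:
  "finite s \<Longrightarrow> Poly_Mapping.lookup (indicator_monomial s) v = of_bool (v \<in> s)"
  by (simp add: indicator_monomial_def lookup_sum lookup_single when_def)

lemma support_indicator_monomial: "finite s \<Longrightarrow> support (indicator_monomial s) = s"
  by (auto simp: in_keys_iff lookup_indicator_monomial)

lemma face_monomial_eq:
  "finite s \<Longrightarrow> face_monomial s = Poly_Mapping.single (indicator_monomial s) 1"
  by (induction s rule: finite_induct)
    (auto simp: face_monomial_def indicator_monomial_def poly_var_def mult_single)

lemma face_monomial_union:
  "finite s \<Longrightarrow> finite t \<Longrightarrow> s \<inter> t = {} \<Longrightarrow>
    face_monomial (s \<union> t) = face_monomial s * face_monomial t"
  by (simp add: face_monomial_def prod.union_disjoint)

lemma coefficient_single_mult: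
  fixes p :: "'v cpoly"
  shows "coefficient (Poly_Mapping.single k c * p) (k + m) = c * coefficient p m"
proof -
  have "coefficient (Poly_Mapping.single k c * p) (k + m) =
    Sum_any (\<lambda>l. (c * Sum_any (\<lambda>q. coefficient p q when k + m = l + q)) when l = k)"
    unfolding lookup_mult lookup_single by (intro Sum_any.cong) (auto simp: when_def)
  then show ?thesis by simp
qed

lemma coefficient_single_mult_eq_0:
  fixes p :: "'v cpoly"
  assumes "\<And>m. n \<noteq> k + m"
  shows "coefficient (Poly_Mapping.single k c * p) n = 0"
proof -
  have "coefficient (Poly_Mapping.single k c * p) n =
    Sum_any (\<lambda>l. (c * Sum_any (\<lambda>q. coefficient p q when n = l + q)) when l = k)"
    unfolding lookup_mult lookup_single by (intro Sum_any.cong) (auto simp: when_def)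
  also have "\<dots> = 0" using assms by simp
  finally show ?thesis .
qed

text \<open>Subtraction of exponents is truncated, so division by the face monomial is exact only if
  \<open>s\<close> lies in the support of \<open>n\<close>; otherwise \<open>n\<close> is not a
  multiple at all.\<close>

lemma coefficient_face_monomial_mult:
  fixes p :: "'v cpoly"
  assumes "finite s"
  shows "coefficient (face_monomial s * p) n =
    (if s \<subseteq> support n then coefficient p (n - indicator_monomial s) else 0)"
proof (cases "s \<subseteq> support n")
  case True
  have "n = indicator_monomial s + (n - indicator_monomial s)"
  proof (rule poly_mapping_eqI)
    fix v
    have "Poly_Mapping.lookup n v \<ge> of_bool (v \<in> s)"
      using True by (auto simp: in_keys_iff Suc_le_eq)
    then show "Poly_Mapping.lookup n v =
        Poly_Mapping.lookup (indicator_monomial s + (n - indicator_monomial s)) v"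
      using assms by (simp add: lookup_add lookup_minus lookup_indicator_monomial)
  qed
  then show ?thesis
    using True assms coefficient_single_mult[of "indicator_monomial s" 1 p "n - indicator_monomial s"]
    by (simp add: face_monomial_eq)
next
  case False
  have "n \<noteq> indicator_monomial s + m" for m
    using False assms by (auto simp: support_add support_indicator_monomial)
  then show ?thesis using False assms by (simp add: face_monomial_eq coefficient_single_mult_eq_0)
qed

definition polys :: "'v set \<Rightarrow> 'v cpoly set" where
  "polys V = {p. \<forall>m \<in> Poly_Mapping.keys p. support m \<subseteq> V}"

lemma poly_ring_sel [simp]:
  "carrier (poly_ring V) = polys V" "mult (poly_ring V) = (*)" "one (poly_ring V) = 1"
  "zero (poly_ring V) = 0" "add (poly_ring V) = (+)"
  by (simp_all add: poly_ring_def polys_def)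

lemma polys_0 [simp]: "0 \<in> polys V" by (simp add: polys_def)
lemma polys_1 [simp]: "1 \<in> polys V" by (simp add: polys_def)
lemma polys_add [simp]: "p \<in> polys V \<Longrightarrow> q \<in> polys V \<Longrightarrow> p + q \<in> polys V"
  using Poly_Mapping.keys_add[of p q] by (auto simp: polys_def)
lemma polys_uminus [simp]: "p \<in> polys V \<Longrightarrow> - p \<in> polys V"
  by (simp add: polys_def in_keys_iff)
lemma polys_diff [simp]: "p \<in> polys V \<Longrightarrow> q \<in> polys V \<Longrightarrow> p - q \<in> polys V"
  using polys_add[of p V "- q"] by simp
lemma polys_mult [simp]: "p \<in> polys V \<Longrightarrow> q \<in> polys V \<Longrightarrow> p * q \<in> polys V"
  using keys_mult[of p q] by (fastforce simp: polys_def support_add)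
lemma polys_sum [simp]: "(\<And>i. i \<in> I \<Longrightarrow> p i \<in> polys V) \<Longrightarrow> sum p I \<in> polys V"
  by (induction I rule: infinite_finite_induct) auto
lemma polys_single: "support m \<subseteq> V \<Longrightarrow> Poly_Mapping.single m c \<in> polys V"
  by (simp add: polys_def)
lemma polys_face_monomial [simp]: "finite s \<Longrightarrow> s \<subseteq> V \<Longrightarrow> face_monomial s \<in> polys V"
  by (simp add: face_monomial_eq polys_single support_indicator_monomial)

lemma cring_poly_ring: "cring (poly_ring V)"
proof (rule cringI)
  show "abelian_group (poly_ring V)"
    by (rule abelian_groupI) (auto simp: algebra_simps intro!: bexI[of _ "- _"])
  show "comm_monoid (poly_ring V)"
    by (rule comm_monoidI) (auto simp: algebra_simps)
qed (auto simp: algebra_simps)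

lemma ring_poly_ring: "ring (poly_ring V)"
  using cring_poly_ring cring.axioms(1) by blast

lemma poly_ring_a_inv [simp]: "p \<in> polys V \<Longrightarrow> \<ominus>\<^bsub>poly_ring V\<^esub> p = - p"
  using ring.ring_simprules(9) abelian_group.minus_equality[OF ring.is_abelian_group[OF ring_poly_ring], of V "- p" p]
  by simp

lemma poly_ring_minus [simp]:
  "p \<in> polys V \<Longrightarrow> q \<in> polys V \<Longrightarrow> p \<ominus>\<^bsub>poly_ring V\<^esub> q = p - q"
  by (simp add: a_minus_def)

lemma poly_ring_finsum:
  assumes "finite I" "\<And>i. i \<in> I \<Longrightarrow> p i \<in> polys V"
  shows "finsum (poly_ring V) p I = sum p I"
proof -
  interpret cring "poly_ring V" by (rule cring_poly_ring)
  show ?thesis using assms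
    by (induction I rule: finite_induct) (simp_all add: finsum_insert Pi_def)
qed

lemma poly_sum_monomials:
  fixes p :: "'v cpoly"
  shows "p = (\<Sum>m\<in>Poly_Mapping.keys p. Poly_Mapping.single m (coefficient p m))"
proof (rule poly_mapping_eqI)
  fix m
  show "coefficient p m = coefficient (\<Sum>k\<in>Poly_Mapping.keys p. Poly_Mapping.single k (coefficient p k)) m"
    by (simp add: lookup_sum lookup_single when_def in_keys_iff)
qed

section \<open>The Stanley--Reisner ideal described by coefficients\<close>

definition nonface_polys :: "'v set set \<Rightarrow> 'v cpoly set" where
  "nonface_polys K = {p \<in> polys (vertices K). \<forall>m. support m \<in> K \<longrightarrow> coefficient p m = 0}"

text \<open>A factor of a monomial has smaller support and \<open>K\<close> is closed under subsets,
  so a product term with face support can only come from a term of \<open>a\<close> with face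
  support.\<close>

lemma ideal_nonface_polys:
  assumes "simplicial_complex K"
  shows "ideal (nonface_polys K) (poly_ring (vertices K))"
proof -
  interpret ring "poly_ring (vertices K)" by (rule ring_poly_ring)
  have mult: "x * a \<in> nonface_polys K" if a: "a \<in> nonface_polys K" and x: "x \<in> polys (vertices K)" for a x
  proof -
    have "coefficient (x * a) m = 0" if m: "support m \<in> K" for m
    proof (rule ccontr)
      assume "coefficient (x * a) m \<noteq> 0"
      then have "m \<in> Poly_Mapping.keys (x * a)" by (simp add: in_keys_iff)
      then obtain k l where "m = k + l" "l \<in> Poly_Mapping.keys a" using keys_mult[of x a] by blast
      moreover from this m have "support l \<in> K"
        using assms by (auto simp: support_add simplicial_complex_def)
      ultimately show False using a by (auto simp: nonface_polys_def in_keys_iff)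
    qed
    then show ?thesis using a x by (simp add: nonface_polys_def)
  qed
  show ?thesis
  proof (rule idealI)
    show "subgroup (nonface_polys K) (add_monoid (poly_ring (vertices K)))"
    proof (rule add.subgroupI)
      show "nonface_polys K \<noteq> {}" unfolding nonface_polys_def by (auto intro!: exI[of _ 0])
    qed (auto simp: nonface_polys_def lookup_add a_inv_def[symmetric])
    show "ring (poly_ring (vertices K))" by (rule ring_poly_ring)
  qed (use mult in \<open>auto simp: mult.commute\<close>)
qed

text \<open>A monomial with nonface support is a multiple of the face monomial of that support.
  Membership in the ideal thus becomes a condition on single coefficients.\<close>

lemma stanley_reisner_ideal_eq:
  assumes K: "simplicial_complex K"
  shows "Idl\<^bsub>poly_ring (vertices K)\<^esub> (face_monomial ` nonfaces K) = nonface_polys K"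
proof
  interpret ring "poly_ring (vertices K)" by (rule ring_poly_ring)
  have fin: "finite (vertices K)" using K by (auto simp: simplicial_complex_def)
  have finJ: "finite s" if "s \<in> nonfaces K" for s
    using that fin by (auto simp: nonfaces_def intro: finite_subset)
  have sub: "face_monomial ` nonfaces K \<subseteq> nonface_polys K"
  proof
    fix p assume "p \<in> face_monomial ` nonfaces K"
    then obtain s where s: "s \<in> nonfaces K" "p = face_monomial s" by auto
    have "coefficient p m = 0" if "support m \<in> K" for m
      using that s finJ[OF s(1)] by (auto simp: face_monomial_eq lookup_single when_def
          support_indicator_monomial nonfaces_def)
    then show "p \<in> nonface_polys K"
      using s finJ[OF s(1)] by (auto simp: nonface_polys_def nonfaces_def)
  qed
  show "Idl\<^bsub>poly_ring (vertices K)\<^esub> (face_monomial ` nonfaces K) \<subseteq> nonface_polys K"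
    using ideal_nonface_polys[OF K] sub by (rule genideal_minimal)
  define I where "I = Idl\<^bsub>poly_ring (vertices K)\<^esub> (face_monomial ` nonfaces K)"
  have carr: "face_monomial ` nonfaces K \<subseteq> carrier (poly_ring (vertices K))"
    using sub by (auto simp: nonface_polys_def)
  interpret I: ideal I "poly_ring (vertices K)" unfolding I_def using carr by (rule genideal_ideal)
  have gen: "face_monomial s \<in> I" if "s \<in> nonfaces K" for s
    using genideal_self[OF carr] that by (auto simp: I_def)
  have mono: "Poly_Mapping.single m c \<in> I" if "support m \<notin> K" "support m \<subseteq> vertices K" for m c
  proof -
    define s where "s = support m"
    have s: "s \<in> nonfaces K" "finite s" using that by (auto simp: nonfaces_def s_def)
    have m: "m = (m - indicator_monomial s) + indicator_monomial s"
      by (rule poly_mapping_eqI) (use s(2) in \<open>auto simp: lookup_add lookup_minus lookup_indicator_monomial s_def in_keys_iff\<close>)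
    have "support (m - indicator_monomial s) \<subseteq> support m"
      by (auto simp: in_keys_iff lookup_minus)
    then have "Poly_Mapping.single (m - indicator_monomial s) c * face_monomial s \<in> I"
      using I.I_l_closed[OF gen[OF s(1)]] that by (simp add: polys_single)
    moreover have "Poly_Mapping.single (m - indicator_monomial s) c * face_monomial s = Poly_Mapping.single m c"
      using m s(2) by (simp add: face_monomial_eq mult_single)
    ultimately show ?thesis by simp
  qed
  show "nonface_polys K \<subseteq> Idl\<^bsub>poly_ring (vertices K)\<^esub> (face_monomial ` nonfaces K)"
    unfolding I_def[symmetric]
  proof
    fix p assume p: "p \<in> nonface_polys K"
    have sumI: "sum f A \<in> I" if "finite A" "\<And>a. a \<in> A \<Longrightarrow> f a \<in> I" for f :: "_ \<Rightarrow> 'a cpoly" and A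
      using that by (induction A rule: finite_induct)
        (use I.zero_closed I.a_closed in \<open>auto\<close>)
    have "(\<Sum>m\<in>Poly_Mapping.keys p. Poly_Mapping.single m (coefficient p m)) \<in> I"
    proof (rule sumI)
      fix m assume "m \<in> Poly_Mapping.keys p"
      then show "Poly_Mapping.single m (coefficient p m) \<in> I"
        using p by (intro mono) (auto simp: nonface_polys_def polys_def in_keys_iff)
    qed simp
    then show "p \<in> I" using poly_sum_monomials[of p] by simp
  qed
qed

section \<open>Flag complexes\<close>

definition clique_complex :: "'v set \<Rightarrow> ('v \<Rightarrow> 'v \<Rightarrow> bool) \<Rightarrow> 'v set set" where
  "clique_complex V R = {F. F \<subseteq> V \<and> (\<forall>x\<in>F. \<forall>y\<in>F. x \<noteq> y \<longrightarrow> R x y)}"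

text \<open>In a flag complex the link of the face \<open>a\<close> is the clique complex on these
  vertices.\<close>

definition common_neighbours :: "'v set \<Rightarrow> ('v \<Rightarrow> 'v \<Rightarrow> bool) \<Rightarrow> 'v set \<Rightarrow> 'v set" where
  "common_neighbours V R a = {x \<in> V. x \<notin> a \<and> (\<forall>y\<in>a. R x y)}"

definition coned :: "'v set \<Rightarrow> ('v \<Rightarrow> 'v \<Rightarrow> bool) \<Rightarrow> bool" where
  "coned W R \<longleftrightarrow> W = {} \<or> (\<exists>z\<in>W. \<forall>w\<in>W. w \<noteq> z \<longrightarrow> R z w)"

text \<open>Connectedness of the induced graph without paths: a property that spreads along edges
  holds everywhere or nowhere. The empty graph counts as connected.\<close>

definition graph_connected :: "'v set \<Rightarrow> ('v \<Rightarrow> 'v \<Rightarrow> bool) \<Rightarrow> bool" where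
  "graph_connected Y R \<longleftrightarrow>
     (\<forall>P. (\<forall>x\<in>Y. \<forall>y\<in>Y. P x \<longrightarrow> R x y \<longrightarrow> P y) \<longrightarrow> (\<exists>x\<in>Y. P x) \<longrightarrow> (\<forall>x\<in>Y. P x))"

definition coned_at :: "'v set \<Rightarrow> ('v \<Rightarrow> 'v \<Rightarrow> bool) \<Rightarrow> 'v \<Rightarrow> bool" where
  "coned_at L R v \<longleftrightarrow> coned {w \<in> L. w \<noteq> v \<and> \<not> R v w} R"

definition connected_at :: "'v set \<Rightarrow> ('v \<Rightarrow> 'v \<Rightarrow> bool) \<Rightarrow> 'v \<Rightarrow> 'v \<Rightarrow> bool" where
  "connected_at L R v w \<longleftrightarrow> graph_connected {y \<in> L. y \<noteq> v \<and> y \<noteq> w \<and> \<not> (R v y \<and> R w y)} R"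

text \<open>The first condition serves the degrees whose negative part is the vertex
  \<open>v\<close>, the second those whose negative part is the non-edge \<open>{v, w}\<close>;
  \<open>a\<close> is the positive part.\<close>

definition unobstructed :: "'v set \<Rightarrow> ('v \<Rightarrow> 'v \<Rightarrow> bool) \<Rightarrow> bool" where
  "unobstructed V R \<longleftrightarrow> (\<forall>a \<in> clique_complex V R.
     (\<forall>v \<in> common_neighbours V R a. coned_at (common_neighbours V R a) R v) \<and>
     (\<forall>v \<in> common_neighbours V R a. \<forall>w \<in> common_neighbours V R a.
        v \<noteq> w \<longrightarrow> \<not> R v w \<longrightarrow> connected_at (common_neighbours V R a) R v w))"

lemma clique_complex_mono: "F \<in> clique_complex V R \<Longrightarrow> G \<subseteq> F \<Longrightarrow> G \<in> clique_complex V R"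
  by (auto simp: clique_complex_def)

lemma graph_connectedD:
  assumes "graph_connected Y R" "x \<in> Y" "y \<in> Y"
    and "\<And>x y. x \<in> Y \<Longrightarrow> y \<in> Y \<Longrightarrow> R x y \<Longrightarrow> f x = f y"
  shows "f x = f y"
proof -
  have "\<forall>z\<in>Y. f z = f x"
    using assms(1)[unfolded graph_connected_def, rule_format, of "\<lambda>z. f z = f x"] assms(2,4) by metis
  then show ?thesis using assms(3) by simp
qed

locale flag_complex =
  fixes V :: "'v set" and R :: "'v \<Rightarrow> 'v \<Rightarrow> bool"
  assumes finite_V: "finite V" and R_sym: "R x y \<Longrightarrow> R y x"
begin

abbreviation "K \<equiv> clique_complex V R"
abbreviation "J \<equiv> Pow V - K"

lemma non_edge:
  assumes "p \<in> J" obtains x y where "x \<in> p" "y \<in> p" "x \<noteq> y" "\<not> R x y" "{x, y} \<in> J"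
proof -
  from assms obtain x y where xy: "x \<in> p" "y \<in> p" "x \<noteq> y" "\<not> R x y" by (auto simp: clique_complex_def)
  moreover have "{x, y} \<in> J" using xy assms by (auto simp: clique_complex_def)
  ultimately show thesis using that by blast
qed

lemma non_edgeI: "x \<in> V \<Longrightarrow> y \<in> V \<Longrightarrow> x \<noteq> y \<Longrightarrow> \<not> R x y \<Longrightarrow> {x, y} \<in> J"
  by (auto simp: clique_complex_def)

lemma clique_insertI:
  "F \<in> K \<Longrightarrow> x \<in> V \<Longrightarrow> (\<And>y. y \<in> F \<Longrightarrow> y \<noteq> x \<Longrightarrow> R x y) \<Longrightarrow> insert x F \<in> K"
  using R_sym by (auto simp: clique_complex_def)

end

text \<open>The component of degree \<open>\<alpha> - b\<close> of a cocycle, where \<open>a\<close> is the support of \<open>\<alpha>\<close>: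
  \<open>c p q\<close> is the coefficient of the value on the relation between the monomials of \<open>p\<close> and \<open>q\<close>.\<close>

locale graded_cocycle = flag_complex +
  fixes a b :: "'a set" and c :: "'a set \<Rightarrow> 'a set \<Rightarrow> complex"
  assumes disjoint: "a \<inter> b = {}"
    and cocycle: "\<And>p q s. p \<in> J \<Longrightarrow> q \<in> J \<Longrightarrow> s \<in> J \<Longrightarrow> b \<subseteq> p \<union> q \<union> s \<Longrightarrow>
      a \<union> ((p \<union> q \<union> s) - b) \<in> K \<Longrightarrow> c p q + c q s + c s p = 0"
    and outside: "\<And>p q. p \<in> J \<Longrightarrow> q \<in> J \<Longrightarrow> \<not> b \<subseteq> p \<union> q \<Longrightarrow> c p q = 0"
    and koszul: "\<And>p q. p \<in> J \<Longrightarrow> q \<in> J \<Longrightarrow> b \<subseteq> p \<union> q \<Longrightarrow>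
      a \<union> ((p \<union> q) - b) \<union> (p \<inter> q) \<in> K \<Longrightarrow> c p q = 0"
begin

text \<open>For \<open>b \<subseteq> s\<close> this set is the support of the monomial of degree
  \<alpha> - \<open>b\<close> times that of \<open>s\<close>; it is a face iff the product survives
  in the quotient. Only there do the cocycle equations say anything.\<close>

definition admissible :: "'a set \<Rightarrow> bool" where
  "admissible s \<longleftrightarrow> a \<union> (s - b) \<in> K"

lemma admissible_mono: "admissible s \<Longrightarrow> t \<subseteq> s \<Longrightarrow> admissible t"
  unfolding admissible_def by (erule clique_complex_mono) auto

text \<open>Frees the cocycle equation from the condition on \<open>b\<close>: if \<open>b\<close>
  is not inside the union of all three, it is inside no union of two, and every term is 0.\<close>

lemma triangle:
  assumes "p \<in> J" "q \<in> J" "s \<in> J" "admissible (p \<union> q \<union> s)"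
  shows "c p q + c q s + c s p = 0"
proof (cases "b \<subseteq> p \<union> q \<union> s")
  case True
  then show ?thesis using cocycle assms by (simp add: admissible_def)
next
  case False
  then have "\<not> b \<subseteq> p \<union> q" "\<not> b \<subseteq> q \<union> s" "\<not> b \<subseteq> s \<union> p" by auto
  then show ?thesis using outside assms by simp
qed

lemma c_refl: "p \<in> J \<Longrightarrow> admissible p \<Longrightarrow> c p p = 0"
  using triangle[of p p p] by simp

lemma c_antisym: "p \<in> J \<Longrightarrow> q \<in> J \<Longrightarrow> admissible (p \<union> q) \<Longrightarrow> c q p = - c p q"
  using triangle[of p q p] c_refl[of p] admissible_mono[of "p \<union> q" p]
  by (simp add: Un_commute Un_assoc eq_neg_iff_add_eq_0 add.commute)

lemma c_trans:
  assumes "p \<in> J" "q \<in> J" "s \<in> J" "admissible (p \<union> q \<union> s)"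
  shows "c p q = c p s + c s q"
proof -
  have "p \<union> s \<union> q = p \<union> q \<union> s" by auto
  then have "c p s + c s q + c q p = 0" using triangle[of p s q] assms by simp
  moreover have "c q p = - c p q" using assms by (intro c_antisym admissible_mono[OF assms(4)]) auto
  ultimately show ?thesis by simp
qed

text \<open>Both nonfaces are replaced by non-edges inside them, at no cost because a nonface and
  its subset have a union without \<open>b\<close>. For disjoint non-edges the Koszul condition
  coincides with admissibility; a common vertex needs the separate argument
  \<open>shared\<close>.\<close>

lemma vanish_outside:
  assumes q: "q \<in> J" "\<not> b \<subseteq> q" and q': "q' \<in> J" "\<not> b \<subseteq> q'" and adm: "admissible (q \<union> q')"
  shows "c q q' = 0"
proof -
  obtain x y where xy: "x \<in> q" "y \<in> q" "x \<noteq> y" "\<not> R x y" "{x, y} \<in> J" using q(1) by (rule non_edge)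
  obtain x' y' where xy': "x' \<in> q'" "y' \<in> q'" "x' \<noteq> y'" "\<not> R x' y'" "{x', y'} \<in> J" using q'(1) by (rule non_edge)
  have adm': "s \<subseteq> q \<union> q' \<Longrightarrow> admissible s" for s using adm admissible_mono by blast
  \<comment> \<open>If adding the common vertex \<open>y\<close> leaves a face, the Koszul condition
    applies. Otherwise \<open>y\<close> lies in \<open>b\<close> and some \<alpha> in
    \<open>a\<close> is not adjacent to it; on the detour over the non-edge
    \<open>{y, \<alpha>}\<close> one union misses \<open>z\<close> and the other \<open>u\<close>,
    both points of \<open>b\<close>.\<close>
  have shared: "c {u, y} {y, z} = 0"
    if J: "{u, y} \<in> J" "{y, z} \<in> J" and sub: "{u, y, z} \<subseteq> q \<union> q'"
      and "\<not> b \<subseteq> {u, y}" "\<not> b \<subseteq> {y, z}" for u y z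
  proof (cases "b \<subseteq> {u, y, z}")
    case False
    then show ?thesis using outside[OF J] by (simp add: insert_commute)
  next
    case True
    have uz: "u \<in> b" "z \<in> b" "u \<notin> {y, z}" "z \<notin> {u, y}"
      using True \<open>\<not> b \<subseteq> {u, y}\<close> \<open>\<not> b \<subseteq> {y, z}\<close> by blast+
    have "admissible {u, y, z}" using sub by (rule adm')
    then have aK: "a \<union> ({u, y, z} - b) \<in> K" by (simp add: admissible_def)
    show ?thesis
    proof (cases "a \<union> ({u, y, z} - b) \<union> {y} \<in> K")
      case True
      have "{u, y} \<inter> {y, z} = {y}" using uz(3,4) by blast
      moreover have un: "{u, y} \<union> {y, z} = {u, y, z}" by auto
      ultimately have "a \<union> (({u, y} \<union> {y, z}) - b) \<union> ({u, y} \<inter> {y, z}) \<in> K" using True by argo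
      then show ?thesis using \<open>b \<subseteq> {u, y, z}\<close> un by (intro koszul J) auto
    next
      case False
      then have "y \<in> b" using aK by (cases "y \<in> b") (auto simp: insert_absorb)
      then have "{u, y, z} - b = {}" using uz by auto
      then have "insert y a \<notin> K" "a \<in> K" using False aK by auto
      then obtain \<alpha> where \<alpha>: "\<alpha> \<in> a" "\<not> R y \<alpha>" using clique_insertI[of a y] J by blast
      have "\<alpha> \<noteq> y" "\<alpha> \<noteq> u" "\<alpha> \<noteq> z" using \<alpha> disjoint \<open>y \<in> b\<close> uz by auto
      have "\<alpha> \<in> V" using \<open>a \<in> K\<close> \<alpha> by (auto simp: clique_complex_def)
      then have J': "{y, \<alpha>} \<in> J" using \<alpha> \<open>\<alpha> \<noteq> y\<close> J by (intro non_edgeI) auto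
      have "a \<union> ({u, y} \<union> {y, z} \<union> {y, \<alpha>} - b) \<subseteq> a" using \<open>y \<in> b\<close> uz \<alpha> by auto
      then have "admissible ({u, y} \<union> {y, z} \<union> {y, \<alpha>})" unfolding admissible_def
        using \<open>a \<in> K\<close> clique_complex_mono by blast
      then have "c {u, y} {y, z} = c {u, y} {y, \<alpha>} + c {y, \<alpha>} {y, z}" by (intro c_trans J J')
      moreover have "\<not> b \<subseteq> {u, y} \<union> {y, \<alpha>}" using uz(2,4) \<open>\<alpha> \<noteq> z\<close> by blast
      moreover have "\<not> b \<subseteq> {y, \<alpha>} \<union> {y, z}" using uz(1,3) \<open>\<alpha> \<noteq> u\<close> by blast
      ultimately show ?thesis using outside J J' by simp
    qed
  qed
  have pair: "c {x, y} {x', y'} = 0"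
  proof (cases "{x, y} \<inter> {x', y'} = {}")
    case True
    have "admissible ({x, y} \<union> {x', y'})" using xy xy' by (intro adm') auto
    then show ?thesis using koszul[OF xy(5) xy'(5)] outside[OF xy(5) xy'(5)] True
      by (metis admissible_def sup_bot.right_neutral)
  next
    case False
    have nb: "\<not> b \<subseteq> {x, y}" "\<not> b \<subseteq> {x', y'}" using q q' xy xy' by auto
    have sub: "{x, y, x', y'} \<subseteq> q \<union> q'" using xy xy' by auto
    from False consider "x = x'" | "x = y'" | "y = x'" | "y = y'" by auto
    then show ?thesis
    proof cases
      case 1 then show ?thesis using shared[of y x y'] nb sub xy(5) xy'(5) by (simp add: insert_commute)
    next
      case 2 then show ?thesis using shared[of y x x'] nb sub xy(5) xy'(5) by (simp add: insert_commute)
    next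
      case 3 then show ?thesis using shared[of x y y'] nb sub xy(5) xy'(5) by (simp add: insert_commute)
    next
      case 4 then show ?thesis using shared[of x y x'] nb sub xy(5) xy'(5) by (simp add: insert_commute)
    qed
  qed
  have "c q q' = c q {x, y} + c {x, y} q'"
    using xy q q' adm' by (intro c_trans) auto
  also have "c {x, y} q' = c {x, y} {x', y'} + c {x', y'} q'"
    using xy xy' q q' adm' by (intro c_trans) auto
  also have "c q {x, y} = 0" using xy q by (intro outside) auto
  also have "c {x', y'} q' = 0" using xy' q' by (intro outside) auto
  finally show ?thesis using pair by simp
qed

text \<open>\<open>\<mu> p\<close> is the coefficient, in degree \<alpha> - \<open>b\<close> +
  \<open>p\<close>, of the value on the basis vector of \<open>p\<close>. This degree has no
  negative exponent only if \<open>b \<subseteq> p\<close>, hence the zeros.\<close>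

definition coboundary :: "('a set \<Rightarrow> complex) \<Rightarrow> bool" where
  "coboundary \<mu> \<longleftrightarrow> (\<forall>p\<in>J. \<forall>q\<in>J. b \<subseteq> p \<union> q \<longrightarrow> admissible (p \<union> q) \<longrightarrow>
     c p q = (if b \<subseteq> p then \<mu> p else 0) - (if b \<subseteq> q then \<mu> q else 0))"

text \<open>Every \<open>p\<close> gets a reference nonface \<open>f p\<close> inside it without
  \<open>b\<close>, and references have mutual value 0 by \<open>vanish_outside\<close>. Hence
  \<open>c p q\<close> is the difference of \<open>c p (f p)\<close> and
  \<open>c q (f q)\<close>.\<close>

lemma coboundary_if_subfaces:
  assumes "\<And>p. p \<in> J \<Longrightarrow> admissible p \<Longrightarrow> b \<subseteq> p \<Longrightarrow> \<exists>q\<in>J. q \<subseteq> p \<and> \<not> b \<subseteq> q"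
  shows "\<exists>\<mu>. coboundary \<mu>"
proof -
  have "\<exists>q. q \<in> J \<and> q \<subseteq> p \<and> \<not> b \<subseteq> q \<and> (b \<subseteq> p \<or> q = p)" if "p \<in> J" "admissible p" for p
  proof (cases "b \<subseteq> p")
    case True
    then obtain q where "q \<in> J" "q \<subseteq> p" "\<not> b \<subseteq> q" using assms[OF \<open>p \<in> J\<close>] \<open>admissible p\<close> by auto
    then show ?thesis using True by (intro exI[of _ q]) simp
  next
    case False
    then show ?thesis using \<open>p \<in> J\<close> by (intro exI[of _ p]) simp
  qed
  then obtain f where f: "f p \<in> J \<and> f p \<subseteq> p \<and> \<not> b \<subseteq> f p \<and> (b \<subseteq> p \<or> f p = p)"
    if "p \<in> J" "admissible p" for p by metis
  show ?thesis
  proof (intro exI, unfold coboundary_def, intro ballI impI)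
    fix p q assume J: "p \<in> J" "q \<in> J" and adm: "admissible (p \<union> q)"
    have adm': "s \<subseteq> p \<union> q \<Longrightarrow> admissible s" for s using adm admissible_mono by blast
    have fp: "f p \<in> J" "f p \<subseteq> p" "\<not> b \<subseteq> f p" "b \<subseteq> p \<or> f p = p" using f[OF J(1)] adm' by auto
    have fq: "f q \<in> J" "f q \<subseteq> q" "\<not> b \<subseteq> f q" "b \<subseteq> q \<or> f q = q" using f[OF J(2)] adm' by auto
    have "c p q = c p (f p) + c (f p) q" using J fp fq by (intro c_trans adm') auto
    also have "c (f p) q = c (f p) (f q) + c (f q) q" using J fp fq by (intro c_trans adm') auto
    also have "c (f p) (f q) = 0" using J fp fq by (intro vanish_outside adm') auto
    also have "c (f q) q = - c q (f q)" using J fq by (intro c_antisym adm') auto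
    finally have "c p q = c p (f p) - c q (f q)" by simp
    moreover have "c p (f p) = 0" if "\<not> b \<subseteq> p" using fp that c_refl[OF J(1)] adm' by auto
    moreover have "c q (f q) = 0" if "\<not> b \<subseteq> q" using fq that c_refl[OF J(2)] adm' by auto
    ultimately show "c p q = (if b \<subseteq> p then c p (f p) else 0) - (if b \<subseteq> q then c q (f q) else 0)" by simp
  qed
qed

text \<open>Every admissible nonface contains \<open>v\<close> and a non-neighbour of
  \<open>v\<close>, so the non-edges at \<open>v\<close> serve as references. A vertex of
  \<open>a\<close> not adjacent to \<open>v\<close>, or else a cone point of the non-neighbours in
  the link of \<open>a\<close>, makes all of them comparable with one.\<close>

lemma coboundary_if_singleton:
  assumes b: "b = {v}" and un: "unobstructed V R"
  shows "\<exists>\<mu>. coboundary \<mu>"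
proof (cases "\<exists>p\<in>J. admissible p")
  case False
  then have "coboundary (\<lambda>_. 0)" using admissible_mono unfolding coboundary_def by blast
  then show ?thesis by blast
next
  case True
  then obtain p0 where p0: "p0 \<in> J" "admissible p0" by blast
  have v_in: "v \<in> p" if "p \<in> J" "admissible p" for p
  proof (rule ccontr)
    assume "v \<notin> p"
    then have "p \<subseteq> a \<union> (p - b)" using b by auto
    then show False using that clique_complex_mono unfolding admissible_def by blast
  qed
  have "a \<subseteq> a \<union> (p0 - b)" by auto
  then have aK: "a \<in> K" using p0(2) clique_complex_mono unfolding admissible_def by blast
  have vV: "v \<in> V" using v_in[OF p0] p0(1) by auto
  have "\<exists>w. w \<in> p \<and> w \<noteq> v \<and> \<not> R v w" if p: "p \<in> J" "admissible p" for p
  proof -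
    obtain x y where xy: "x \<in> p" "y \<in> p" "x \<noteq> y" "\<not> R x y" using p(1) by (rule non_edge)
    have "x = v \<or> y = v" using p(2) xy b unfolding admissible_def clique_complex_def by auto
    then show ?thesis using xy R_sym by metis
  qed
  then obtain f where f: "f p \<in> p \<and> f p \<noteq> v \<and> \<not> R v (f p)" if "p \<in> J" "admissible p" for p by metis
  show ?thesis
  proof (cases "\<forall>\<alpha>\<in>a. R v \<alpha>")
    case False
    \<comment> \<open>Since \<alpha> already lies in \<open>a\<close>, the non-edge
      \<open>{v, \<alpha>}\<close> can be joined to any nonface without affecting admissibility: one
      reference for all.\<close>
    then obtain \<alpha> where \<alpha>: "\<alpha> \<in> a" "\<not> R v \<alpha>" by blast
    then have s: "{v, \<alpha>} \<in> J" using aK vV disjoint b by (intro non_edgeI) (auto simp: clique_complex_def)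
    have adm: "admissible (p \<union> {v, \<alpha>})" if "admissible p" for p
    proof -
      have "a \<union> (p \<union> {v, \<alpha>} - b) = a \<union> (p - b)" using \<alpha> b by auto
      then show ?thesis using that by (simp add: admissible_def)
    qed
    have "coboundary (\<lambda>p. c p {v, \<alpha>})"
      unfolding coboundary_def
    proof (intro ballI impI)
      fix p q assume J: "p \<in> J" "q \<in> J" and pq: "admissible (p \<union> q)"
      have vp: "b \<subseteq> p" "b \<subseteq> q" using v_in J pq admissible_mono b by auto
      have "c p q = c p {v, \<alpha>} + c {v, \<alpha>} q" using J s adm[OF pq] by (intro c_trans)
      moreover have "c {v, \<alpha>} q = - c q {v, \<alpha>}"
        using J s adm[of q] pq admissible_mono by (intro c_antisym) auto
      ultimately show "c p q = (if b \<subseteq> p then c p {v, \<alpha>} else 0) - (if b \<subseteq> q then c q {v, \<alpha>} else 0)"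
        using vp by simp
    qed
    then show ?thesis by blast
  next
    case True
    define L where "L = common_neighbours V R a"
    define W where "W = {w \<in> L. w \<noteq> v \<and> \<not> R v w}"
    have vL: "v \<in> L" using True vV disjoint b by (auto simp: L_def common_neighbours_def)
    have fW: "f p \<in> W" if p: "p \<in> J" "admissible p" for p
    proof -
      have fp: "f p \<in> p" "f p \<noteq> v" "\<not> R v (f p)" using f p by auto
      have "f p \<notin> a" using fp True by blast
      moreover have "\<forall>\<alpha>\<in>a. R (f p) \<alpha>"
      proof
        fix \<alpha> assume "\<alpha> \<in> a"
        then have "f p \<in> a \<union> (p - b)" "\<alpha> \<in> a \<union> (p - b)" "f p \<noteq> \<alpha>" using fp b \<open>f p \<notin> a\<close> by auto
        then show "R (f p) \<alpha>"
          using p(2) unfolding admissible_def clique_complex_def by blast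
      qed
      ultimately show ?thesis using fp p by (auto simp: W_def L_def common_neighbours_def)
    qed
    have "coned_at L R v" using un aK vL by (auto simp: unobstructed_def L_def)
    then obtain z where z: "z \<in> W" "\<And>w. w \<in> W \<Longrightarrow> w \<noteq> z \<Longrightarrow> R z w"
      using fW[OF p0] unfolding coned_at_def coned_def W_def[symmetric] by blast
    have s: "{v, w} \<in> J" if "w \<in> W" for w
      using that vV by (intro non_edgeI) (auto simp: W_def L_def common_neighbours_def)
    \<comment> \<open>The direct value \<open>c p {v, z}\<close> is not under control, because
      \<open>z\<close> need not be adjacent to the rest of \<open>p\<close>. On the detour over
      \<open>f p\<close> each step is admissible.\<close>
    define \<mu> where "\<mu> p = c p {v, f p} + c {v, f p} {v, z}" for p
    have "coboundary \<mu>"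
      unfolding coboundary_def
    proof (intro ballI impI)
      fix p q assume J: "p \<in> J" "q \<in> J" and pq: "admissible (p \<union> q)"
      have adm': "s \<subseteq> p \<union> q \<Longrightarrow> admissible s" for s using pq admissible_mono by blast
      have vp: "v \<in> p" "v \<in> q" using v_in J adm' by auto
      have fp: "f p \<in> p" "f p \<in> W" and fq: "f q \<in> q" "f q \<in> W" using f fW J adm' by auto
      have "c p q = c p {v, f p} + c {v, f p} q" using J s fp fq vp by (intro c_trans adm') auto
      also have "c {v, f p} q = c {v, f p} {v, f q} + c {v, f q} q"
        using J s fp fq vp by (intro c_trans adm') auto
      also have "c {v, f q} q = - c q {v, f q}" using J s fp fq vp by (intro c_antisym adm') auto
      also have adm: "admissible ({v, f p} \<union> {v, f q} \<union> {v, z})"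
      proof -
        have "R (f p) (f q)" if "f p \<noteq> f q"
        proof -
          have "f p \<in> a \<union> (p \<union> q - b)" "f q \<in> a \<union> (p \<union> q - b)" using fp fq b by (auto simp: W_def)
          then show ?thesis using pq that unfolding admissible_def clique_complex_def by blast
        qed
        then have "a \<union> {f p, f q, z} \<in> K"
          using aK fp(2) fq(2) z R_sym
          by (auto simp: clique_complex_def W_def L_def common_neighbours_def)
        moreover have "a \<union> ({v, f p} \<union> {v, f q} \<union> {v, z} - b) = a \<union> {f p, f q, z}"
          using fp fq z b by (auto simp: W_def)
        ultimately show ?thesis by (simp add: admissible_def)
      qed
      then have "c {v, f p} {v, f q} = c {v, f p} {v, z} + c {v, z} {v, f q}"
        using s fp fq z by (intro c_trans) auto
      also have "c {v, z} {v, f q} = - c {v, f q} {v, z}"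
        using s fp fq z admissible_mono[OF adm] by (intro c_antisym) auto
      finally show "c p q = (if b \<subseteq> p then \<mu> p else 0) - (if b \<subseteq> q then \<mu> q else 0)"
        using vp b by (simp add: \<mu>_def)
    qed
    then show ?thesis by blast
  qed
qed

text \<open>Here \<open>b\<close> is itself a nonface, and joining it to a nonface does not affect
  admissibility, so it is a natural reference. What has to be shown is that \<open>c b q\<close> is
  the same number for all admissible nonfaces \<open>q\<close> not containing \<open>b\<close>; this
  is where connectedness enters.\<close>

lemma coboundary_if_non_edge:
  assumes b: "b = {v, w}" "v \<noteq> w" "\<not> R v w" "v \<in> V" "w \<in> V" and un: "unobstructed V R"
  shows "\<exists>\<mu>. coboundary \<mu>"
proof (cases "a \<in> K")
  case False
  have "\<not> admissible p" for p using False clique_complex_mono[of "a \<union> (p - b)" V R a]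
    by (auto simp: admissible_def)
  then show ?thesis by (auto simp: coboundary_def)
next
  case aK: True
  have bJ: "b \<in> J" using b by (auto simp: clique_complex_def)
  define Q where "Q = {q \<in> J. admissible q \<and> \<not> b \<subseteq> q}"
  have adm_b: "admissible (s \<union> b) = admissible s" for s
    by (simp add: admissible_def Un_Diff)
  have step: "c b q = c b q'" if "q \<in> Q" "q' \<in> Q" "admissible (q \<union> q')" for q q'
  proof -
    have "admissible (b \<union> q \<union> q')" using that(3) adm_b[of "q \<union> q'"] by (simp add: Un_ac)
    then have "c b q = c b q' + c q' q" using that bJ by (intro c_trans) (auto simp: Q_def)
    moreover have "c q' q = 0" using that by (intro vanish_outside) (auto simp: Q_def Un_commute)
    ultimately show ?thesis by simp
  qed
  have const: "c b q = c b q'" if q: "q \<in> Q" "q' \<in> Q" for q q'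
  proof (cases "\<exists>\<alpha>\<in>a. \<not> R v \<alpha> \<or> \<not> R w \<alpha>")
    case True
    then obtain \<alpha> u where \<alpha>: "\<alpha> \<in> a" "u \<in> b" "\<not> R u \<alpha>" using b by blast
    then have s: "{u, \<alpha>} \<in> J" using aK b disjoint by (intro non_edgeI) (auto simp: clique_complex_def)
    have adm: "admissible (s \<union> {u, \<alpha>}) = admissible s" for s
    proof -
      have "a \<union> (s \<union> {u, \<alpha>} - b) = a \<union> (s - b)" using \<alpha> by auto
      then show ?thesis by (simp add: admissible_def)
    qed
    have "admissible ({} \<union> {u, \<alpha>})" using adm[of "{}"] aK by (simp add: admissible_def)
    moreover have "\<not> b \<subseteq> {u, \<alpha>}" using b \<alpha> disjoint by auto
    ultimately have "{u, \<alpha>} \<in> Q" using s by (auto simp: Q_def)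
    then show ?thesis using step[OF _ \<open>{u, \<alpha>} \<in> Q\<close>] q adm by (metis (no_types, lifting) Q_def mem_Collect_eq)
  next
    case False
    define L where "L = common_neighbours V R a"
    define Y where "Y = {y \<in> L. y \<noteq> v \<and> y \<noteq> w \<and> \<not> (R v y \<and> R w y)}"
    \<comment> \<open>A non-edge from \<open>y\<close> to \<open>v\<close> or to \<open>w\<close>: a
      vertex of \<open>Y\<close> is adjacent to at most one of them.\<close>
    define e where "e y = (if R v y then {w, y} else {v, y})" for y
    have vL: "v \<in> L" "w \<in> L" using False b disjoint by (auto simp: L_def common_neighbours_def)
    then have conn: "graph_connected Y R"
      using un aK b by (auto simp: unobstructed_def L_def[symmetric] connected_at_def Y_def)
    have adm_e: "admissible (s \<union> e y)" if "y \<in> Y" "y \<in> s" "admissible s" for s y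
    proof -
      have "a \<union> (s \<union> e y - b) = a \<union> (s - b)" using that b by (auto simp: e_def)
      then show ?thesis using that by (simp add: admissible_def)
    qed
    have eQ: "e y \<in> Q" if y: "y \<in> Y" for y
    proof -
      have "insert y a \<in> K" using y aK R_sym by (auto simp: Y_def L_def common_neighbours_def clique_complex_def)
      moreover have "a \<union> (e y - b) = insert y a" using y b by (auto simp: Y_def e_def)
      ultimately have "admissible (e y)" by (simp add: admissible_def)
      moreover have "e y \<in> J" using y b
        by (auto simp: e_def Y_def L_def common_neighbours_def clique_complex_def)
      moreover have "\<not> b \<subseteq> e y" using y b by (auto simp: e_def Y_def)
      ultimately show ?thesis by (simp add: Q_def)
    qed
    \<comment> \<open>A non-edge inside \<open>q\<close> has exactly one end in \<open>b\<close>,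
      since \<open>q\<close> is admissible and does not contain \<open>b\<close>. Its other end is a
      vertex of \<open>Y\<close>.\<close>
    have to_Y: "\<exists>y\<in>Y. c b q = c b (e y)" if q: "q \<in> Q" for q
    proof -
      have qJ: "q \<in> J" and qa: "admissible q" and qb: "\<not> b \<subseteq> q" using q by (auto simp: Q_def)
      obtain x y where xy: "x \<in> q" "y \<in> q" "x \<noteq> y" "\<not> R x y" using qJ by (rule non_edge)
      have "x \<in> b \<or> y \<in> b" using qa xy unfolding admissible_def clique_complex_def by auto
      moreover have "\<not> (x \<in> b \<and> y \<in> b)" using qb xy b by auto
      ultimately obtain u y where y: "u \<in> b" "y \<in> q" "y \<notin> b" "\<not> R u y"
        using xy R_sym by metis
      have "y \<notin> a" using y False b by blast
      moreover have "R y \<alpha>" if "\<alpha> \<in> a" for \<alpha>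
      proof -
        have "y \<in> a \<union> (q - b)" "\<alpha> \<in> a \<union> (q - b)" "y \<noteq> \<alpha>" using y that \<open>y \<notin> a\<close> by auto
        then show ?thesis using qa unfolding admissible_def clique_complex_def by blast
      qed
      ultimately have "y \<in> L" using y qJ by (auto simp: L_def common_neighbours_def)
      then have yY: "y \<in> Y" using y b by (auto simp: Y_def)
      moreover have "c b q = c b (e y)" using step[OF q eQ[OF yY]] adm_e[OF yY y(2) qa] by simp
      ultimately show ?thesis by blast
    qed
    obtain y y' where y: "y \<in> Y" "c b q = c b (e y)" "y' \<in> Y" "c b q' = c b (e y')"
      using to_Y q by metis
    have "c b (e y) = c b (e y')"
    proof (rule graph_connectedD[OF conn y(1) y(3), of "\<lambda>y. c b (e y)"])
      fix x y assume xy: "x \<in> Y" "y \<in> Y" "R x y"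
      have "a \<union> {x, y} \<in> K" using xy aK R_sym by (auto simp: Y_def L_def common_neighbours_def clique_complex_def)
      moreover have "a \<union> (e x \<union> e y - b) = a \<union> {x, y}" using xy b by (auto simp: Y_def e_def)
      ultimately have "admissible (e x \<union> e y)" by (simp add: admissible_def)
      then show "c b (e x) = c b (e y)" using step eQ xy by simp
    qed
    then show ?thesis using y by simp
  qed
  obtain k where k: "\<And>q. q \<in> Q \<Longrightarrow> c b q = k" using const by metis
  \<comment> \<open>The constant normalises: \<open>c q b = - k\<close> for every admissible
    \<open>q\<close> that does not contain \<open>b\<close>, and there the contribution has to be
    0.\<close>
  have "coboundary (\<lambda>p. c p b + k)"
    unfolding coboundary_def
  proof (intro ballI impI)
    fix p q assume J: "p \<in> J" "q \<in> J" and sub: "b \<subseteq> p \<union> q" and pq: "admissible (p \<union> q)"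
    have adm': "s \<subseteq> p \<union> q \<Longrightarrow> admissible s" for s using pq admissible_mono by blast
    have *: "c p q = c p b + c b q" using J bJ sub by (intro c_trans adm') auto
    have anti: "c b r = - c r b" if "r \<in> J" "r \<subseteq> p \<union> q" for r
      using that bJ sub by (intro c_antisym adm') auto
    have kQ: "c b r = k" if "r \<in> J" "r \<subseteq> p \<union> q" "\<not> b \<subseteq> r" for r
      using k[of r] that adm'[of r] by (simp add: Q_def)
    show "c p q = (if b \<subseteq> p then c p b + k else 0) - (if b \<subseteq> q then c q b + k else 0)"
    proof (cases "b \<subseteq> p \<or> b \<subseteq> q")
      case True
      have "c p b = - k" if "\<not> b \<subseteq> p" using that anti[of p] kQ[of p] J by simp
      moreover have "c b q = (if b \<subseteq> q then - c q b else k)" using anti[of q] kQ[of q] J by simp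
      ultimately show ?thesis using * True by (cases "b \<subseteq> p"; cases "b \<subseteq> q") simp_all
    next
      case False
      then show ?thesis using vanish_outside[OF J(1) _ J(2) _ pq] by simp
    qed
  qed
  then show ?thesis by blast
qed

text \<open>If all nonfaces inside an admissible nonface \<open>p\<close> contain \<open>b\<close>,
  then \<open>b\<close> lies in a non-edge of \<open>p\<close>; it is not empty, since
  \<open>p\<close> would then be a face. So \<open>b\<close> is a vertex or a non-edge.\<close>

lemma coboundary_exists:
  assumes un: "unobstructed V R"
  shows "\<exists>\<mu>. coboundary \<mu>"
proof (cases "\<forall>p\<in>J. admissible p \<longrightarrow> b \<subseteq> p \<longrightarrow> (\<exists>q\<in>J. q \<subseteq> p \<and> \<not> b \<subseteq> q)")
  case True
  then show ?thesis by (intro coboundary_if_subfaces) blast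
next
  case False
  then obtain p where p: "p \<in> J" "admissible p" "\<not> (\<exists>q\<in>J. q \<subseteq> p \<and> \<not> b \<subseteq> q)" by meson
  obtain x y where xy: "x \<in> p" "y \<in> p" "x \<noteq> y" "\<not> R x y" "{x, y} \<in> J" using p(1) by (rule non_edge)
  have "b \<subseteq> {x, y}" using p(3) xy(1,2,5) by (meson insert_subset empty_subsetI)
  moreover have "b \<noteq> {}"
  proof
    assume "b = {}"
    then have "p \<subseteq> a \<union> (p - b)" by auto
    then have "p \<in> K" using p(2) clique_complex_mono unfolding admissible_def by metis
    then show False using p(1) by simp
  qed
  ultimately consider "b = {x}" | "b = {y}" | "b = {x, y}" by (metis subset_insert_iff subset_singletonD insert_Diff empty_iff)
  then show ?thesis
  proof cases
    case 3
    then show ?thesis using coboundary_if_non_edge[OF 3 xy(3,4) _ _ un] xy(5) by simp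
  qed (rule coboundary_if_singleton[OF _ un], assumption)+
qed

end

section \<open>The second cotangent cohomology of a flag complex\<close>

text \<open>For polynomials in the vertices this is congruence modulo the Stanley--Reisner
  ideal.\<close>

definition face_eq :: "'v set set \<Rightarrow> 'v cpoly \<Rightarrow> 'v cpoly \<Rightarrow> bool" where
  "face_eq K p q \<longleftrightarrow> (\<forall>m. support m \<in> K \<longrightarrow> coefficient p m = coefficient q m)"

lemma face_eq_sym: "face_eq K p q \<Longrightarrow> face_eq K q p"
  and face_eq_trans [trans]: "face_eq K p q \<Longrightarrow> face_eq K q s \<Longrightarrow> face_eq K p s"
  and face_eq_add: "face_eq K p q \<Longrightarrow> face_eq K p' q' \<Longrightarrow> face_eq K (p + p') (q + q')"
  by (simp_all add: face_eq_def lookup_add)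

text \<open>Carries a value on \<open>t\<close> up to the common multiple \<open>l\<close>: dividing
  the degree \<alpha> - \<open>b\<close> + \<open>l\<close> by the cofactor \<open>l - t\<close>
  gives \<alpha> - \<open>b\<close> + \<open>t\<close>, which has no negative exponent iff
  \<open>b \<subseteq> t\<close>.\<close>

lemma coefficient_split:
  fixes \<alpha> :: "'v \<Rightarrow>\<^sub>0 nat"
  assumes "finite l" "t \<subseteq> l" "b \<subseteq> l" "support \<alpha> \<inter> b = {}"
  shows "coefficient (face_monomial (l - t) * p) (\<alpha> + indicator_monomial (l - b)) =
    (if b \<subseteq> t then coefficient p (\<alpha> + indicator_monomial (t - b)) else 0)"
proof -
  have "finite t" using assms(2,1) by (rule finite_subset)
  with assms(1) have fin: "finite (l - t)" "finite (l - b)" "finite (t - b)" by auto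
  have "l - t \<subseteq> support (\<alpha> + indicator_monomial (l - b)) \<longleftrightarrow> b \<subseteq> t"
    using assms by (auto simp: support_add support_indicator_monomial fin)
  moreover have "\<alpha> + indicator_monomial (l - b) - indicator_monomial (l - t) =
      \<alpha> + indicator_monomial (t - b)" if "b \<subseteq> t"
    by (rule poly_mapping_eqI)
      (use assms that fin in \<open>auto simp: lookup_add lookup_minus lookup_indicator_monomial\<close>)
  ultimately show ?thesis by (simp add: coefficient_face_monomial_mult fin)
qed

context flag_complex
begin

lemma finite_face: "p \<subseteq> V \<Longrightarrow> finite p"
  using finite_V finite_subset by blast

lemma finite_J: "finite J" using finite_V by simp

lemma simplicial_complex_K: "simplicial_complex K"
  unfolding simplicial_complex_def
proof (intro conjI ballI allI impI)
  have "K \<subseteq> Pow V" by (auto simp: clique_complex_def)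
  then show "finite K" using finite_V finite_subset by blast
  show "finite f" if "f \<in> K" for f using that finite_face by (auto simp: clique_complex_def)
  show "g \<in> K" if "f \<in> K" "g \<subseteq> f" for f g using that by (rule clique_complex_mono)
qed (simp add: clique_complex_def)

lemma vertices_K: "vertices K = V"
proof
  show "V \<subseteq> vertices K"
  proof
    fix x assume "x \<in> V"
    then have "{x} \<in> K" by (auto simp: clique_complex_def)
    then show "x \<in> vertices K" by blast
  qed
qed (auto simp: clique_complex_def)

lemma nonfaces_K: "nonfaces K = J"
  by (simp add: nonfaces_def vertices_K)

section \<open>Relations between the face monomials of nonfaces\<close>

definition relations :: "('v set \<Rightarrow> 'v cpoly) set" where
  "relations = {x \<in> J \<rightarrow>\<^sub>E polys V. (\<Sum>j\<in>J. x j * face_monomial j) = 0}"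

definition vplus :: "('v set \<Rightarrow> 'v cpoly) \<Rightarrow> ('v set \<Rightarrow> 'v cpoly) \<Rightarrow> 'v set \<Rightarrow> 'v cpoly" where
  "vplus x y = (\<lambda>j\<in>J. x j + y j)"

definition vscale :: "'v cpoly \<Rightarrow> ('v set \<Rightarrow> 'v cpoly) \<Rightarrow> 'v set \<Rightarrow> 'v cpoly" where
  "vscale a x = (\<lambda>j\<in>J. a * x j)"

lemma sum_restrict: "(\<Sum>j\<in>J. (\<lambda>j\<in>J. f j) j * g j) = (\<Sum>j\<in>J. f j * (g j :: 'v cpoly))"
  by (intro sum.cong) auto

lemma relations_vplus: "x \<in> relations \<Longrightarrow> y \<in> relations \<Longrightarrow> vplus x y \<in> relations"
  by (auto simp: relations_def vplus_def sum_restrict distrib_right sum.distrib intro!: polys_add)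

lemma relations_vscale: "x \<in> relations \<Longrightarrow> a \<in> polys V \<Longrightarrow> vscale a x \<in> relations"
  by (auto simp: relations_def vscale_def sum_restrict mult.assoc simp flip: sum_distrib_left intro!: polys_mult)

text \<open>The Taylor syzygy, in which both monomials are raised to their least common multiple. As
  a difference of two conditionals it is 0 for \<open>p = q\<close>.\<close>

definition syzygy :: "'v set \<Rightarrow> 'v set \<Rightarrow> 'v set \<Rightarrow> 'v cpoly" where
  "syzygy p q = (\<lambda>j\<in>J. (if j = p then face_monomial (q - p) else 0) - (if j = q then face_monomial (p - q) else 0))"

lemma sum_syzygy:
  assumes "p \<in> J" "q \<in> J"
  shows "(\<Sum>j\<in>J. syzygy p q j * u j) = face_monomial (q - p) * u p - face_monomial (p - q) * u q"
proof -
  have "(\<Sum>j\<in>J. syzygy p q j * u j) =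
    (\<Sum>j\<in>J. (if j = p then face_monomial (q - p) * u p else 0)) -
    (\<Sum>j\<in>J. (if j = q then face_monomial (p - q) * u q else 0))"
    unfolding sum_subtractf[symmetric]
    by (intro sum.cong) (simp_all only: syzygy_def restrict_apply' algebra_simps, auto)
  also have "\<dots> = face_monomial (q - p) * u p - face_monomial (p - q) * u q"
    using assms finite_J by (simp only: sum.delta if_True)
  finally show ?thesis .
qed

lemma face_monomial_diff_mult:
  assumes "p \<in> J" "q \<in> J"
  shows "face_monomial (q - p) * face_monomial p = (face_monomial (p \<union> q) :: 'v cpoly)"
proof -
  have "finite (q - p)" "finite p" "(q - p) \<inter> p = {}" using assms finite_face by auto
  from face_monomial_union[OF this] show ?thesis by (simp add: Un_commute)
qed

lemma syzygy_relation:
  assumes "p \<in> J" "q \<in> J"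
  shows "syzygy p q \<in> relations"
  using assms sum_syzygy[OF assms, of face_monomial]
    face_monomial_diff_mult[OF assms] face_monomial_diff_mult[OF assms(2,1)] finite_face
  by (auto simp: relations_def syzygy_def Un_commute intro!: polys_diff polys_face_monomial)

end

text \<open>\<open>C\<close> selects polynomial representatives for the values of a cocycle, so that
  linearity holds up to \<open>face_eq\<close>. The multiple of the syzygy in
  \<open>C_koszul\<close> is the Koszul relation of two basis vectors.\<close>

locale relation_map = flag_complex +
  fixes C :: "('a set \<Rightarrow> 'a cpoly) \<Rightarrow> 'a cpoly"
  assumes C_add: "\<And>x y. x \<in> relations \<Longrightarrow> y \<in> relations \<Longrightarrow> face_eq K (C (vplus x y)) (C x + C y)"
    and C_scale: "\<And>a x. a \<in> polys V \<Longrightarrow> x \<in> relations \<Longrightarrow> face_eq K (C (vscale a x)) (a * C x)"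
    and C_koszul: "\<And>p q. p \<in> J \<Longrightarrow> q \<in> J \<Longrightarrow> face_eq K (C (vscale (face_monomial (p \<inter> q)) (syzygy p q))) 0"
begin

text \<open>The part of degree \<alpha> - \<open>b\<close> on the syzygy of \<open>p\<close> and
  \<open>q\<close>, which itself has degree \<open>p \<union> q\<close>. If \<open>b\<close> is not
  inside \<open>p \<union> q\<close>, the true exponent is negative, which the set difference would
  hide.\<close>

definition component :: "('a \<Rightarrow>\<^sub>0 nat) \<Rightarrow> 'a set \<Rightarrow> 'a set \<Rightarrow> 'a set \<Rightarrow> complex" where
  "component \<alpha> b p q = (if b \<subseteq> p \<union> q
     then coefficient (C (syzygy p q)) (\<alpha> + indicator_monomial (p \<union> q - b)) else 0)"

text \<open>Raised to the common multiple \<open>l\<close>, the three syzygies telescope. The zero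
  relation is written as a multiple by 0 so that \<open>C_scale\<close> evaluates it.\<close>

lemma syzygy_triangle:
  assumes "p \<in> J" "q \<in> J" "s \<in> J" and l: "l = p \<union> q \<union> s"
  shows "vplus (vplus (vscale (face_monomial (l - (p \<union> q))) (syzygy p q))
      (vscale (face_monomial (l - (q \<union> s))) (syzygy q s)))
      (vscale (face_monomial (l - (s \<union> p))) (syzygy s p)) = vscale 0 (syzygy p q)"
proof
  fix j
  have mult: "face_monomial (l - (x \<union> y)) * face_monomial (y - x) = (face_monomial (l - x) :: 'a cpoly)"
    if "x \<subseteq> l" "y \<subseteq> l" for x y
  proof -
    have "finite l" using assms finite_face by auto
    then have "finite (l - (x \<union> y))" "finite (y - x)" using that(2) by (auto intro: finite_subset)
    moreover have "l - x = (l - (x \<union> y)) \<union> (y - x)" "(l - (x \<union> y)) \<inter> (y - x) = {}" using that by auto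
    ultimately show ?thesis using face_monomial_union[of "l - (x \<union> y)" "y - x"] by metis
  qed
  have *: "face_monomial (l - (x \<union> y)) * (if P then face_monomial (y - x) else 0) =
     (if P then face_monomial (l - x) else 0 :: 'a cpoly)"
    "face_monomial (l - (y \<union> x)) * (if P then face_monomial (y - x) else 0) =
     (if P then face_monomial (l - x) else 0 :: 'a cpoly)" if "x \<subseteq> l" "y \<subseteq> l" for x y P
    using mult[OF that] by (simp_all add: Un_commute)
  have "p \<subseteq> l" "q \<subseteq> l" "s \<subseteq> l" using l by auto
  then show "vplus (vplus (vscale (face_monomial (l - (p \<union> q))) (syzygy p q))
      (vscale (face_monomial (l - (q \<union> s))) (syzygy q s)))
      (vscale (face_monomial (l - (s \<union> p))) (syzygy s p)) j = vscale 0 (syzygy p q) j"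
    by (cases "j \<in> J") (simp_all only: vplus_def vscale_def syzygy_def restrict_apply
        right_diff_distrib * mult_zero_left if_True if_False, simp_all)
qed

text \<open>The cocycle equation is \<open>syzygy_triangle\<close> read at the degree \<alpha> -
  \<open>b\<close> + \<open>l\<close>. In the Koszul condition the monomial of
  \<open>p \<inter> q\<close> is cancelled, which is legitimate because the exponent before
  cancelling still has face support.\<close>

lemma graded_cocycle_component:
  assumes "support \<alpha> \<inter> b = {}"
  shows "graded_cocycle V R (support \<alpha>) b (component \<alpha> b)"
proof
  fix p q s assume J: "p \<in> J" "q \<in> J" "s \<in> J" and b: "b \<subseteq> p \<union> q \<union> s"
    and K: "support \<alpha> \<union> (p \<union> q \<union> s - b) \<in> K"
  define l where "l = p \<union> q \<union> s"
  have fin: "finite l" using J finite_face by (auto simp: l_def)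
  define n where "n = \<alpha> + indicator_monomial (l - b)"
  have nK: "support n \<in> K" using K fin by (simp add: n_def l_def support_add support_indicator_monomial)
  have mon: "face_monomial (l - t) \<in> polys V" for t
    using J fin by (intro polys_face_monomial) (auto simp: l_def)
  have comp: "coefficient (C (vscale (face_monomial (l - (x \<union> y))) (syzygy x y))) n = component \<alpha> b x y"
    if "x \<in> J" "y \<in> J" "x \<subseteq> l" "y \<subseteq> l" for x y
  proof -
    have "coefficient (C (vscale (face_monomial (l - (x \<union> y))) (syzygy x y))) n =
        coefficient (face_monomial (l - (x \<union> y)) * C (syzygy x y)) n"
      using C_scale[OF mon syzygy_relation] that nK by (simp add: face_eq_def)
    then show ?thesis using coefficient_split[OF fin, of "x \<union> y" b \<alpha>] that b assms
      by (simp add: n_def component_def l_def)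
  qed
  let ?x = "vscale (face_monomial (l - (p \<union> q))) (syzygy p q)"
  let ?y = "vscale (face_monomial (l - (q \<union> s))) (syzygy q s)"
  let ?z = "vscale (face_monomial (l - (s \<union> p))) (syzygy s p)"
  have rel: "?x \<in> relations" "?y \<in> relations" "?z \<in> relations"
    using J by (auto intro!: relations_vscale mon syzygy_relation)
  have "coefficient (C (vplus (vplus ?x ?y) ?z)) n = coefficient (C ?x) n + coefficient (C ?y) n + coefficient (C ?z) n"
    using C_add[OF relations_vplus[OF rel(1,2)] rel(3)] C_add[OF rel(1,2)] nK
    by (simp add: face_eq_def lookup_add)
  moreover have "coefficient (C (vplus (vplus ?x ?y) ?z)) n = 0"
    unfolding syzygy_triangle[OF J l_def]
    using C_scale[OF polys_0 syzygy_relation[OF J(1,2)]] nK by (simp add: face_eq_def)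
  moreover have "p \<subseteq> l" "q \<subseteq> l" "s \<subseteq> l" by (auto simp: l_def)
  ultimately show "component \<alpha> b p q + component \<alpha> b q s + component \<alpha> b s p = 0"
    using comp J by simp
next
  fix p q assume J: "p \<in> J" "q \<in> J" and b: "b \<subseteq> p \<union> q"
    and K: "support \<alpha> \<union> (p \<union> q - b) \<union> (p \<inter> q) \<in> K"
  have fin: "finite p" "finite q" using J finite_face by auto
  have mon: "face_monomial (p \<inter> q) \<in> polys V" using fin J by (intro polys_face_monomial) auto
  define n where "n = \<alpha> + indicator_monomial (p \<union> q - b)"
  have "support (indicator_monomial (p \<inter> q) + n) \<in> K"
    using K fin by (simp add: n_def support_add support_indicator_monomial Un_ac)
  then have "coefficient (face_monomial (p \<inter> q) * C (syzygy p q)) (indicator_monomial (p \<inter> q) + n) = 0"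
    using C_koszul[OF J] C_scale[OF mon syzygy_relation[OF J]] by (simp add: face_eq_def)
  then have "coefficient (C (syzygy p q)) n = 0"
    using fin coefficient_single_mult[of "indicator_monomial (p \<inter> q)" 1 "C (syzygy p q)" n]
    by (simp add: face_monomial_eq)
  then show "component \<alpha> b p q = 0" by (simp add: component_def n_def)
next
  show "support \<alpha> \<inter> b = {}" by (rule assms)
next
  fix p q assume "\<not> b \<subseteq> p \<union> q"
  then show "component \<alpha> b p q = 0" by (simp only: component_def if_False)
qed

text \<open>The degrees with a nonzero component. There are finitely many, so solutions found degree
  by degree can be put together to polynomials.\<close>

definition relevant :: "(('a \<Rightarrow>\<^sub>0 nat) \<times> 'a set) set" where
  "relevant = {(\<alpha>, b). \<exists>p\<in>J. \<exists>q\<in>J. component \<alpha> b p q \<noteq> 0}"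

lemma finite_relevant: "finite relevant"
proof (rule finite_subset)
  let ?f = "\<lambda>(p, q, b, n). (n - indicator_monomial (p \<union> q - b), b)"
  show "relevant \<subseteq> ?f ` (SIGMA p:J. SIGMA q:J. Pow V \<times> Poly_Mapping.keys (C (syzygy p q)))"
  proof (rule subsetI, unfold relevant_def, clarify)
    fix \<alpha> b p q assume pq: "p \<subseteq> V" "p \<notin> K" "q \<subseteq> V" "q \<notin> K" "component \<alpha> b p q \<noteq> 0"
    then have "b \<subseteq> p \<union> q" by (auto simp: component_def split: if_splits)
    then have "b \<in> Pow V" using pq by auto
    moreover have "\<alpha> + indicator_monomial (p \<union> q - b) \<in> Poly_Mapping.keys (C (syzygy p q))"
      using pq by (auto simp: component_def in_keys_iff split: if_splits)
    ultimately show "(\<alpha>, b) \<in> ?f ` (SIGMA p:J. SIGMA q:J. Pow V \<times> Poly_Mapping.keys (C (syzygy p q)))"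
      using pq by (intro image_eqI[of _ _ "(p, q, b, \<alpha> + indicator_monomial (p \<union> q - b))"]) auto
  qed
  show "finite (?f ` (SIGMA p:J. SIGMA q:J. Pow V \<times> Poly_Mapping.keys (C (syzygy p q))))"
    by (intro finite_imageI finite_SigmaI finite_J finite_cartesian_product finite_keys)
      (simp add: finite_V)
qed

lemma exists_primitive_on_syzygies:
  assumes un: "unobstructed V R"
  shows "\<exists>u. (\<forall>p. u p \<in> polys V) \<and> (\<forall>p\<in>J. \<forall>q\<in>J.
    face_eq K (C (syzygy p q)) (face_monomial (q - p) * u p - face_monomial (p - q) * u q))"
proof -
  \<comment> \<open>Degrees that are not relevant receive the zero solution; an arbitrary one could
    lead to infinitely many terms.\<close>
  have "\<exists>\<mu>. support \<alpha> \<inter> b = {} \<longrightarrow>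
      graded_cocycle.coboundary V R (support \<alpha>) b (component \<alpha> b) \<mu> \<and>
      ((\<alpha>, b) \<notin> relevant \<longrightarrow> \<mu> = (\<lambda>_. 0))" for \<alpha> b
  proof (cases "support \<alpha> \<inter> b = {}")
    case True
    interpret g: graded_cocycle V R "support \<alpha>" b "component \<alpha> b"
      using True by (rule graded_cocycle_component)
    show ?thesis
    proof (cases "(\<alpha>, b) \<in> relevant")
      case True
      then show ?thesis using g.coboundary_exists[OF un] by blast
    next
      case False
      then have "g.coboundary (\<lambda>_. 0)" by (auto simp: g.coboundary_def relevant_def)
      then show ?thesis by blast
    qed
  qed simp
  then obtain \<mu> where \<mu>: "\<And>\<alpha> b. support \<alpha> \<inter> b = {} \<Longrightarrow>
      graded_cocycle.coboundary V R (support \<alpha>) b (component \<alpha> b) (\<mu> \<alpha> b)"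
    and \<mu>0: "\<And>\<alpha> b. support \<alpha> \<inter> b = {} \<Longrightarrow> (\<alpha>, b) \<notin> relevant \<Longrightarrow> \<mu> \<alpha> b = (\<lambda>_. 0)" by metis
  \<comment> \<open>The exponent \<open>n\<close> at \<open>p\<close> belongs to the degree
    \<open>n\<close> - \<open>p\<close>: the truncated difference is its positive part, and the
    points of \<open>p\<close> missing in \<open>n\<close> are its negative part. Exponents without
    face support are 0 in the quotient.\<close>
  define f where "f p n = (if p \<subseteq> V \<and> support n \<in> K then \<mu> (n - indicator_monomial p) (p - support n) p else 0)"
    for p n
  define u where "u p = Abs_poly_mapping (f p)" for p
  have disj: "support (n - indicator_monomial p) \<inter> (p - support n) = {}" for n p
    by (auto simp: in_keys_iff lookup_minus)
  have "finite {n. f p n \<noteq> 0}" for p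
  proof (rule finite_subset)
    show "{n. f p n \<noteq> 0} \<subseteq> (\<lambda>(\<alpha>, b). \<alpha> + indicator_monomial (p - b)) ` relevant"
    proof (rule subsetI, clarify)
      fix n assume n: "f p n \<noteq> 0"
      then have p: "finite p" using finite_face by (auto simp: f_def split: if_splits)
      have "n = (n - indicator_monomial p) + indicator_monomial (p - (p - support n))"
        by (rule poly_mapping_eqI)
          (use p in \<open>auto simp: lookup_add lookup_minus lookup_indicator_monomial in_keys_iff\<close>)
      moreover have "(n - indicator_monomial p, p - support n) \<in> relevant"
      proof (rule ccontr)
        assume "(n - indicator_monomial p, p - support n) \<notin> relevant"
        then show False using n \<mu>0[OF disj] by (simp add: f_def split: if_splits)
      qed
      ultimately show "n \<in> (\<lambda>(\<alpha>, b). \<alpha> + indicator_monomial (p - b)) ` relevant" by force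
    qed
  qed (use finite_relevant in simp)
  then have coeff_u: "coefficient (u p) n = f p n" for p n
    by (simp add: u_def lookup_Abs_poly_mapping)
  have "u p \<in> polys V" for p
  proof -
    have "support m \<in> K" if "m \<in> Poly_Mapping.keys (u p)" for m
      using that by (simp add: in_keys_iff coeff_u f_def split: if_splits)
    then show ?thesis by (auto simp: polys_def clique_complex_def)
  qed
  moreover have "face_eq K (C (syzygy p q)) (face_monomial (q - p) * u p - face_monomial (p - q) * u q)"
    if J: "p \<in> J" "q \<in> J" for p q
    unfolding face_eq_def
  proof (intro allI impI)
    fix n assume nK: "support n \<in> K"
    have fin: "finite p" "finite q" "finite (p \<union> q)" using J finite_face by auto
    define \<alpha> where "\<alpha> = n - indicator_monomial (p \<union> q)"
    define b where "b = p \<union> q - support n"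
    have \<alpha>b: "support \<alpha> \<inter> b = {}" unfolding \<alpha>_def b_def by (rule disj)
    have n: "n = \<alpha> + indicator_monomial (p \<union> q - b)"
      by (rule poly_mapping_eqI)
        (use fin in \<open>auto simp: \<alpha>_def b_def lookup_add lookup_minus lookup_indicator_monomial in_keys_iff\<close>)
    then have supp: "support n = support \<alpha> \<union> (p \<union> q - b)"
      using fin by (simp add: support_add support_indicator_monomial)
    interpret g: graded_cocycle V R "support \<alpha>" b "component \<alpha> b"
      using \<alpha>b by (rule graded_cocycle_component)
    have b: "b \<subseteq> p \<union> q" by (auto simp: b_def)
    have \<alpha>0: "Poly_Mapping.lookup \<alpha> v = 0" if "v \<in> b" for v
      using that \<alpha>b by (auto simp flip: not_in_keys_iff_lookup_eq_zero)
    have u: "coefficient (u t) (\<alpha> + indicator_monomial (t - b)) = \<mu> \<alpha> b t"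
      if t: "t \<subseteq> p \<union> q" "b \<subseteq> t" for t
    proof -
      have ft: "finite t" using t fin finite_subset by blast
      then have st: "support (\<alpha> + indicator_monomial (t - b)) = support \<alpha> \<union> (t - b)"
        by (simp add: support_add support_indicator_monomial)
      have "support (\<alpha> + indicator_monomial (t - b)) \<in> K"
      proof (rule clique_complex_mono[OF nK])
        show "support (\<alpha> + indicator_monomial (t - b)) \<subseteq> support n" using supp st t by auto
      qed
      moreover have "\<alpha> + indicator_monomial (t - b) - indicator_monomial t = \<alpha>"
        by (rule poly_mapping_eqI)
          (use ft \<alpha>0 in \<open>auto simp: lookup_add lookup_minus lookup_indicator_monomial\<close>)
      moreover have "t - support (\<alpha> + indicator_monomial (t - b)) = b"
        using st \<alpha>b t by auto
      moreover have "t \<subseteq> V" using t J by auto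
      ultimately show ?thesis by (simp add: coeff_u f_def)
    qed
    \<comment> \<open>Used for \<open>t = p\<close> and \<open>t = q\<close>, both in the degree
      determined by \<open>n\<close> and \<open>p \<union> q\<close>.\<close>
    have split: "coefficient (face_monomial (p \<union> q - t) * u t) n = (if b \<subseteq> t then \<mu> \<alpha> b t else 0)"
      if "t \<subseteq> p \<union> q" for t
      using coefficient_split[OF fin(3) that b \<alpha>b] u[OF that] by (simp flip: n)
    have "coefficient (C (syzygy p q)) n = component \<alpha> b p q"
      using b n by (simp add: component_def)
    also have "\<dots> = (if b \<subseteq> p then \<mu> \<alpha> b p else 0) - (if b \<subseteq> q then \<mu> \<alpha> b q else 0)"
      using \<mu>[OF \<alpha>b] J b nK supp by (auto simp: g.coboundary_def g.admissible_def)
    also have "\<dots> = coefficient (face_monomial (q - p) * u p - face_monomial (p - q) * u q) n"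
    proof -
      have "p \<union> q - p = q - p" "p \<union> q - q = p - q" by auto
      then show ?thesis using split[of p] split[of q] by (simp add: lookup_minus)
    qed
    finally show "coefficient (C (syzygy p q)) n =
        coefficient (face_monomial (q - p) * u p - face_monomial (p - q) * u q) n" .
  qed
  ultimately show ?thesis by blast
qed

section \<open>Reduction of relations to syzygies\<close>

lemma relation_reduction:
  assumes x: "x \<in> relations" and m: "p \<in> J" "m \<in> Poly_Mapping.keys (x p)"
  shows "\<exists>y q k. y \<in> relations \<and> q \<in> J \<and> support k \<subseteq> V \<and>
    x = vplus y (vscale (Poly_Mapping.single k (coefficient (x p) m)) (syzygy p q)) \<and>
    (\<Sum>j\<in>J. card (Poly_Mapping.keys (y j))) < (\<Sum>j\<in>J. card (Poly_Mapping.keys (x j)))"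
proof -
  let ?n = "m + indicator_monomial p"
  let ?c = "coefficient (x p) m"
  have xV: "x j \<in> polys V" if "j \<in> J" for j using x that by (auto simp: relations_def)
  have fin: "finite j" if "j \<in> J" for j using that finite_face by auto
  define g where "g j = coefficient (x j * face_monomial j) ?n" for j
  have "sum g J = coefficient (\<Sum>j\<in>J. x j * face_monomial j) ?n" by (simp add: g_def lookup_sum)
  also have "\<dots> = 0" using x by (simp add: relations_def)
  finally have "g p + sum g (J - {p}) = 0" using sum.remove[OF finite_J m(1), of g] by simp
  moreover have "g p = ?c" using coefficient_single_mult[of "indicator_monomial p" 1 "x p" m] fin[OF m(1)]
    by (simp add: g_def face_monomial_eq mult.commute add.commute)
  moreover have "?c \<noteq> 0" using m by (simp add: in_keys_iff)
  ultimately have "sum g (J - {p}) \<noteq> 0" by auto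
  \<comment> \<open>The term \<open>m\<close> at \<open>p\<close> must be cancelled by a term of the
    same total exponent at another nonface \<open>q\<close>. Subtracting a multiple of the syzygy
    deletes the first and changes only the coefficient of the second, so the number of terms
    drops.\<close>
  then obtain q where "q \<in> J - {p}" and gq0: "g q \<noteq> 0" by (rule sum.not_neutral_contains_not_neutral)
  then have q: "q \<in> J" "q \<noteq> p" "g q \<noteq> 0" by blast+
  have gq: "g q = (if q \<subseteq> support ?n then coefficient (x q) (?n - indicator_monomial q) else 0)"
    using coefficient_face_monomial_mult[OF fin[OF q(1)], of "x q" ?n] by (simp add: g_def mult.commute)
  define k where "k = m - indicator_monomial (q - p)"
  have fpq: "finite p" "finite q" "finite (q - p)" "finite (p - q)" using fin m q by auto
  have qm: "q - p \<subseteq> support m" using gq q(3) fpq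
    by (auto simp: support_add support_indicator_monomial split: if_splits)
  have mk: "m = k + indicator_monomial (q - p)"
  proof (rule poly_mapping_eqI)
    fix v
    have "Poly_Mapping.lookup m v \<ge> of_bool (v \<in> q - p)" using qm by (auto simp: in_keys_iff Suc_le_eq)
    then show "Poly_Mapping.lookup m v = Poly_Mapping.lookup (k + indicator_monomial (q - p)) v"
      using fpq by (simp add: k_def lookup_add lookup_minus lookup_indicator_monomial)
  qed
  define m' where "m' = k + indicator_monomial (p - q)"
  have "?n - indicator_monomial q = m'"
    by (rule poly_mapping_eqI, subst mk)
      (use fpq in \<open>auto simp: m'_def lookup_add lookup_minus lookup_indicator_monomial\<close>)
  then have m': "m' \<in> Poly_Mapping.keys (x q)" using gq q(3) by (auto simp: in_keys_iff split: if_splits)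
  have "support k \<subseteq> support m" by (subst mk) (simp add: support_add)
  then have kV: "support k \<subseteq> V" using xV[OF m(1)] m(2) by (auto simp: polys_def)
  define z where "z = vscale (Poly_Mapping.single k ?c) (syzygy p q)"
  have z: "z \<in> relations" unfolding z_def using m q kV by (intro relations_vscale syzygy_relation polys_single)
  define y where "y = vplus x (vscale (- 1) z)"
  have y: "y \<in> relations" unfolding y_def using x z by (intro relations_vplus relations_vscale) auto
  have y_eq: "y j = x j - z j" if "j \<in> J" for j using that by (simp add: y_def vplus_def vscale_def)
  have "x = vplus y z"
  proof
    fix j show "x j = vplus y z j"
      using x y_eq[of j] by (cases "j \<in> J") (auto simp: vplus_def relations_def PiE_def extensional_def)
  qed
  moreover have "(\<Sum>j\<in>J. card (Poly_Mapping.keys (y j))) < (\<Sum>j\<in>J. card (Poly_Mapping.keys (x j)))"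
  proof (rule sum_strict_mono_ex1)
    have zp: "z p = Poly_Mapping.single m ?c"
      using m q fpq by (simp add: z_def vscale_def syzygy_def face_monomial_eq mult_single flip: mk)
    have zq: "z q = - Poly_Mapping.single m' ?c"
      using m q fpq by (simp add: z_def vscale_def syzygy_def face_monomial_eq mult_single flip: m'_def)
    have zj: "z j = 0" if "j \<in> J" "j \<noteq> p" "j \<noteq> q" for j using that by (simp add: z_def vscale_def syzygy_def)
    have keys: "Poly_Mapping.keys (y j) \<subseteq> Poly_Mapping.keys (x j)" if "j \<in> J" for j
    proof -
      consider "j = p" | "j = q" | "j \<noteq> p" "j \<noteq> q" by blast
      then show ?thesis
      proof cases
        case 1 then show ?thesis using y_eq[OF that] zp m
          by (auto simp: in_keys_iff lookup_minus lookup_single when_def split: if_splits)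
      next
        case 2 then show ?thesis using y_eq[OF that] zq m'
          by (auto simp: in_keys_iff lookup_add lookup_single when_def split: if_splits)
      next
        case 3 then show ?thesis using y_eq[OF that] zj[OF that] by simp
      qed
    qed
    then show "\<forall>j\<in>J. card (Poly_Mapping.keys (y j)) \<le> card (Poly_Mapping.keys (x j))" by (simp add: card_mono)
    have "m \<notin> Poly_Mapping.keys (y p)" using y_eq[OF m(1)] zp by (simp add: in_keys_iff lookup_minus)
    then have "Poly_Mapping.keys (y p) \<subset> Poly_Mapping.keys (x p)" using keys[OF m(1)] m(2) by blast
    then show "\<exists>j\<in>J. card (Poly_Mapping.keys (y j)) < card (Poly_Mapping.keys (x j))"
      using m(1) by (intro bexI[of _ p]) (simp_all add: psubset_card_mono)
  qed (rule finite_J)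
  ultimately show ?thesis using y q(1) kV unfolding z_def by blast
qed

text \<open>The syzygies generate all relations: induction on the number of terms, with
  \<open>relation_reduction\<close> as the descent.\<close>

lemma exists_primitive:
  assumes un: "unobstructed V R"
  shows "\<exists>u. (\<forall>p. u p \<in> polys V) \<and> (\<forall>x\<in>relations. face_eq K (C x) (\<Sum>j\<in>J. x j * u j))"
proof -
  obtain u where uV: "\<And>p. u p \<in> polys V"
    and u: "\<And>p q. p \<in> J \<Longrightarrow> q \<in> J \<Longrightarrow>
      face_eq K (C (syzygy p q)) (face_monomial (q - p) * u p - face_monomial (p - q) * u q)"
    using exists_primitive_on_syzygies[OF un] by blast
  have "face_eq K (C x) (\<Sum>j\<in>J. x j * u j)" if "x \<in> relations" for x
    using that
  proof (induction "\<Sum>j\<in>J. card (Poly_Mapping.keys (x j))" arbitrary: x rule: less_induct)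
    case less
    show ?case
    proof (cases "\<forall>p\<in>J. x p = 0")
      case True
      then have "x = vscale 0 x"
        using less(2) by (auto simp: vscale_def relations_def PiE_def extensional_def fun_eq_iff)
      then have "face_eq K (C x) 0" using C_scale[OF polys_0 less(2)] by simp
      then show ?thesis using True by simp
    next
      case False
      then obtain p m where p: "p \<in> J" "m \<in> Poly_Mapping.keys (x p)" by (auto simp: ex_in_conv simp flip: keys_eq_empty)
      obtain y q k where y: "y \<in> relations" "q \<in> J" "support k \<subseteq> V"
        and x: "x = vplus y (vscale (Poly_Mapping.single k (coefficient (x p) m)) (syzygy p q))"
        and lt: "(\<Sum>j\<in>J. card (Poly_Mapping.keys (y j))) < (\<Sum>j\<in>J. card (Poly_Mapping.keys (x j)))"
        using relation_reduction[OF less(2) p] by blast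
      define t where "t = Poly_Mapping.single k (coefficient (x p) m)"
      have x: "x = vplus y (vscale t (syzygy p q))" using x by (simp add: t_def)
      have t: "t \<in> polys V" using y by (simp add: t_def polys_single)
      note s = syzygy_relation[OF p(1) y(2)]
      define d where "d = face_monomial (q - p) * u p - face_monomial (p - q) * u q"
      \<comment> \<open>Multiplying by a single term respects \<open>face_eq\<close>, since a
        divisor of a monomial with face support has face support.\<close>
      have ideal: "face_eq K (t * C (syzygy p q)) (t * d)"
      proof -
        have "t = Poly_Mapping.single k (coefficient (x p) m)" by (simp add: t_def)
        moreover have "coefficient (t * C (syzygy p q)) n = coefficient (t * d) n" if "support n \<in> K" for n
        proof (cases "\<exists>l. n = k + l")
          case True
          then obtain l where l: "n = k + l" by blast
          then have "support l \<in> K" using that clique_complex_mono[of "support n" V R] by (auto simp: support_add)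
          then show ?thesis using u[OF p(1) y(2)] unfolding l t_def coefficient_single_mult
            by (simp add: face_eq_def d_def)
        next
          case False
          then show ?thesis by (simp add: t_def coefficient_single_mult_eq_0)
        qed
        ultimately show ?thesis by (simp add: face_eq_def)
      qed
      have "face_eq K (C x) (C y + C (vscale t (syzygy p q)))"
        using C_add[OF y(1) relations_vscale[OF s t]] x by simp
      also have "face_eq K (C y + C (vscale t (syzygy p q))) ((\<Sum>j\<in>J. y j * u j) + t * d)"
        by (intro face_eq_add less(1)[OF lt y(1)] face_eq_trans[OF C_scale[OF t s] ideal])
      also have "(\<Sum>j\<in>J. y j * u j) + t * d = (\<Sum>j\<in>J. x j * u j)"
      proof -
        have "t * d = (\<Sum>j\<in>J. t * (syzygy p q j * u j))"
          by (simp only: d_def sum_syzygy[OF p(1) y(2), of u, symmetric] sum_distrib_left)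
        then have "(\<Sum>j\<in>J. y j * u j) + t * d = (\<Sum>j\<in>J. y j * u j + t * (syzygy p q j * u j))"
          by (simp only: sum.distrib)
        also have "\<dots> = (\<Sum>j\<in>J. x j * u j)"
          by (intro sum.cong refl, subst x)
            (simp only: vplus_def vscale_def restrict_apply' distrib_right mult.assoc)
        finally show ?thesis .
      qed
      finally show ?thesis .
    qed
  qed
  then show ?thesis using uV by blast
qed

end

section \<open>The quotient ring and the group of cocycles\<close>

context flag_complex
begin

abbreviation "P \<equiv> poly_ring V"

abbreviation "I \<equiv> nonface_polys K"

lemma ideal_I: "ideal I P"
  using ideal_nonface_polys[OF simplicial_complex_K] by (simp add: vertices_K)

lemma genideal_I: "Idl\<^bsub>P\<^esub> (face_monomial ` J) = I"
  using stanley_reisner_ideal_eq[OF simplicial_complex_K] by (simp add: vertices_K nonfaces_K)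

lemma coset_eq_iff:
  assumes "p \<in> polys V" "q \<in> polys V"
  shows "I +>\<^bsub>P\<^esub> p = I +>\<^bsub>P\<^esub> q \<longleftrightarrow> face_eq K p q"
proof -
  interpret ring P by (rule ring_poly_ring)
  have "I +>\<^bsub>P\<^esub> p = I +>\<^bsub>P\<^esub> q \<longleftrightarrow> p \<ominus>\<^bsub>P\<^esub> q \<in> I"
    using quotient_eq_iff_same_a_r_cos[OF ideal_I, of p q] assms by simp
  also have "\<dots> \<longleftrightarrow> face_eq K p q"
    using assms by (simp add: nonface_polys_def vertices_K face_eq_def lookup_minus)
  finally show ?thesis .
qed

lemma quotient_carrier: "X \<in> carrier (P Quot I) \<longleftrightarrow> (\<exists>p\<in>polys V. X = I +>\<^bsub>P\<^esub> p)"
  by (auto simp: FactRing_def A_RCOSETS_def' a_r_coset_def')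

lemma quotient_add:
  "p \<in> polys V \<Longrightarrow> q \<in> polys V \<Longrightarrow>
    (I +>\<^bsub>P\<^esub> p) \<oplus>\<^bsub>P Quot I\<^esub> (I +>\<^bsub>P\<^esub> q) = I +>\<^bsub>P\<^esub> (p + q)"
  using ring_hom_add[OF ideal.rcos_ring_hom[OF ideal_I], of p q] by simp

lemma quotient_mult:
  "p \<in> polys V \<Longrightarrow> q \<in> polys V \<Longrightarrow>
    (I +>\<^bsub>P\<^esub> p) \<otimes>\<^bsub>P Quot I\<^esub> (I +>\<^bsub>P\<^esub> q) = I +>\<^bsub>P\<^esub> (p * q)"
  using ring_hom_mult[OF ideal.rcos_ring_hom[OF ideal_I], of p q] by simp

lemma quotient_zero: "\<zero>\<^bsub>P Quot I\<^esub> = I +>\<^bsub>P\<^esub> 0"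
  using ring_hom_zero[OF ideal.rcos_ring_hom[OF ideal_I] ring_poly_ring ideal.quotient_is_ring[OF ideal_I]]
  by simp

abbreviation "A \<equiv> quotient_module P I"

lemma A_sel:
  "carrier A = carrier (P Quot I)" "add A = add (P Quot I)" "zero A = zero (P Quot I)"
  "smult A a X = (I +>\<^bsub>P\<^esub> a) \<otimes>\<^bsub>P Quot I\<^esub> X"
  by (simp_all add: quotient_module_def)

lemma free_module_sel:
  "carrier (free_module P J) = J \<rightarrow>\<^sub>E polys V"
  "add (free_module P J) = vplus" "smult (free_module P J) = vscale"
  by (simp_all add: free_module_def vplus_def vscale_def fun_eq_iff)

lemma gen_map_eq:
  assumes "x \<in> J \<rightarrow>\<^sub>E polys V"
  shows "gen_map P J face_monomial x = (\<Sum>j\<in>J. x j * face_monomial j)"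
proof -
  have "x j * face_monomial j \<in> polys V" if "j \<in> J" for j
    using assms that finite_face by (intro polys_mult polys_face_monomial) auto
  then show ?thesis unfolding gen_map_def by (subst poly_ring_finsum[OF finite_J]) simp_all
qed

lemma relation_module_sel:
  "carrier (relation_module P J face_monomial) = relations"
  "add (relation_module P J face_monomial) = vplus" "smult (relation_module P J face_monomial) = vscale"
  by (auto simp: relation_module_def free_module_sel relations_def gen_map_eq)

lemma linear_mapsD:
  assumes "\<phi> \<in> linear_maps P (relation_module P J face_monomial) A"
  shows "\<phi> \<in> extensional relations" "x \<in> relations \<Longrightarrow> \<exists>p\<in>polys V. \<phi> x = I +>\<^bsub>P\<^esub> p"
    "x \<in> relations \<Longrightarrow> y \<in> relations \<Longrightarrow> \<phi> (vplus x y) = \<phi> x \<oplus>\<^bsub>P Quot I\<^esub> \<phi> y"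
    "a \<in> polys V \<Longrightarrow> x \<in> relations \<Longrightarrow> \<phi> (vscale a x) = (I +>\<^bsub>P\<^esub> a) \<otimes>\<^bsub>P Quot I\<^esub> \<phi> x"
  using assms
  by (auto simp: linear_maps_def relation_module_sel A_sel PiE_def Pi_def simp flip: quotient_carrier)

lemma vplus_PiE: "x \<in> J \<rightarrow>\<^sub>E polys V \<Longrightarrow> y \<in> J \<rightarrow>\<^sub>E polys V \<Longrightarrow> vplus x y \<in> J \<rightarrow>\<^sub>E polys V"
  unfolding vplus_def restrict_PiE_iff by (blast intro: polys_add PiE_mem)

lemma vscale_PiE: "a \<in> polys V \<Longrightarrow> x \<in> J \<rightarrow>\<^sub>E polys V \<Longrightarrow> vscale a x \<in> J \<rightarrow>\<^sub>E polys V"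
  unfolding vscale_def restrict_PiE_iff by (blast intro: polys_mult PiE_mem)

lemma combination_polys:
  "x \<in> J \<rightarrow>\<^sub>E polys V \<Longrightarrow> (\<And>j. j \<in> J \<Longrightarrow> u j \<in> polys V) \<Longrightarrow> (\<Sum>j\<in>J. x j * u j) \<in> polys V"
  by (intro polys_sum polys_mult) (erule (1) PiE_mem, blast)

lemma face_monomial_J: "p \<in> J \<Longrightarrow> face_monomial p \<in> polys V"
  using finite_face by simp

text \<open>The linear map on the free module whose value on the basis vector of \<open>j\<close> is
  the class of \<open>u j\<close>; its restriction to the relations will be the coboundary
  sought.\<close>

lemma sum_coset_linear:
  assumes u: "\<And>p. u p \<in> polys V"
  shows "(\<lambda>x\<in>J \<rightarrow>\<^sub>E polys V. I +>\<^bsub>P\<^esub> (\<Sum>j\<in>J. x j * u j)) \<in> linear_maps P (free_module P J) A"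
proof -
  have S: "(\<Sum>j\<in>J. x j * u j) \<in> polys V" if "x \<in> J \<rightarrow>\<^sub>E polys V" for x
    using that u by (intro polys_sum polys_mult) auto
  have "(\<Sum>j\<in>J. vplus x y j * u j) = (\<Sum>j\<in>J. x j * u j) + (\<Sum>j\<in>J. y j * u j)" for x y
    by (simp only: vplus_def sum_restrict distrib_right sum.distrib)
  moreover have "(\<Sum>j\<in>J. vscale a x j * u j) = a * (\<Sum>j\<in>J. x j * u j)" for a x
    by (simp only: vscale_def sum_restrict sum_distrib_left mult.assoc)
  ultimately show ?thesis
    using S vplus_PiE vscale_PiE unfolding linear_maps_def
    by (auto simp: free_module_sel A_sel quotient_add quotient_mult simp flip: quotient_carrier)
      (auto simp: quotient_carrier)
qed

lemma face_monomial_empty: "face_monomial {} = 1"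
  by (simp add: face_monomial_def)

text \<open>The Koszul relation of the basis vectors of \<open>q\<close> and \<open>p\<close> has
  the monomials of \<open>q\<close> and \<open>p\<close> as entries; their common factor splits off
  and leaves the syzygy.\<close>

lemma koszul_syzygy:
  assumes "p \<in> J" "q \<in> J"
  shows "vscale (face_monomial (p \<inter> q)) (syzygy p q) \<in> koszul_relations P J face_monomial"
proof -
  define e :: "'v set \<Rightarrow> 'v set \<Rightarrow> 'v cpoly" where "e s = (\<lambda>j\<in>J. if j = s then 1 else 0)" for s
  have e: "e s \<in> J \<rightarrow>\<^sub>E polys V" for s by (auto simp: e_def)
  have gen: "gen_map P J face_monomial (e s) = face_monomial s" if "s \<in> J" for s
  proof -
    have "(\<Sum>j\<in>J. e s j * face_monomial j) = (\<Sum>j\<in>J. if j = s then face_monomial s else 0)"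
      by (intro sum.cong) (auto simp: e_def)
    also have "\<dots> = face_monomial s" using that finite_J by (simp only: sum.delta if_True)
    finally show ?thesis using gen_map_eq[OF e] by simp
  qed
  have mult: "face_monomial (x \<inter> y) * face_monomial (y - x) = (face_monomial y :: 'v cpoly)" if "y \<in> J" for x y
  proof -
    have "finite (x \<inter> y)" "finite (y - x)" "(x \<inter> y) \<inter> (y - x) = {}" "(x \<inter> y) \<union> (y - x) = y"
      using that finite_face[of y] by auto
    then show ?thesis using face_monomial_union[of "x \<inter> y" "y - x"] by simp
  qed
  have mon: "face_monomial s \<in> polys V" if "s \<in> J" for s using that finite_face by auto
  have "vscale (face_monomial (p \<inter> q)) (syzygy p q) =
    (\<lambda>j\<in>J. gen_map P J face_monomial (e q) \<otimes>\<^bsub>P\<^esub> e p j \<ominus>\<^bsub>P\<^esub> gen_map P J face_monomial (e p) \<otimes>\<^bsub>P\<^esub> e q j)"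
  proof
    fix j
    have that: "j \<in> J \<Longrightarrow> face_monomial q * e p j \<in> polys V" "j \<in> J \<Longrightarrow> face_monomial p * e q j \<in> polys V"
      using PiE_mem[OF e] mon assms by (blast intro: polys_mult)+
    show "vscale (face_monomial (p \<inter> q)) (syzygy p q) j =
      (\<lambda>j\<in>J. gen_map P J face_monomial (e q) \<otimes>\<^bsub>P\<^esub> e p j \<ominus>\<^bsub>P\<^esub> gen_map P J face_monomial (e p) \<otimes>\<^bsub>P\<^esub> e q j) j"
    proof (cases "j \<in> J")
      case True
      have "gen_map P J face_monomial (e q) \<otimes>\<^bsub>P\<^esub> e p j \<ominus>\<^bsub>P\<^esub> gen_map P J face_monomial (e p) \<otimes>\<^bsub>P\<^esub> e q j =
          face_monomial q * e p j - face_monomial p * e q j"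
        using True that by (simp add: gen[OF assms(1)] gen[OF assms(2)])
      also have "\<dots> = face_monomial (p \<inter> q) * syzygy p q j"
        using True mult[OF assms(2), of p] mult[OF assms(1), of q]
        by (simp add: syzygy_def e_def right_diff_distrib Int_commute face_monomial_empty)
      finally show ?thesis using True by (simp only: vscale_def restrict_apply' simp_thms)
    next
      case False
      then show ?thesis by (simp only: vscale_def restrict_apply if_False)
    qed
  qed
  then show ?thesis unfolding koszul_relations_def free_module_sel using e by blast
qed

text \<open>Choosing representatives turns a cocycle into a \<open>relation_map\<close>, and a
  primitive of that extends it to the free module.\<close>

lemma cocycles_subset_coboundaries:
  assumes un: "unobstructed V R"
  shows "carrier (T2_cocycles P J face_monomial) \<subseteq> T2_coboundaries P J face_monomial"
proof
  fix \<phi> assume "\<phi> \<in> carrier (T2_cocycles P J face_monomial)"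
  then have lin: "\<phi> \<in> linear_maps P (relation_module P J face_monomial) A"
    and kos: "\<And>k. k \<in> koszul_relations P J face_monomial \<Longrightarrow> \<phi> k = I +>\<^bsub>P\<^esub> 0"
    by (simp_all add: T2_cocycles_def genideal_I Let_def A_sel quotient_zero)
  define C where "C x = (SOME p. p \<in> polys V \<and> \<phi> x = I +>\<^bsub>P\<^esub> p)" for x
  have C: "C x \<in> polys V" "\<phi> x = I +>\<^bsub>P\<^esub> C x" if "x \<in> relations" for x
    using someI_ex[of "\<lambda>p. p \<in> polys V \<and> \<phi> x = I +>\<^bsub>P\<^esub> p"] linear_mapsD(2)[OF lin that]
    unfolding C_def by blast+
  interpret relation_map V R C
  proof
    fix x y assume xy: "x \<in> relations" "y \<in> relations"
    have "I +>\<^bsub>P\<^esub> C (vplus x y) = I +>\<^bsub>P\<^esub> (C x + C y)"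
      using linear_mapsD(3)[OF lin xy] C xy relations_vplus by (simp add: quotient_add)
    then show "face_eq K (C (vplus x y)) (C x + C y)"
      using C xy relations_vplus by (simp add: coset_eq_iff)
  next
    fix a x assume ax: "a \<in> polys V" "x \<in> relations"
    have "I +>\<^bsub>P\<^esub> C (vscale a x) = I +>\<^bsub>P\<^esub> (a * C x)"
      using linear_mapsD(4)[OF lin ax] C ax relations_vscale by (simp add: quotient_mult)
    then show "face_eq K (C (vscale a x)) (a * C x)"
      using C ax relations_vscale by (simp add: coset_eq_iff)
  next
    fix p q assume pq: "p \<in> J" "q \<in> J"
    then have "vscale (face_monomial (p \<inter> q)) (syzygy p q) \<in> relations"
      using finite_face by (intro relations_vscale syzygy_relation polys_face_monomial) auto
    then show "face_eq K (C (vscale (face_monomial (p \<inter> q)) (syzygy p q))) 0"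
      using kos[OF koszul_syzygy[OF pq]] C by (simp flip: coset_eq_iff)
  qed
  obtain u where u: "\<And>p. u p \<in> polys V" "\<And>x. x \<in> relations \<Longrightarrow> face_eq K (C x) (\<Sum>j\<in>J. x j * u j)"
    using exists_primitive[OF un] by blast
  have "\<phi> = restrict (\<lambda>x\<in>J \<rightarrow>\<^sub>E polys V. I +>\<^bsub>P\<^esub> (\<Sum>j\<in>J. x j * u j)) relations"
  proof
    fix x
    show "\<phi> x = restrict (\<lambda>x\<in>J \<rightarrow>\<^sub>E polys V. I +>\<^bsub>P\<^esub> (\<Sum>j\<in>J. x j * u j)) relations x"
    proof (cases "x \<in> relations")
      case True
      then have x: "x \<in> J \<rightarrow>\<^sub>E polys V" by (simp add: relations_def)
      then have "(\<Sum>j\<in>J. x j * u j) \<in> polys V" using u(1) by (intro polys_sum polys_mult) auto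
      then show ?thesis using C[OF True] u(2)[OF True] True x by (simp add: coset_eq_iff)
    next
      case False
      then show ?thesis using linear_mapsD(1)[OF lin] by (simp add: extensional_def)
    qed
  qed
  then show "\<phi> \<in> T2_coboundaries P J face_monomial"
    unfolding T2_coboundaries_def genideal_I relation_module_sel
    using sum_coset_linear[OF u(1)] by (rule image_eqI)
qed

lemma mult_T2_cocycles:
  "mult (T2_cocycles P J face_monomial) = (\<lambda>\<phi> \<psi>. \<lambda>x\<in>relations. \<phi> x \<oplus>\<^bsub>P Quot I\<^esub> \<psi> x)"
  by (simp add: T2_cocycles_def Let_def relation_module_sel A_sel genideal_I)

lemma T2_coboundaries_iff:
  "\<phi> \<in> T2_coboundaries P J face_monomial \<longleftrightarrow>
    (\<exists>\<psi>\<in>linear_maps P (free_module P J) A. \<phi> = restrict \<psi> relations)"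
  unfolding T2_coboundaries_def genideal_I relation_module_sel by (rule image_iff)

lemma free_linear_maps_iff:
  "\<psi> \<in> linear_maps P (free_module P J) A \<longleftrightarrow>
    \<psi> \<in> extensional (J \<rightarrow>\<^sub>E polys V) \<and> (\<forall>x\<in>J \<rightarrow>\<^sub>E polys V. \<psi> x \<in> carrier (P Quot I)) \<and>
    (\<forall>x\<in>J \<rightarrow>\<^sub>E polys V. \<forall>y\<in>J \<rightarrow>\<^sub>E polys V. \<psi> (vplus x y) = \<psi> x \<oplus>\<^bsub>P Quot I\<^esub> \<psi> y) \<and>
    (\<forall>a\<in>polys V. \<forall>x\<in>J \<rightarrow>\<^sub>E polys V. \<psi> (vscale a x) = (I +>\<^bsub>P\<^esub> a) \<otimes>\<^bsub>P Quot I\<^esub> \<psi> x)"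
  unfolding linear_maps_def free_module_sel A_sel PiE_def Pi_def poly_ring_sel by blast

text \<open>Supplies a coset: together with the coincidence of all cosets this makes the quotient a
  one-point set, not an empty one.\<close>

lemma zero_T2_cocycles: "(\<lambda>x\<in>relations. \<zero>\<^bsub>P Quot I\<^esub>) \<in> carrier (T2_cocycles P J face_monomial)"
proof -
  interpret Q: cring "P Quot I" using ideal.quotient_is_cring[OF ideal_I cring_poly_ring] .
  have coset: "I +>\<^bsub>P\<^esub> a \<in> carrier (P Quot I)" if "a \<in> polys V" for a
    unfolding quotient_carrier using that by blast
  have "(\<lambda>x\<in>relations. \<zero>\<^bsub>P Quot I\<^esub>) \<in> linear_maps P (relation_module P J face_monomial) A"
    using coset relations_vplus relations_vscale
    by (auto simp: linear_maps_def relation_module_sel A_sel)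
  moreover have "koszul_relations P J face_monomial \<subseteq> relations"
  proof
    fix k assume "k \<in> koszul_relations P J face_monomial"
    then obtain x y where xy: "x \<in> J \<rightarrow>\<^sub>E polys V" "y \<in> J \<rightarrow>\<^sub>E polys V"
      and k: "k = (\<lambda>j\<in>J. gen_map P J face_monomial x \<otimes>\<^bsub>P\<^esub> y j \<ominus>\<^bsub>P\<^esub> gen_map P J face_monomial y \<otimes>\<^bsub>P\<^esub> x j)"
      unfolding koszul_relations_def free_module_sel by blast
    define s t where "s = (\<Sum>j\<in>J. x j * face_monomial j)" and "t = (\<Sum>j\<in>J. y j * face_monomial j)"
    have st: "s \<in> polys V" "t \<in> polys V"
      unfolding s_def t_def
      by (rule combination_polys[OF xy(1) face_monomial_J], assumption,
          rule combination_polys[OF xy(2) face_monomial_J], assumption)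
    have k: "k = (\<lambda>j\<in>J. s * y j - t * x j)"
      unfolding k gen_map_eq[OF xy(1)] gen_map_eq[OF xy(2)] s_def[symmetric] t_def[symmetric]
      using st PiE_mem[OF xy(1)] PiE_mem[OF xy(2)] by (intro restrict_ext) simp
    have "(\<Sum>j\<in>J. (s * y j - t * x j) * face_monomial j) = s * t - t * s"
      unfolding s_def t_def by (simp add: left_diff_distrib sum_subtractf mult.assoc sum_distrib_left)
    then show "k \<in> relations"
      using st PiE_mem[OF xy(1)] PiE_mem[OF xy(2)]
      by (simp add: k relations_def sum_restrict restrict_PiE_iff)
  qed
  ultimately show ?thesis by (auto simp: T2_cocycles_def Let_def genideal_I relation_module_sel A_sel)
qed

text \<open>\<^term>\<open>T2_coboundaries\<close> need not be shown to consist of cocycles: it is enough that it is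
  closed under sums and differences.\<close>

lemma trivial_T2:
  assumes un: "unobstructed V R"
  shows "trivial_T2 K"
proof -
  let ?Z = "T2_cocycles P J face_monomial" and ?B = "T2_coboundaries P J face_monomial"
  let ?F = "linear_maps P (free_module P J) A"
  interpret Q: cring "P Quot I" using ideal.quotient_is_cring[OF ideal_I cring_poly_ring] .
  have rel: "relations \<subseteq> J \<rightarrow>\<^sub>E polys V" by (auto simp: relations_def)
  have coset: "I +>\<^bsub>P\<^esub> a \<in> carrier (P Quot I)" if "a \<in> polys V" for a
    using that by (auto simp: quotient_carrier)
  note mult = mult_T2_cocycles and B = T2_coboundaries_iff
  define D where "D = J \<rightarrow>\<^sub>E polys V"
  have relD: "relations \<subseteq> D" using rel by (simp add: D_def)
  have clos: "vplus x y \<in> D" "vscale a x \<in> D" if "x \<in> D" "y \<in> D" "a \<in> polys V" for x y a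
    using that vplus_PiE vscale_PiE by (simp_all add: D_def)
  note F_iff = free_linear_maps_iff[folded D_def]
  have FD: "\<psi> x \<in> carrier (P Quot I)" if "\<psi> \<in> ?F" "x \<in> D" for \<psi> x
    using that F_iff by blast
  have plus: "(\<lambda>x\<in>D. \<psi> x \<oplus>\<^bsub>P Quot I\<^esub> \<chi> x) \<in> ?F" if "\<psi> \<in> ?F" "\<chi> \<in> ?F" for \<psi> \<chi>
    unfolding F_iff
  proof (intro conjI ballI)
    fix x y assume xy: "x \<in> D" "y \<in> D"
    have "\<psi> (vplus x y) = \<psi> x \<oplus>\<^bsub>P Quot I\<^esub> \<psi> y" "\<chi> (vplus x y) = \<chi> x \<oplus>\<^bsub>P Quot I\<^esub> \<chi> y"
      using that xy unfolding F_iff by blast+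
    then show "(\<lambda>x\<in>D. \<psi> x \<oplus>\<^bsub>P Quot I\<^esub> \<chi> x) (vplus x y) =
      (\<lambda>x\<in>D. \<psi> x \<oplus>\<^bsub>P Quot I\<^esub> \<chi> x) x \<oplus>\<^bsub>P Quot I\<^esub> (\<lambda>x\<in>D. \<psi> x \<oplus>\<^bsub>P Quot I\<^esub> \<chi> x) y"
      using xy clos(1)[OF xy polys_0] FD that by (simp add: Q.a_ac)
  next
    fix a x assume ax: "a \<in> polys V" "x \<in> D"
    have "\<psi> (vscale a x) = (I +>\<^bsub>P\<^esub> a) \<otimes>\<^bsub>P Quot I\<^esub> \<psi> x" "\<chi> (vscale a x) = (I +>\<^bsub>P\<^esub> a) \<otimes>\<^bsub>P Quot I\<^esub> \<chi> x"
      using that ax unfolding F_iff by blast+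
    then show "(\<lambda>x\<in>D. \<psi> x \<oplus>\<^bsub>P Quot I\<^esub> \<chi> x) (vscale a x) =
      (I +>\<^bsub>P\<^esub> a) \<otimes>\<^bsub>P Quot I\<^esub> (\<lambda>x\<in>D. \<psi> x \<oplus>\<^bsub>P Quot I\<^esub> \<chi> x) x"
      using ax clos(2)[OF ax(2,2,1)] FD that coset by (simp add: Q.r_distr)
  qed (use FD that in simp_all)
  have uminus: "(\<lambda>x\<in>D. \<ominus>\<^bsub>P Quot I\<^esub> \<psi> x) \<in> ?F" if "\<psi> \<in> ?F" for \<psi>
    unfolding F_iff
  proof (intro conjI ballI)
    fix x y assume xy: "x \<in> D" "y \<in> D"
    have "\<psi> (vplus x y) = \<psi> x \<oplus>\<^bsub>P Quot I\<^esub> \<psi> y" using that xy unfolding F_iff by blast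
    then show "(\<lambda>x\<in>D. \<ominus>\<^bsub>P Quot I\<^esub> \<psi> x) (vplus x y) =
      (\<lambda>x\<in>D. \<ominus>\<^bsub>P Quot I\<^esub> \<psi> x) x \<oplus>\<^bsub>P Quot I\<^esub> (\<lambda>x\<in>D. \<ominus>\<^bsub>P Quot I\<^esub> \<psi> x) y"
      using xy clos(1)[OF xy polys_0] FD that by (simp add: Q.minus_add)
  next
    fix a x assume ax: "a \<in> polys V" "x \<in> D"
    have "\<psi> (vscale a x) = (I +>\<^bsub>P\<^esub> a) \<otimes>\<^bsub>P Quot I\<^esub> \<psi> x" using that ax unfolding F_iff by blast
    then show "(\<lambda>x\<in>D. \<ominus>\<^bsub>P Quot I\<^esub> \<psi> x) (vscale a x) =
      (I +>\<^bsub>P\<^esub> a) \<otimes>\<^bsub>P Quot I\<^esub> (\<lambda>x\<in>D. \<ominus>\<^bsub>P Quot I\<^esub> \<psi> x) x"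
      using ax clos(2)[OF ax(2,2,1)] FD that coset by (simp add: Q.r_minus)
  qed (use FD that in simp_all)
  have coset_B: "?B #>\<^bsub>?Z\<^esub> \<phi> = ?B" if phi: "\<phi> \<in> ?B" for \<phi>
  proof
    obtain \<psi> where \<psi>: "\<psi> \<in> ?F" "\<phi> = restrict \<psi> relations" using phi[unfolded B] by blast
    show "?B #>\<^bsub>?Z\<^esub> \<phi> \<subseteq> ?B"
    proof
      fix \<theta> assume "\<theta> \<in> ?B #>\<^bsub>?Z\<^esub> \<phi>"
      then obtain \<eta> where "\<eta> \<in> ?B" "\<theta> = \<eta> \<otimes>\<^bsub>?Z\<^esub> \<phi>" by (auto simp: r_coset_def)
      moreover from \<open>\<eta> \<in> ?B\<close>[unfolded B] obtain \<chi> where "\<chi> \<in> ?F" "\<eta> = restrict \<chi> relations" by blast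
      ultimately have "\<theta> = restrict (\<lambda>x\<in>D. \<chi> x \<oplus>\<^bsub>P Quot I\<^esub> \<psi> x) relations"
        using \<psi> relD by (auto simp: mult fun_eq_iff restrict_def)
      then show "\<theta> \<in> ?B" unfolding B using plus[OF \<open>\<chi> \<in> ?F\<close> \<psi>(1)] by (rule bexI)
    qed
    show "?B \<subseteq> ?B #>\<^bsub>?Z\<^esub> \<phi>"
    proof
      fix \<theta> assume "\<theta> \<in> ?B"
      from this[unfolded B] obtain \<chi> where \<chi>: "\<chi> \<in> ?F" "\<theta> = restrict \<chi> relations" by blast
      define \<eta> where "\<eta> = restrict (\<lambda>x\<in>D. \<chi> x \<oplus>\<^bsub>P Quot I\<^esub> (\<lambda>x\<in>D. \<ominus>\<^bsub>P Quot I\<^esub> \<psi> x) x) relations"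
      have "\<eta> \<in> ?B" unfolding \<eta>_def B using plus[OF \<chi>(1) uminus[OF \<psi>(1)]] by (rule rev_bexI) (rule refl)
      moreover have "\<theta> = \<eta> \<otimes>\<^bsub>?Z\<^esub> \<phi>"
      proof
        fix x
        have "\<chi> x = (\<chi> x \<oplus>\<^bsub>P Quot I\<^esub> (\<ominus>\<^bsub>P Quot I\<^esub> \<psi> x)) \<oplus>\<^bsub>P Quot I\<^esub> \<psi> x" if "x \<in> D"
          using FD[OF \<chi>(1) that] FD[OF \<psi>(1) that] by (simp add: Q.a_assoc Q.l_neg)
        then show "\<theta> x = (\<eta> \<otimes>\<^bsub>?Z\<^esub> \<phi>) x"
          using relD by (cases "x \<in> relations") (auto simp: mult \<chi>(2) \<psi>(2) \<eta>_def)
      qed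
      ultimately show "\<theta> \<in> ?B #>\<^bsub>?Z\<^esub> \<phi>" by (auto simp: r_coset_def)
    qed
  qed
  \<comment> \<open>Every cocycle is a coboundary, and a coset by a coboundary is the set of
    coboundaries itself.\<close>
  have "carrier (?Z Mod ?B) = {?B}"
    using coset_B cocycles_subset_coboundaries[OF un] zero_T2_cocycles
    by (auto simp: FactGroup_def RCOSETS_def)
  then show ?thesis
    by (simp add: trivial_T2_def stanley_reisner_T2_def T2_group_def vertices_K nonfaces_K)
qed

end

section \<open>Building sets of intervals\<close>

definition non_neighbours :: "'v set \<Rightarrow> ('v \<Rightarrow> 'v \<Rightarrow> bool) \<Rightarrow> 'v \<Rightarrow> 'v set" where
  "non_neighbours L R v = {w \<in> L. w \<noteq> v \<and> \<not> R v w}"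

lemma coned_at_iff: "coned_at L R v \<longleftrightarrow> coned (non_neighbours L R v) R"
  by (simp add: coned_at_def non_neighbours_def)

lemma connected_at_iff:
  "connected_at L R v w \<longleftrightarrow>
    graph_connected ((non_neighbours L R v - {w}) \<union> (non_neighbours L R w - {v})) R"
proof -
  have "{y \<in> L. y \<noteq> v \<and> y \<noteq> w \<and> \<not> (R v y \<and> R w y)} =
      (non_neighbours L R v - {w}) \<union> (non_neighbours L R w - {v})"
    by (auto simp: non_neighbours_def)
  then show ?thesis by (simp add: connected_at_def)
qed

lemma graph_connected_propagate:
  assumes "graph_connected Y R" "x \<in> Y" "P x" "y \<in> Y"
    and "\<And>x y. x \<in> Y \<Longrightarrow> y \<in> Y \<Longrightarrow> P x \<Longrightarrow> R x y \<Longrightarrow> P y"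
  shows "P y"
proof -
  have step: "\<forall>x\<in>Y. \<forall>y\<in>Y. P x \<longrightarrow> R x y \<longrightarrow> P y" using assms(5) by blast
  have "(\<exists>x\<in>Y. P x) \<longrightarrow> (\<forall>x\<in>Y. P x)"
    using assms(1)[unfolded graph_connected_def, THEN spec, of P] step by (rule mp)
  then show ?thesis using assms(2-4) by blast
qed

lemma coned_image:
  assumes "inj_on f W" "\<And>x y. x \<in> W \<Longrightarrow> y \<in> W \<Longrightarrow> R' (f x) (f y) \<longleftrightarrow> R x y"
  shows "coned (f ` W) R' \<longleftrightarrow> coned W R"
  unfolding coned_def using assms by (simp add: inj_on_eq_iff)

lemma graph_connected_image:
  assumes inj: "inj_on f Y" and R: "\<And>x y. x \<in> Y \<Longrightarrow> y \<in> Y \<Longrightarrow> R' (f x) (f y) \<longleftrightarrow> R x y"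
    and conn: "graph_connected (f ` Y) R'"
  shows "graph_connected Y R"
  unfolding graph_connected_def
proof (intro allI impI)
  fix P assume step: "\<forall>x\<in>Y. \<forall>y\<in>Y. P x \<longrightarrow> R x y \<longrightarrow> P y" and ex: "\<exists>x\<in>Y. P x"
  define P' where "P' x = P (inv_into Y f x)" for x
  have P': "P' (f x) = P x" if "x \<in> Y" for x using inj that by (simp add: P'_def)
  have "\<forall>x\<in>f ` Y. \<forall>y\<in>f ` Y. P' x \<longrightarrow> R' x y \<longrightarrow> P' y"
    unfolding ball_simps using step P' R by simp
  then have "P' (f y)" if "x \<in> Y" "P' (f x)" "y \<in> Y" for x y
    using graph_connected_propagate[OF conn, of "f x" P' "f y"] that by blast
  then show "\<forall>x\<in>Y. P x" using P' ex by blast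
qed

lemma graph_connected_if_coned:
  assumes "coned Y R" "\<And>x y. R x y \<Longrightarrow> R y x"
  shows "graph_connected Y R"
  using assms unfolding coned_def graph_connected_def by (metis empty_iff)

lemma graph_connected_union:
  assumes A: "graph_connected A R" and B: "graph_connected B R"
    and ab: "a \<in> A" "b \<in> B" "a = b \<or> R a b" and sym: "\<And>x y. R x y \<Longrightarrow> R y x"
  shows "graph_connected (A \<union> B) R"
  unfolding graph_connected_def
proof (intro allI impI)
  fix P assume step: "\<forall>x\<in>A \<union> B. \<forall>y\<in>A \<union> B. P x \<longrightarrow> R x y \<longrightarrow> P y" and ex: "\<exists>x\<in>A \<union> B. P x"
  have PA: "P y" if "x \<in> A" "P x" "y \<in> A" for x y
    by (rule graph_connected_propagate[where P = P, OF A that]) (use step in blast)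
  have PB: "P y" if "x \<in> B" "P x" "y \<in> B" for x y
    by (rule graph_connected_propagate[where P = P, OF B that]) (use step in blast)
  have "P a \<longleftrightarrow> P b" using step ab sym by blast
  then show "\<forall>x\<in>A \<union> B. P x" using PA PB ab(1,2) ex by blast
qed

text \<open>The edges of the nested complex. Incomparable members of a building set with a common
  point have their union in \<open>E\<close>, so compatible members are nested or disjoint.\<close>

definition compatible :: "'a set set \<Rightarrow> 'a set \<Rightarrow> 'a set \<Rightarrow> bool" where
  "compatible E J K \<longleftrightarrow> J \<subseteq> K \<or> K \<subseteq> J \<or> J \<union> K \<notin> E"

lemma compatible_sym: "compatible E J K \<Longrightarrow> compatible E K J"
  by (auto simp: compatible_def Un_commute)

text \<open>Repeated splitting ends in singletons, so every point of a member is itself a member.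
  The order is a parameter because it gets reversed, and \<open>interval\<close> speaks only of
  points of \<open>\<Union>E\<close> because contraction deletes points from the middle of
  members.\<close>

locale building_set =
  fixes lt :: "'a \<Rightarrow> 'a \<Rightarrow> bool" (infix "\<sqsubset>" 50) and E :: "'a set set"
  assumes irrefl: "\<not> x \<sqsubset> x" and trans: "x \<sqsubset> y \<Longrightarrow> y \<sqsubset> z \<Longrightarrow> x \<sqsubset> z"
    and total: "x \<noteq> y \<Longrightarrow> x \<sqsubset> y \<or> y \<sqsubset> x"
    and finite_E: "finite E" and finite_member: "J \<in> E \<Longrightarrow> finite J" and nonempty: "{} \<notin> E"
    and union: "J \<in> E \<Longrightarrow> K \<in> E \<Longrightarrow> J \<inter> K \<noteq> {} \<Longrightarrow> J \<union> K \<in> E"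
    and split: "M \<in> E \<Longrightarrow> (\<And>x. M \<noteq> {x}) \<Longrightarrow> \<exists>A\<in>E. \<exists>B\<in>E. A \<inter> B = {} \<and> M = A \<union> B"
    and interval: "J \<in> E \<Longrightarrow> x \<in> J \<Longrightarrow> z \<in> J \<Longrightarrow> y \<in> \<Union>E \<Longrightarrow> x \<sqsubset> y \<Longrightarrow> y \<sqsubset> z \<Longrightarrow> y \<in> J"
begin

lemma dual: "building_set (\<lambda>x y. y \<sqsubset> x) E"
proof
  fix J x y z assume "J \<in> E" "x \<in> J" "z \<in> J" "y \<in> \<Union>E" "y \<sqsubset> x" "z \<sqsubset> y"
  then show "y \<in> J" by (intro interval[of J z x y])
next
  show "z \<sqsubset> x" if "y \<sqsubset> x" "z \<sqsubset> y" for x y z using that trans by metis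
  show "y \<sqsubset> x \<or> x \<sqsubset> y" if "x \<noteq> y" for x y using that total by metis
  show "\<not> x \<sqsubset> x" for x by (rule irrefl)
  show "finite J" if "J \<in> E" for J using that by (rule finite_member)
  show "J \<union> K \<in> E" if "J \<in> E" "K \<in> E" "J \<inter> K \<noteq> {}" for J K using that by (rule union)
  show "\<exists>A\<in>E. \<exists>B\<in>E. A \<inter> B = {} \<and> M = A \<union> B" if "M \<in> E" "\<And>x. M \<noteq> {x}" for M using that by (rule split)
qed (fact finite_E nonempty)+

lemma splitE:
  assumes "M \<in> E" "\<And>x. M \<noteq> {x}"
  obtains A B where "A \<in> E" "B \<in> E" "A \<inter> B = {}" "M = A \<union> B" "card A < card M" "card B < card M"
proof -
  obtain A B where AB: "A \<in> E" "B \<in> E" "A \<inter> B = {}" "M = A \<union> B" using split[OF assms] by auto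
  moreover have "A \<noteq> {}" "B \<noteq> {}" "finite M" using AB nonempty finite_member assms by auto
  ultimately show thesis by (intro that) (auto intro!: psubset_card_mono)
qed

lemma restriction: "building_set (\<sqsubset>) {J \<in> E. J \<subseteq> M}"
proof
  fix A assume A: "A \<in> {J \<in> E. J \<subseteq> M}" "\<And>x. A \<noteq> {x}"
  have "A \<in> E" using A by simp
  then obtain B C where "B \<in> E" "C \<in> E" "B \<inter> C = {}" "A = B \<union> C" using A(2) by (rule splitE)
  then show "\<exists>B\<in>{J \<in> E. J \<subseteq> M}. \<exists>C\<in>{J \<in> E. J \<subseteq> M}. B \<inter> C = {} \<and> A = B \<union> C" using A by blast
next
  fix J x y z
  assume "J \<in> {J \<in> E. J \<subseteq> M}" "x \<in> J" "z \<in> J" "y \<in> \<Union>{J \<in> E. J \<subseteq> M}" "x \<sqsubset> y" "y \<sqsubset> z"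
  then show "y \<in> J" by (intro interval[of J x z y]) auto
next
  show "J \<union> K \<in> {J \<in> E. J \<subseteq> M}" if "J \<in> {J \<in> E. J \<subseteq> M}" "K \<in> {J \<in> E. J \<subseteq> M}" "J \<inter> K \<noteq> {}" for J K
    using that union by simp
  show "x \<sqsubset> z" if "x \<sqsubset> y" "y \<sqsubset> z" for x y z using that trans by metis
  show "\<not> x \<sqsubset> x" for x by (rule irrefl)
  show "x \<sqsubset> y \<or> y \<sqsubset> x" if "x \<noteq> y" for x y using that by (rule total)
  show "finite J" if "J \<in> {J \<in> E. J \<subseteq> M}" for J using that finite_member by simp
qed (simp_all add: finite_E nonempty)

text \<open>For the splitting axiom, a half inside \<open>M\<close> disappears and the other half
  then has the same trace outside \<open>M\<close>. Descending to that half must end in a splitting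
  with two nonempty traces.\<close>

lemma contraction: "building_set (\<sqsubset>) ((\<lambda>J. J - M) ` {J \<in> E. \<not> J \<subseteq> M})"
proof
  let ?E = "(\<lambda>J. J - M) ` {J \<in> E. \<not> J \<subseteq> M}"
  show "finite ?E" using finite_E by simp
  show "{} \<notin> ?E" by auto
  show "\<And>J. J \<in> ?E \<Longrightarrow> finite J" using finite_member by auto
  fix J K assume J: "J \<in> ?E" and K: "K \<in> ?E" and JK: "J \<inter> K \<noteq> {}"
  obtain J' where J': "J' \<in> E" "\<not> J' \<subseteq> M" "J = J' - M" using J by blast
  obtain K' where K': "K' \<in> E" "\<not> K' \<subseteq> M" "K = K' - M" using K by blast
  have "J' \<union> K' \<in> E" using J' K' JK by (intro union) auto
  moreover have "\<not> J' \<union> K' \<subseteq> M" "J \<union> K = (J' \<union> K') - M" using J' K' by auto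
  ultimately show "J \<union> K \<in> ?E" by blast
next
  let ?E = "(\<lambda>J. J - M) ` {J \<in> E. \<not> J \<subseteq> M}"
  fix J assume "J \<in> ?E" and J: "\<And>x. J \<noteq> {x}"
  then obtain K where "K \<in> E" "\<not> K \<subseteq> M" "J = K - M" by blast
  then show "\<exists>A\<in>?E. \<exists>B\<in>?E. A \<inter> B = {} \<and> J = A \<union> B"
  proof (induction "card K" arbitrary: K rule: less_induct)
    case less
    have "K \<noteq> {x}" for x using less.prems J[of x] by auto
    with less.prems(1) obtain A B where AB: "A \<in> E" "B \<in> E" "A \<inter> B = {}" "K = A \<union> B"
      and lt: "card A < card K" "card B < card K" by (rule splitE)
    consider "A \<subseteq> M" | "B \<subseteq> M" | "\<not> A \<subseteq> M" "\<not> B \<subseteq> M" by blast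
    then show ?case
    proof cases
      case 1
      then have "J = B - M" "\<not> B \<subseteq> M" using AB less.prems by auto
      then show ?thesis using less.hyps[OF lt(2) AB(2)] by blast
    next
      case 2
      then have "J = A - M" "\<not> A \<subseteq> M" using AB less.prems by auto
      then show ?thesis using less.hyps[OF lt(1) AB(1)] by blast
    next
      case 3
      have "(A - M) \<inter> (B - M) = {} \<and> J = (A - M) \<union> (B - M)" using AB less.prems by auto
      moreover have "A - M \<in> ?E" "B - M \<in> ?E" using AB 3 by auto
      ultimately show ?thesis by blast
    qed
  qed
next
  fix J x y z
  assume J: "J \<in> (\<lambda>J. J - M) ` {J \<in> E. \<not> J \<subseteq> M}" "x \<in> J" "z \<in> J"
    and y: "y \<in> \<Union> ((\<lambda>J. J - M) ` {J \<in> E. \<not> J \<subseteq> M})" "x \<sqsubset> y" "y \<sqsubset> z"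
  obtain K where K: "K \<in> E" "J = K - M" using J by blast
  have "y \<in> \<Union>E" "y \<notin> M" using y by auto
  then show "y \<in> J" using interval[of K x z y] K J y by auto
next
  show "x \<sqsubset> z" if "x \<sqsubset> y" "y \<sqsubset> z" for x y z using that trans by metis
  show "\<not> x \<sqsubset> x" for x by (rule irrefl)
  show "x \<sqsubset> y \<or> y \<sqsubset> x" if "x \<noteq> y" for x y using that by (rule total)
qed

text \<open>As long as a half meets both \<open>S\<close> and its complement, it is split further;
  finally the two halves are on different sides.\<close>

lemma split_between:
  assumes "M \<in> E" "M \<inter> S \<noteq> {}" "M - S \<noteq> {}"
  shows "\<exists>A\<in>E. \<exists>B\<in>E. A \<subseteq> M \<inter> S \<and> B \<subseteq> M - S \<and> A \<union> B \<in> E"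
  using assms
proof (induction "card M" arbitrary: M rule: less_induct)
  case less
  have "M \<noteq> {x}" for x using less.prems by auto
  with less.prems(1) obtain A B where AB: "A \<in> E" "B \<in> E" "A \<inter> B = {}" "M = A \<union> B"
    and lt: "card A < card M" "card B < card M" by (rule splitE)
  have sub: "A \<inter> S \<subseteq> M \<inter> S" "A - S \<subseteq> M - S" "B \<inter> S \<subseteq> M \<inter> S" "B - S \<subseteq> M - S" using AB by auto
  consider "A \<inter> S \<noteq> {}" "A - S \<noteq> {}" | "B \<inter> S \<noteq> {}" "B - S \<noteq> {}"
    | "A \<subseteq> S" "B \<subseteq> M - S" | "B \<subseteq> S" "A \<subseteq> M - S"
    using less.prems AB by blast
  then show ?case
  proof cases
    case 1 then show ?thesis using less.hyps[OF lt(1) AB(1)] sub by (meson subset_trans)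
  next
    case 2 then show ?thesis using less.hyps[OF lt(2) AB(2)] sub by (meson subset_trans)
  next
    case 3 then show ?thesis using AB less.prems(1) by blast
  next
    case 4 then show ?thesis using AB less.prems(1) by (metis Un_commute Un_upper1 Un_upper2 le_inf_iff)
  qed
qed

text \<open>By induction the halves of \<open>M\<close> lie in some \<open>X\<close> and
  \<open>Y\<close> of \<open>P\<close>. As \<open>M\<close> overlaps both,
  \<open>X \<union> Y\<close> is a member, so \<open>X = Y\<close>. This is why conditions on pairs
  suffice and nested complexes are flag.\<close>

lemma inside_one:
  assumes P: "P \<subseteq> E" "\<And>X Y. X \<in> P \<Longrightarrow> Y \<in> P \<Longrightarrow> X \<noteq> Y \<Longrightarrow> X \<union> Y \<notin> E"
    and "M \<in> E" "M \<subseteq> \<Union>P"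
  shows "\<exists>X\<in>P. M \<subseteq> X"
  using assms(3,4)
proof (induction "card M" arbitrary: M rule: less_induct)
  case less
  show ?case
  proof (cases "\<exists>x. M = {x}")
    case False
    then have "\<And>x. M \<noteq> {x}" by blast
    with less.prems(1) obtain A B where AB: "A \<in> E" "B \<in> E" "A \<inter> B = {}" "M = A \<union> B"
      and lt: "card A < card M" "card B < card M" by (rule splitE)
    have ne: "A \<noteq> {}" "B \<noteq> {}" using AB nonempty by auto
    obtain X Y where XY: "X \<in> P" "A \<subseteq> X" "Y \<in> P" "B \<subseteq> Y"
      using less.hyps[OF lt(1) AB(1)] less.hyps[OF lt(2) AB(2)] less.prems AB by auto
    have "X \<union> M \<in> E" using XY P(1) ne AB less.prems(1) by (intro union) auto
    then have "(X \<union> M) \<union> Y \<in> E" by (rule union) (use XY P(1) ne AB in auto)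
    moreover have "(X \<union> M) \<union> Y = X \<union> Y" using XY AB by auto
    ultimately have "X = Y" using P(2) XY by auto
    then show ?thesis using XY AB by auto
  qed (use less.prems in auto)
qed

section \<open>Non-neighbours of a member on its two sides\<close>

definition left :: "'a set \<Rightarrow> 'a set \<Rightarrow> bool" where
  "left v w \<longleftrightarrow> (\<forall>x\<in>w - v. \<forall>y\<in>v. x \<sqsubset> y)"

text \<open>Since \<open>v\<close> is an interval, each point of \<open>w\<close> outside it
  precedes or follows all of \<open>v\<close>. Points of both kinds would force
  \<open>v \<subseteq> w\<close>.\<close>

lemma incompatible_left_or_right:
  assumes "v \<in> E" "w \<in> E" "\<not> compatible E v w"
  shows "left v w \<or> (\<forall>x\<in>w - v. \<forall>y\<in>v. y \<sqsubset> x)"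
proof (rule ccontr)
  assume "\<not> ?thesis"
  then obtain x y x' y' where x: "x \<in> w" "x \<notin> v" "y \<in> v" "\<not> x \<sqsubset> y" and x': "x' \<in> w" "x' \<notin> v" "y' \<in> v" "\<not> y' \<sqsubset> x'"
    unfolding left_def by blast
  have side: "(\<forall>y\<in>v. z \<sqsubset> y) \<or> (\<forall>y\<in>v. y \<sqsubset> z)" if z: "z \<in> w" "z \<notin> v" for z
  proof (rule ccontr)
    assume "\<not> ?thesis"
    then obtain s t where "s \<in> v" "t \<in> v" "\<not> z \<sqsubset> s" "\<not> t \<sqsubset> z" by blast
    then have "s \<sqsubset> z" "z \<sqsubset> t" using total z by metis+
    then show False using interval[OF assms(1) \<open>s \<in> v\<close> \<open>t \<in> v\<close>] z assms(2) by blast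
  qed
  have "\<forall>y\<in>v. y \<sqsubset> x" "\<forall>y\<in>v. x' \<sqsubset> y" using side x x' by blast+
  then have "v \<subseteq> w" using interval[OF assms(2) x'(1) x(1)] assms(1) by blast
  then show False using assms(3) by (simp add: compatible_def)
qed

lemma left_flip:
  assumes "v \<in> E" "w \<in> E" "\<not> compatible E v w" "left v w" "x \<in> v - w" "y \<in> w"
  shows "y \<sqsubset> x"
proof -
  obtain z where z: "z \<in> w" "z \<notin> v" using assms(3) by (auto simp: compatible_def)
  have "\<not> compatible E w v" using assms(3) compatible_sym by blast
  moreover have "z \<sqsubset> x" using assms z by (auto simp: left_def)
  then have "\<not> left w v" using z assms(5) irrefl trans unfolding left_def by blast
  ultimately show ?thesis using incompatible_left_or_right[OF assms(2,1)] assms(5,6) by blast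
qed

abbreviation "N v \<equiv> non_neighbours E (compatible E) v"

lemma N_iff: "w \<in> N v \<longleftrightarrow> w \<in> E \<and> \<not> w \<subseteq> v \<and> \<not> v \<subseteq> w \<and> v \<union> w \<in> E"
  by (auto simp: non_neighbours_def compatible_def)

text \<open>The proper enlargements of \<open>v\<close> to the left contain a least one,
  \<open>M\<close>, and \<open>M - v\<close> is the neighbour sought. It is also compatible with
  every non-neighbour on the right, hence a cone point.\<close>

lemma least_left_neighbour:
  assumes v: "v \<in> E" and ex: "w0 \<in> N v" "left v w0"
  obtains l where "l \<in> N v" "left v l" "l \<inter> v = {}" "\<And>w. w \<in> N v \<Longrightarrow> left v w \<Longrightarrow> l \<subseteq> w"
    "\<And>w. w \<in> N v \<Longrightarrow> \<not> left v w \<Longrightarrow> compatible E l w"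
proof -
  define D where "D = {M \<in> E. v \<subset> M \<and> left v M}"
  have DI: "v \<union> w \<in> D" if "w \<in> N v" "left v w" for w
    using that by (auto simp: D_def N_iff left_def)
  have "finite D" using finite_E by (simp add: D_def)
  then obtain M where M: "M \<in> D" "\<And>M'. M' \<in> D \<Longrightarrow> card M \<le> card M'"
    using DI[OF ex] arg_min_if_finite[of D card] by (metis empty_iff not_le)
  \<comment> \<open>Enlargements to the left are intervals with a common right part, so they form a
    chain and smallest cardinality means least.\<close>
  have least: "M \<subseteq> M'" if M': "M' \<in> D" for M'
  proof (rule ccontr)
    assume "\<not> M \<subseteq> M'"
    then obtain x where x: "x \<in> M" "x \<notin> M'" by blast
    have "M' \<subseteq> M"
    proof
      fix z assume z: "z \<in> M'"
      show "z \<in> M"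
      proof (cases "z \<in> v")
        case False
        obtain y where y: "y \<in> v" using v nonempty by (metis ex_in_conv)
        have xv: "x \<notin> v" using x M' by (auto simp: D_def)
        have "z \<sqsubset> y" "x \<sqsubset> y" using M M' x z xv False y by (auto simp: D_def left_def)
        moreover have "\<not> z \<sqsubset> x"
          using interval[of M' z y x] M M' x z y \<open>x \<sqsubset> y\<close> by (auto simp: D_def)
        moreover have "x \<noteq> z" using x z by blast
        ultimately show ?thesis
          using interval[of M x y z] total[of x z] M M' x z y by (auto simp: D_def)
      qed (use M in \<open>auto simp: D_def\<close>)
    qed
    then have "M' \<subset> M" using x by blast
    moreover have "finite M" using M finite_member by (auto simp: D_def)
    ultimately have "card M' < card M" by (simp add: psubset_card_mono)
    then show False using M(2)[OF M'] by simp
  qed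
  \<comment> \<open>Gives a member \<open>B\<close> outside \<open>v\<close> that can be attached to
    \<open>v\<close>; then \<open>v \<union> B\<close> is an enlargement inside \<open>M\<close>,
    hence equal to \<open>M\<close>.\<close>
  obtain A B where AB: "A \<in> E" "B \<in> E" "A \<subseteq> M \<inter> v" "B \<subseteq> M - v" "A \<union> B \<in> E"
  proof -
    have "M \<in> E" "v \<subset> M" using M by (simp_all add: D_def)
    moreover have "v \<noteq> {}" using v nonempty by metis
    ultimately have "\<exists>A\<in>E. \<exists>B\<in>E. A \<subseteq> M \<inter> v \<and> B \<subseteq> M - v \<and> A \<union> B \<in> E"
      by (intro split_between) auto
    then show thesis using that by blast
  qed
  have ABne: "A \<noteq> {}" "B \<noteq> {}" using AB nonempty by metis+
  then have "A \<union> B \<union> v \<in> E" by (intro union[OF AB(5) v]) (use AB in blast)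
  then have "B \<union> v \<in> E" using AB by (metis Un_absorb1 Un_assoc Un_commute le_inf_iff)
  with ABne AB M have "B \<union> v \<in> D" by (auto simp: D_def left_def)
  then have B: "B = M - v" using least[of "B \<union> v"] AB by blast
  have BM: "v \<union> B = M" using B M by (auto simp: D_def)
  show thesis
  proof (rule that[of B])
    show BN: "B \<in> N v" using AB BM M B nonempty v ABne by (auto simp: N_iff D_def)
    show lB: "left v B" using M B by (auto simp: D_def left_def)
    show "B \<inter> v = {}" using B by blast
    show "B \<subseteq> w" if "w \<in> N v" "left v w" for w using least[OF DI[OF that]] B by blast
    show "compatible E B w" if w: "w \<in> N v" "\<not> left v w" for w
    proof (rule ccontr)
      assume "\<not> compatible E B w"
      then have Bw: "B \<union> w \<in> E" by (simp add: compatible_def)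
      have inc: "\<not> compatible E v w" "w \<in> E" using w by (auto simp: non_neighbours_def)
      obtain x z where x: "x \<in> B" and z: "z \<in> w" "z \<notin> v" using ABne inc by (auto simp: compatible_def)
      \<comment> \<open>\<open>v\<close> lies between \<open>B\<close> on its left and a point of
        \<open>w\<close> on its right. As \<open>B\<close> is disjoint from \<open>v\<close>, this
        puts \<open>v\<close> into \<open>w\<close>.\<close>
      have "v \<subseteq> B \<union> w"
      proof
        fix y assume y: "y \<in> v"
        have "x \<sqsubset> y" using lB x B y by (auto simp: left_def)
        moreover have "y \<sqsubset> z" using incompatible_left_or_right[OF v inc(2,1)] w z y by blast
        ultimately show "y \<in> B \<union> w" using interval[OF Bw, of x z y] x z v y by blast
      qed
      then show False using inc B by (auto simp: compatible_def)
    qed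
  qed
qed

text \<open>Left neighbours are closed under unions: they all contain the least one, so their unions
  are members. If two of them covered \<open>v\<close>, points of \<open>v\<close> missed by the
  first and by the second would each precede the other.\<close>

lemma greatest_left_neighbour:
  assumes v: "v \<in> E" and ex: "w0 \<in> N v" "left v w0"
  obtains m where "m \<in> N v" "left v m" "\<And>w. w \<in> N v \<Longrightarrow> left v w \<Longrightarrow> w \<subseteq> m"
proof -
  define L where "L = {w \<in> N v. left v w}"
  obtain l where l: "l \<in> N v" "left v l" "\<And>w. w \<in> N v \<Longrightarrow> left v w \<Longrightarrow> l \<subseteq> w"
    by (rule least_left_neighbour[OF v ex]) blast
  then have l: "l \<in> N v" "\<And>w. w \<in> L \<Longrightarrow> l \<subseteq> w" by (simp_all add: L_def)
  have un: "w \<union> w' \<in> L" if w: "w \<in> L" "w' \<in> L" for w w'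
  proof -
    have wE: "w \<in> E" "w' \<in> E" "\<not> compatible E v w" "\<not> compatible E v w'" "left v w" "left v w'"
      using w by (auto simp: L_def non_neighbours_def)
    have "l \<noteq> {}" using l(1) nonempty by (auto simp: non_neighbours_def)
    then have "w \<union> w' \<in> E" by (intro union[OF wE(1,2)]) (use l(2)[OF w(1)] l(2)[OF w(2)] in blast)
    moreover have "(v \<union> w) \<union> (v \<union> w') \<in> E"
    proof (rule union)
      show "v \<union> w \<in> E" "v \<union> w' \<in> E" using w by (simp_all add: L_def N_iff)
      have "v \<noteq> {}" using v nonempty by metis
      then show "(v \<union> w) \<inter> (v \<union> w') \<noteq> {}" by blast
    qed
    then have "v \<union> (w \<union> w') \<in> E" by (simp add: Un_ac)
    moreover have "\<not> v \<subseteq> w \<union> w'"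
    proof
      assume sub: "v \<subseteq> w \<union> w'"
      obtain x x' where x: "x \<in> v" "x \<notin> w" "x' \<in> v" "x' \<notin> w'" using wE by (auto simp: compatible_def)
      then have "x \<in> w'" "x' \<in> w" using sub by auto
      then have "x' \<sqsubset> x" "x \<sqsubset> x'" using left_flip[OF v wE(1,3,5), of x x'] left_flip[OF v wE(2,4,6), of x' x] x by auto
      then show False using trans irrefl by blast
    qed
    moreover have "left v (w \<union> w')" using wE by (auto simp: left_def)
    moreover have "\<not> w \<union> w' \<subseteq> v" using wE by (auto simp: compatible_def)
    ultimately show ?thesis by (auto simp: L_def N_iff)
  qed
  have "finite L" using finite_E by (simp add: L_def non_neighbours_def)
  moreover have "L \<noteq> {}" using ex by (auto simp: L_def)
  ultimately obtain m where m: "m \<in> L" "\<And>w. w \<in> L \<Longrightarrow> card w \<le> card m"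
    using Max_in[of "card ` L"] Max_ge[of "card ` L"] by (metis (no_types, lifting) finite_imageI image_iff image_is_empty)
  have "w \<subseteq> m" if "w \<in> L" for w
  proof -
    have "finite (w \<union> m)" using un[OF that m(1)] finite_member by (auto simp: L_def non_neighbours_def)
    then show ?thesis using m(2)[OF un[OF that m(1)]] by (metis Un_upper1 Un_upper2 card_seteq)
  qed
  then show thesis using that m(1) by (auto simp: L_def)
qed

lemma not_left_dual:
  assumes "v \<in> E" "w \<in> N v"
  shows "building_set.left (\<lambda>x y. y \<sqsubset> x) v w \<longleftrightarrow> \<not> left v w"
proof -
  have w: "w \<in> E" "\<not> compatible E v w" using assms by (auto simp: non_neighbours_def)
  obtain x y where "x \<in> w - v" "y \<in> v" using w assms nonempty by (auto simp: compatible_def)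
  then show ?thesis
    using incompatible_left_or_right[OF assms(1) w] irrefl trans
    unfolding left_def building_set.left_def[OF dual] by blast
qed

text \<open>There are always two candidates for a cone point, so that removing \<open>w\<close> does
  no harm: the least neighbours on the two sides, or the least and the greatest one if all are on
  one side. In the latter case both equal \<open>w\<close> only if \<open>w\<close> is the sole
  neighbour.\<close>

lemma coned_N_minus:
  assumes v: "v \<in> E"
  shows "coned (N v - {w}) (compatible E)"
proof -
  interpret d: building_set "\<lambda>x y. y \<sqsubset> x" E by (rule dual)
  have sub: "compatible E x y" if "x \<subseteq> y \<or> y \<subseteq> x" for x y using that by (auto simp: compatible_def)
  have conedI: ?thesis if "z \<in> N v" "z \<noteq> w" "\<And>y. y \<in> N v \<Longrightarrow> compatible E z y" for z
    using that unfolding coned_def by blast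
  show ?thesis
  proof (cases "\<exists>l. l \<in> N v \<and> left v l")
    case L: True
    obtain l where l: "l \<in> N v" "left v l" "\<And>w. w \<in> N v \<Longrightarrow> left v w \<Longrightarrow> l \<subseteq> w"
      "\<And>w. w \<in> N v \<Longrightarrow> \<not> left v w \<Longrightarrow> compatible E l w"
      using L least_left_neighbour[OF v] by metis
    have lc: "compatible E l y" if "y \<in> N v" for y
      using l(3)[OF that] l(4)[OF that] sub by (cases "left v y") simp_all
    show ?thesis
    proof (cases "\<exists>r. r \<in> N v \<and> d.left v r")
      case True
      then obtain r where r: "r \<in> N v" "d.left v r" "\<And>w. w \<in> N v \<Longrightarrow> d.left v w \<Longrightarrow> r \<subseteq> w"
        "\<And>w. w \<in> N v \<Longrightarrow> \<not> d.left v w \<Longrightarrow> compatible E r w"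
        using d.least_left_neighbour[OF v] by metis
      have rc: "compatible E r y" if "y \<in> N v" for y
        using r(3)[OF that] r(4)[OF that] sub by (cases "d.left v y") simp_all
      have "l \<noteq> r" using not_left_dual[OF v l(1)] l r by metis
      then consider "l \<noteq> w" | "r \<noteq> w" by metis
      then show ?thesis
      proof cases
        case 1 show ?thesis by (rule conedI[OF l(1) 1 lc])
      next
        case 2 show ?thesis by (rule conedI[OF r(1) 2 rc])
      qed
    next
      case False
      then have all: "left v y" if "y \<in> N v" for y using not_left_dual[OF v that] that by blast
      obtain m where m: "m \<in> N v" "\<And>w. w \<in> N v \<Longrightarrow> left v w \<Longrightarrow> w \<subseteq> m"
        using L greatest_left_neighbour[OF v] by metis
      have mc: "compatible E m y" if "y \<in> N v" for y using m(2)[OF that all[OF that]] sub by simp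
      consider "l = w" "m = w" | "l \<noteq> w" | "m \<noteq> w" by metis
      then show ?thesis
      proof cases
        case 1
        then have "N v - {w} = {}" using l(3) m(2) all by blast
        then show ?thesis by (simp add: coned_def)
      next
        case 2 show ?thesis by (rule conedI[OF l(1) 2 lc])
      next
        case 3 show ?thesis by (rule conedI[OF m(1) 3 mc])
      qed
    qed
  next
    case False
    then have all: "d.left v y" if "y \<in> N v" for y using not_left_dual[OF v that] that by blast
    show ?thesis
    proof (cases "N v = {}")
      case True
      then show ?thesis by (simp add: coned_def)
    next
      case False
      then obtain l where l: "l \<in> N v" "\<And>w. w \<in> N v \<Longrightarrow> l \<subseteq> w"
        using d.least_left_neighbour[OF v] all by (metis ex_in_conv)
      obtain m where m: "m \<in> N v" "\<And>w. w \<in> N v \<Longrightarrow> w \<subseteq> m"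
        using False d.greatest_left_neighbour[OF v] all by (metis ex_in_conv)
      have mc: "compatible E m y" and lc: "compatible E l y" if "y \<in> N v" for y
        using m(2)[OF that] l(2)[OF that] sub by simp_all
      consider "l = w" "m = w" | "l \<noteq> w" | "m \<noteq> w" by metis
      then show ?thesis
      proof cases
        case 1
        then have "N v - {w} = {}" using l(2) m(2) by blast
        then show ?thesis by (simp add: coned_def)
      next
        case 2 show ?thesis by (rule conedI[OF l(1) 2 lc])
      next
        case 3 show ?thesis by (rule conedI[OF m(1) 3 mc])
      qed
    qed
  qed
qed

lemma coned_N: "v \<in> E \<Longrightarrow> coned (N v) (compatible E)"
  using coned_N_minus[of v v] by (simp add: non_neighbours_def)

text \<open>Links the two cones of \<open>connected_N\<close>. If \<open>v\<close> has a left
  neighbour \<open>l\<close>, then \<open>l \<union> v\<close> is a non-neighbour of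
  \<open>w\<close> and contains \<open>l\<close>. Otherwise all neighbours of \<open>v\<close>
  extend it to the right, and \<open>u\<close> is used.\<close>

lemma N_connection_right:
  assumes v: "v \<in> E" and w: "w \<in> N v" "\<not> left v w" and u: "u \<in> N v" "u \<noteq> w"
  shows "\<exists>y\<in>N v - {w}. \<exists>y'\<in>N w - {v}. y = y' \<or> compatible E y y'"
proof (cases "\<exists>l. l \<in> N v \<and> left v l")
  case True
  then obtain l where l: "l \<in> N v" "left v l" "l \<inter> v = {}" using least_left_neighbour[OF v] by metis
  have wE: "w \<in> E" "\<not> w \<subseteq> v" "\<not> v \<subseteq> w" "v \<union> w \<in> E" "\<not> compatible E v w"
    using w(1) unfolding N_iff compatible_def by blast+
  have "l \<noteq> {}" using l nonempty by (auto simp: N_iff)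
  have "(l \<union> v) \<union> (v \<union> w) \<in> E"
  proof (rule union)
    show "l \<union> v \<in> E" using l by (simp add: N_iff Un_commute)
    have "v \<noteq> {}" using v nonempty by metis
    then show "(l \<union> v) \<inter> (v \<union> w) \<noteq> {}" by blast
  qed (rule wE)
  then have un: "w \<union> (l \<union> v) \<in> E" by (simp add: Un_ac)
  obtain z where z: "z \<in> w" "z \<notin> v" using wE by blast
  have "\<forall>y\<in>v. y \<sqsubset> z" using incompatible_left_or_right[OF v wE(1,5)] w(2) z by blast
  have "z \<notin> l"
  proof
    assume "z \<in> l"
    obtain y where y: "y \<in> v" using v nonempty by (metis ex_in_conv)
    then have "z \<sqsubset> y" using l(2) \<open>z \<in> l\<close> z by (simp add: left_def)
    then show False using \<open>\<forall>y\<in>v. y \<sqsubset> z\<close> y trans irrefl by metis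
  qed
  then have "l \<union> v \<in> N w" using un l wE z by (auto simp: N_iff Un_commute)
  moreover have "l \<union> v \<noteq> v" using l \<open>l \<noteq> {}\<close> by blast
  moreover have "compatible E l (l \<union> v)" by (auto simp: compatible_def)
  moreover have "l \<noteq> w" using l w by blast
  ultimately show ?thesis using l(1) by blast
next
  case False
  then have all: "\<not> left v y" if "y \<in> N v" for y using that by blast
  interpret d: building_set "\<lambda>x y. y \<sqsubset> x" E by (rule dual)
  have wE: "w \<in> E" "\<not> w \<subseteq> v" "\<not> v \<subseteq> w" "v \<union> w \<in> E" "\<not> compatible E v w"
    using w(1) unfolding N_iff compatible_def by blast+
  have uE: "u \<in> E" "\<not> u \<subseteq> v" "\<not> v \<subseteq> u" "v \<union> u \<in> E" "\<not> compatible E v u"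
    using u(1) unfolding N_iff compatible_def by blast+
  obtain r where r: "r \<in> N v" "\<And>w. w \<in> N v \<Longrightarrow> r \<subseteq> w"
    using d.least_left_neighbour[OF v] w not_left_dual[OF v] all by metis
  have "r \<noteq> {}" using r nonempty by (auto simp: N_iff)
  then have uw: "u \<inter> w \<noteq> {}" using r(2)[OF w(1)] r(2)[OF u(1)] by blast
  \<comment> \<open>The partner of \<open>u\<close> among the non-neighbours of \<open>w\<close> is
    \<open>u\<close> itself, a member inside \<open>u - w\<close>, the union
    \<open>v \<union> u\<close>, and a member inside \<open>v - w\<close>, respectively. In the last
    case a point of \<open>w - u\<close> separates the partner from \<open>u\<close>.\<close>
  consider "\<not> u \<subseteq> w" "\<not> w \<subseteq> u" | "w \<subset> u" | "u \<subset> w" "\<not> w \<subseteq> v \<union> u" | "u \<subset> w" "w \<subseteq> v \<union> u"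
    using u(2) by blast
  then show ?thesis
  proof cases
    case 1
    have "w \<union> u \<in> E" by (intro union wE uE) (use uw in blast)
    then have "u \<in> N w" using 1 uE by (auto simp: N_iff)
    moreover have "u \<noteq> v" using uE by blast
    ultimately show ?thesis using u by blast
  next
    case 2
    obtain A B where AB: "A \<in> E" "B \<in> E" "A \<subseteq> u \<inter> w" "B \<subseteq> u - w" "A \<union> B \<in> E"
      using split_between[OF uE(1), of w] 2 uw by blast
    have ne: "A \<noteq> {}" "B \<noteq> {}" "w \<noteq> {}" using AB wE nonempty by metis+
    have "w \<union> (A \<union> B) \<in> E" by (intro union[OF wE(1) AB(5)]) (use AB ne in blast)
    moreover have "w \<union> (A \<union> B) = w \<union> B" using AB by blast
    ultimately have "w \<union> B \<in> E" by simp
    with ne AB have "B \<in> N w" by (auto simp: N_iff)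
    moreover have "B \<noteq> v" using AB uE by blast
    moreover have "compatible E u B" using AB by (auto simp: compatible_def)
    ultimately show ?thesis using u by blast
  next
    case 3
    have "w \<union> (v \<union> u) = v \<union> w" using 3 by blast
    then have "v \<union> u \<in> N w" using 3 uE wE by (auto simp: N_iff)
    moreover have "v \<union> u \<noteq> v" using uE by blast
    moreover have "compatible E u (v \<union> u)" by (auto simp: compatible_def)
    ultimately show ?thesis using u by blast
  next
    case 4
    obtain x where x: "x \<in> w" "x \<notin> u" "x \<in> v" using 4 by blast
    obtain z where z: "z \<in> u" "z \<notin> v" using uE by blast
    have "\<exists>A\<in>E. \<exists>B\<in>E. A \<subseteq> (v \<union> w) \<inter> w \<and> B \<subseteq> (v \<union> w) - w \<and> A \<union> B \<in> E"
      using wE x by (intro split_between) auto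
    then obtain A C where AC: "A \<in> E" "C \<in> E" "A \<subseteq> w" "C \<subseteq> v - w" "A \<union> C \<in> E" by blast
    have ne: "A \<noteq> {}" "C \<noteq> {}" "w \<noteq> {}" using AC wE nonempty by metis+
    have "w \<union> (A \<union> C) \<in> E" by (intro union[OF wE(1) AC(5)]) (use AC ne in blast)
    moreover have "w \<union> (A \<union> C) = w \<union> C" using AC by blast
    ultimately have "w \<union> C \<in> E" by simp
    with ne AC have "C \<in> N w" by (auto simp: N_iff)
    moreover have "C \<noteq> v" using AC x by blast
    moreover have "compatible E u C"
    proof (rule ccontr)
      assume "\<not> compatible E u C"
      then have uC: "u \<union> C \<in> E" by (simp add: compatible_def)
      obtain c where c: "c \<in> C" using ne by blast
      have "c \<sqsubset> x"
        using d.left_flip[OF v wE(1,5), of c x] not_left_dual[OF v w(1)] w(2) AC c x by blast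
      moreover have "x \<sqsubset> z"
        using incompatible_left_or_right[OF v uE(1,5)] all[OF u(1)] x z by blast
      ultimately have "x \<in> u \<union> C" using interval[OF uC, of c z x] c z x v by blast
      then show False using x AC by blast
    qed
    ultimately show ?thesis using u by blast
  qed
qed

end

lemma (in building_set) N_connection:
  assumes v: "v \<in> E" and w: "w \<in> N v" and u: "u \<in> N v" "u \<noteq> w"
  shows "\<exists>y\<in>N v - {w}. \<exists>y'\<in>N w - {v}. y = y' \<or> compatible E y y'"
proof (cases "left v w")
  case True
  then show ?thesis
    using building_set.N_connection_right[OF dual v w _ u] not_left_dual[OF v w] by blast
next
  case False
  then show ?thesis using N_connection_right[OF v w _ u] by blast
qed

text \<open>Each of the two sets is a cone, hence connected, and \<open>N_connection\<close> joins
  them unless the first one is empty.\<close>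

lemma (in building_set) connected_N:
  assumes v: "v \<in> E" and w: "w \<in> N v"
  shows "graph_connected ((N v - {w}) \<union> (N w - {v})) (compatible E)"
proof -
  have wE: "w \<in> E" and vw: "v \<in> N w" using v w compatible_sym by (auto simp: non_neighbours_def)
  have c: "graph_connected (N v - {w}) (compatible E)" "graph_connected (N w - {v}) (compatible E)"
    using coned_N_minus v wE compatible_sym by (metis graph_connected_if_coned)+
  show ?thesis
  proof (cases "N v - {w} = {}")
    case True
    then show ?thesis using c(2) by (simp only: Un_empty_left)
  next
    case False
    then obtain y y' where "y \<in> N v - {w}" "y' \<in> N w - {v}" "y = y' \<or> compatible E y y'"
      using N_connection[OF v w] by blast
    then show ?thesis using graph_connected_union[OF c] compatible_sym by metis
  qed
qed

lemma non_neighbours_subset_iff: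
  "w \<in> non_neighbours L (compatible E) v \<longleftrightarrow> w \<in> L \<and> \<not> compatible E v w"
  by (auto simp: non_neighbours_def compatible_def)

context building_set
begin

text \<open>The link of a member \<open>M\<close> is the join of the complexes of the restriction and of the
  contraction at \<open>M\<close>; all non-neighbours of a vertex in a link lie in the same factor.\<close>

definition outer :: "'a set \<Rightarrow> 'a set set" where
  "outer M = {J \<in> E. \<not> J \<subseteq> M \<and> (M \<subseteq> J \<or> J \<union> M \<notin> E)}"

lemma outer_cases:
  assumes M: "M \<in> E" and J: "J \<in> outer M"
  obtains "J \<in> E" "\<not> J \<subseteq> M" "M \<subseteq> J" | "J \<in> E" "\<not> J \<subseteq> M" "J \<inter> M = {}" "J \<union> M \<notin> E"
proof -
  have J: "J \<in> E" "\<not> J \<subseteq> M" "M \<subseteq> J \<or> J \<union> M \<notin> E" using assms by (simp_all add: outer_def)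
  show thesis
  proof (cases "M \<subseteq> J")
    case False
    then show thesis using J that(2) union[OF J(1) M] by metis
  qed (use J that(1) in metis)
qed

text \<open>A trace outside \<open>M\<close> comes from \<open>J \<union> M\<close> if this is a
  member and from \<open>J\<close> otherwise; both are compatible with \<open>M\<close>.\<close>

lemma outer_contraction:
  assumes M: "M \<in> E"
  shows "(\<lambda>J. J - M) ` outer M = (\<lambda>J. J - M) ` {J \<in> E. \<not> J \<subseteq> M}"
proof
  show "(\<lambda>J. J - M) ` {J \<in> E. \<not> J \<subseteq> M} \<subseteq> (\<lambda>J. J - M) ` outer M"
  proof (rule image_subsetI)
    fix J assume "J \<in> {J \<in> E. \<not> J \<subseteq> M}"
    then have J: "J \<in> E" "\<not> J \<subseteq> M" by simp_all
    show "J - M \<in> (\<lambda>J. J - M) ` outer M"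
    proof (cases "J \<union> M \<in> E")
      case True
      then have "J \<union> M \<in> outer M" "(J \<union> M) - M = J - M" using J by (auto simp: outer_def)
      then show ?thesis by (metis image_eqI)
    next
      case False
      then have "J \<in> outer M" using J by (simp add: outer_def)
      then show ?thesis by blast
    qed
  qed
qed (auto simp: outer_def)

lemma inj_outer:
  assumes M: "M \<in> E"
  shows "inj_on (\<lambda>J. J - M) (outer M)"
proof (rule inj_onI)
  fix J K assume JK: "J \<in> outer M" "K \<in> outer M" "J - M = K - M"
  show "J = K"
    by (rule outer_cases[OF M JK(1)]; rule outer_cases[OF M JK(2)])
      (use JK(3) in \<open>(metis Un_Diff_cancel2 sup.absorb1 Un_commute Diff_triv)+\<close>)
qed

text \<open>The danger is a member \<open>L\<close> whose trace outside \<open>M\<close> is the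
  union of two traces although \<open>J \<union> K\<close> is no member. If \<open>J\<close> or
  \<open>K\<close> contains \<open>M\<close>, unions with overlapping members produce
  \<open>J \<union> K\<close>; the remaining case has both disjoint from \<open>M\<close>.\<close>

lemma outer_compatible:
  assumes M: "M \<in> E" and J: "J \<in> outer M" and K: "K \<in> outer M"
  shows "compatible ((\<lambda>J. J - M) ` {J \<in> E. \<not> J \<subseteq> M}) (J - M) (K - M) \<longleftrightarrow> compatible E J K"
    (is "compatible ?E _ _ \<longleftrightarrow> _")
proof
  assume c: "compatible E J K"
  show "compatible ?E (J - M) (K - M)"
  proof (rule ccontr)
    assume nc: "\<not> compatible ?E (J - M) (K - M)"
    then have "\<not> J \<subseteq> K" "\<not> K \<subseteq> J" by (auto simp: compatible_def)
    with c have un: "J \<union> K \<notin> E" by (simp add: compatible_def)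
    from nc obtain L where L: "L \<in> E" "L - M = (J - M) \<union> (K - M)" by (auto simp: compatible_def)
    from J M show False
    proof (cases rule: outer_cases[OF M J])
      case 1
      note J = this
      have "J \<union> L \<in> E" using J L by (intro union) auto
      show False
      proof (cases rule: outer_cases[OF M K])
        case 1
        then show False using union[of J K] J un nonempty M by (metis inf.bounded_iff subset_empty)
      next
        case 2
        then have "J \<union> L = J \<union> K" using J L by blast
        then show False using \<open>J \<union> L \<in> E\<close> un by simp
      qed
    next
      case 2
      note J = this
      show False
      proof (cases rule: outer_cases[OF M K])
        case 1
        have "K \<union> L \<in> E" using 1 L by (intro union) auto
        moreover have "K \<union> L = J \<union> K" using 1 J L by blast
        ultimately show False using un by simp
      next
        case 2
        note K = this
        have eq: "L - M = J \<union> K" using L J K by blast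
        show False
        proof (cases "L \<inter> M = {}")
          case True
          then have "L = J \<union> K" using eq by blast
          then show False using L un by simp
        next
          case False
          then have LM: "L \<union> M \<in> E" using L M by (intro union)
          \<comment> \<open>\<open>J\<close>, \<open>K\<close> and \<open>M\<close> pairwise have no
            union in \<open>E\<close>, while the member \<open>L \<union> M\<close> would spread
            over all three.\<close>
          have "\<exists>X\<in>{J, K, M}. L \<union> M \<subseteq> X"
          proof (rule inside_one[OF _ _ LM])
            show "{J, K, M} \<subseteq> E" using J K M by simp
            show "X \<union> Y \<notin> E" if "X \<in> {J, K, M}" "Y \<in> {J, K, M}" "X \<noteq> Y" for X Y
              using that un J(4) K(4) by (auto simp: Un_commute)
            show "L \<union> M \<subseteq> \<Union>{J, K, M}" using eq by blast
          qed
          then consider "M \<subseteq> J" | "M \<subseteq> K" | "L - M = {}" by blast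
          then show False
          proof cases
            case 1 then show False using J(3) M nonempty by (metis inf.absorb2)
          next
            case 2 then show False using K(3) M nonempty by (metis inf.absorb2)
          next
            case 3 then show False using eq J(2) by blast
          qed
        qed
      qed
    qed
  qed
next
  assume c: "compatible ?E (J - M) (K - M)"
  have sub: "A \<subseteq> B" if A: "A \<in> outer M" and B: "B \<in> outer M" and AB: "A - M \<subseteq> B - M" for A B
  proof (cases rule: outer_cases[OF M B])
    case 1
    then show ?thesis using AB by blast
  next
    case 2
    note B = this
    show ?thesis
    proof (cases rule: outer_cases[OF M A])
      case 1
      then have "A \<union> B \<in> E" using AB B by (intro union) auto
      moreover have "A \<union> B = B \<union> M" using 1 AB by blast
      ultimately show ?thesis using B by simp
    next
      case 2
      then show ?thesis using AB by blast
    qed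
  qed
  show "compatible E J K"
  proof (rule ccontr)
    assume nc: "\<not> compatible E J K"
    then have "J \<union> K \<in> E" by (simp add: compatible_def)
    moreover have "\<not> J \<union> K \<subseteq> M" using J by (auto simp: outer_def)
    moreover have "(J - M) \<union> (K - M) = (J \<union> K) - M" by blast
    ultimately have "(J - M) \<union> (K - M) \<in> ?E" by auto
    then show False using c nc sub[OF J K] sub[OF K J] by (auto simp: compatible_def)
  qed
qed

abbreviation "link_members a \<equiv> common_neighbours E (compatible E) a"

text \<open>If \<open>v \<subseteq> M\<close> and \<open>v \<union> w\<close> is a member, its union
  with \<open>M\<close> is the member \<open>w \<union> M\<close>; compatibility of \<open>w\<close>
  with \<open>M\<close> then forces \<open>w\<close> into \<open>M\<close>. Members of
  \<open>a\<close> not properly inside \<open>M\<close> are compatible with everything inside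
  \<open>M\<close>.\<close>

lemma inner_non_neighbours:
  assumes a: "a \<in> clique_complex E (compatible E)" "M \<in> a" and v: "v \<in> link_members a" "v \<subseteq> M"
  shows "non_neighbours (link_members a) (compatible E) v =
    non_neighbours (common_neighbours {J \<in> E. J \<subseteq> M} (compatible {J \<in> E. J \<subseteq> M}) {J \<in> a. J \<subset> M})
      (compatible {J \<in> E. J \<subseteq> M}) v" (is "?A = ?B")
proof
  let ?E = "{J \<in> E. J \<subseteq> M}"
  have ce: "compatible ?E x y \<longleftrightarrow> compatible E x y" if "x \<subseteq> M" "y \<subseteq> M" for x y
    using that by (auto simp: compatible_def)
  have ME: "M \<in> E" using a by (auto simp: clique_complex_def)
  have vE: "v \<in> E" "v \<noteq> {}" "v \<notin> a" using v nonempty by (auto simp: common_neighbours_def)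
  show "?A \<subseteq> ?B"
  proof
    fix w assume "w \<in> ?A"
    then have w: "w \<in> E" "w \<notin> a" "\<And>y. y \<in> a \<Longrightarrow> compatible E w y" "\<not> compatible E v w"
      by (auto simp: non_neighbours_def common_neighbours_def)
    have "w \<subseteq> M"
    proof (rule ccontr)
      assume "\<not> w \<subseteq> M"
      then have "M \<subseteq> w \<or> w \<union> M \<notin> E" using w(3)[OF a(2)] by (simp add: compatible_def)
      moreover have "\<not> M \<subseteq> w" using w(4) v(2) by (auto simp: compatible_def)
      moreover have "(v \<union> w) \<union> M \<in> E"
      proof (rule union)
        show "v \<union> w \<in> E" using w(4) by (simp add: compatible_def)
        show "(v \<union> w) \<inter> M \<noteq> {}" using vE v by blast
      qed (rule ME)
      moreover have "(v \<union> w) \<union> M = w \<union> M" using v by blast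
      ultimately show False by simp
    qed
    then show "w \<in> ?B" using w v ce by (auto simp: non_neighbours_subset_iff common_neighbours_def)
  qed
  show "?B \<subseteq> ?A"
  proof
    fix w assume "w \<in> ?B"
    then have w: "w \<in> E" "w \<subseteq> M" "w \<notin> {J \<in> a. J \<subset> M}" "\<And>y. y \<in> {J \<in> a. J \<subset> M} \<Longrightarrow> compatible E w y"
      "\<not> compatible E v w"
      using ce v(2) by (auto simp: non_neighbours_subset_iff common_neighbours_def)
    have wa: "w \<notin> a" using w(5) v(1) by (auto simp: common_neighbours_def)
    have "compatible E w y" if y: "y \<in> a" for y
    proof -
      have "compatible E y M" using a y by (cases "y = M") (auto simp: clique_complex_def compatible_def)
      then consider "y \<subset> M" | "M \<subseteq> y" | "y \<union> M \<notin> E" by (auto simp: compatible_def)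
      then show ?thesis
      proof cases
        case 1 then show ?thesis using w(4) y by blast
      next
        case 2 then show ?thesis using w(2) by (auto simp: compatible_def)
      next
        case 3
        have "w \<noteq> {}" using w nonempty by metis
        then have "(w \<union> y) \<union> M \<in> E" if "w \<union> y \<in> E" using that w(2) ME by (intro union[OF that ME]) blast
        moreover have "(w \<union> y) \<union> M = y \<union> M" using w(2) by blast
        ultimately show ?thesis using 3 by (auto simp: compatible_def)
      qed
    qed
    then show "w \<in> ?A" using w wa by (simp add: non_neighbours_subset_iff common_neighbours_def)
  qed
qed

text \<open>A member of \<open>outer M\<close> is compatible with all members inside
  \<open>M\<close>, so only the part of \<open>a\<close> outside \<open>M\<close> constrains the
  non-neighbours, and traces preserve compatibility.\<close>

lemma outer_non_neighbours:
  assumes a: "a \<in> clique_complex E (compatible E)" "M \<in> a" and v: "v \<in> link_members a" "\<not> v \<subseteq> M"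
  defines "E' \<equiv> (\<lambda>J. J - M) ` {J \<in> E. \<not> J \<subseteq> M}"
  shows "non_neighbours (link_members a) (compatible E) v \<subseteq> outer M"
    "(\<lambda>J. J - M) ` non_neighbours (link_members a) (compatible E) v =
      non_neighbours (common_neighbours E' (compatible E') ((\<lambda>J. J - M) ` {J \<in> a. \<not> J \<subseteq> M}))
        (compatible E') (v - M)" (is "?A = ?B")
proof -
  have ME: "M \<in> E" using a by (auto simp: clique_complex_def)
  have outer_iff: "J \<in> outer M \<longleftrightarrow> J \<in> E \<and> \<not> J \<subseteq> M \<and> compatible E J M" for J
    by (auto simp: outer_def compatible_def)
  have vo: "v \<in> outer M" using v a by (auto simp: outer_iff common_neighbours_def)
  have ao: "y \<in> outer M" if "y \<in> a" "\<not> y \<subseteq> M" for y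
    using that a by (auto simp: outer_iff clique_complex_def)
  have comp: "compatible E' (J - M) (K - M) \<longleftrightarrow> compatible E J K" if "J \<in> outer M" "K \<in> outer M" for J K
    unfolding E'_def using outer_compatible[OF ME that] .
  have inner: "compatible E w y" if w: "w \<in> outer M" and y: "y \<in> E" "y \<subseteq> M" for w y
  proof (cases rule: outer_cases[OF ME w])
    case 1 then show ?thesis using y by (auto simp: compatible_def)
  next
    case 2
    have "y \<noteq> {}" using y nonempty by metis
    then have "(w \<union> y) \<union> M \<in> E" if "w \<union> y \<in> E" using y by (intro union[OF that ME]) blast
    moreover have "(w \<union> y) \<union> M = w \<union> M" using y by blast
    ultimately show ?thesis using 2 by (auto simp: compatible_def)
  qed
  show sub: "non_neighbours (link_members a) (compatible E) v \<subseteq> outer M"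
  proof
    fix w assume w: "w \<in> non_neighbours (link_members a) (compatible E) v"
    then have "w \<in> E" "compatible E w M" "\<not> compatible E v w"
      using a by (auto simp: non_neighbours_def common_neighbours_def)
    then show "w \<in> outer M" using inner[OF vo, of w] by (auto simp: outer_iff)
  qed
  show "?A = ?B"
  proof
    show "?A \<subseteq> ?B"
    proof (rule image_subsetI)
      fix w assume w: "w \<in> non_neighbours (link_members a) (compatible E) v"
      then have wo: "w \<in> outer M" using sub by blast
      have w': "w \<notin> a" "\<And>y. y \<in> a \<Longrightarrow> compatible E w y" "\<not> compatible E v w"
        using w by (auto simp: non_neighbours_def common_neighbours_def)
      have "w - M \<in> E'" using wo by (auto simp: E'_def outer_def)
      moreover have "w - M \<notin> (\<lambda>J. J - M) ` {J \<in> a. \<not> J \<subseteq> M}"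
        using inj_on_eq_iff[OF inj_outer[OF ME] wo ao] w'(1) by blast
      moreover have "compatible E' (w - M) (y - M)" if "y \<in> a" "\<not> y \<subseteq> M" for y
        using comp[OF wo ao[OF that]] w'(2)[OF that(1)] by simp
      ultimately show "w - M \<in> ?B"
        using comp[OF vo wo] w'(3) by (auto simp: non_neighbours_subset_iff common_neighbours_def)
    qed
    show "?B \<subseteq> ?A"
    proof
      fix x assume x: "x \<in> ?B"
      then have "x \<in> (\<lambda>J. J - M) ` outer M"
        using outer_contraction[OF ME] by (auto simp: non_neighbours_def common_neighbours_def E'_def)
      then obtain w where w: "w \<in> outer M" "x = w - M" by blast
      have inc: "\<not> compatible E v w" using x w comp[OF vo w(1)] by (simp add: non_neighbours_subset_iff)
      then have "w \<notin> a" using v(1) by (auto simp: common_neighbours_def)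
      moreover have "compatible E w y" if y: "y \<in> a" for y
      proof (cases "y \<subseteq> M")
        case True
        then show ?thesis using inner[OF w(1)] a y by (auto simp: clique_complex_def)
      next
        case False
        then have "compatible E' x (y - M)"
          using x y by (simp add: non_neighbours_subset_iff common_neighbours_def)
        then show ?thesis using comp[OF w(1) ao[OF y False]] w(2) by simp
      qed
      ultimately have "w \<in> non_neighbours (link_members a) (compatible E) v"
        using inc w by (simp add: non_neighbours_subset_iff common_neighbours_def outer_def)
      then show "x \<in> ?A" using w by blast
    qed
  qed
qed

end

text \<open>Induction on the size of the face, for all building sets at once. A member
  \<open>M\<close> of the face splits it into parts inside and outside, and neither part counts
  \<open>M\<close>, so both are smaller. For the empty face the results on \<open>N v\<close>
  apply.\<close>

lemma building_set_unobstructed: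
  assumes "building_set lt E"
  shows "unobstructed E (compatible E)"
proof -
  have "(\<forall>v\<in>common_neighbours E (compatible E) a. coned_at (common_neighbours E (compatible E) a) (compatible E) v) \<and>
     (\<forall>v\<in>common_neighbours E (compatible E) a. \<forall>w\<in>common_neighbours E (compatible E) a.
        v \<noteq> w \<longrightarrow> \<not> compatible E v w \<longrightarrow> connected_at (common_neighbours E (compatible E) a) (compatible E) v w)"
    if "a \<in> clique_complex E (compatible E)" for a
    using assms that
  proof (induction "card a" arbitrary: a E rule: less_induct)
    case less
    interpret building_set lt E by (rule less.prems)
    define X where "X = common_neighbours E (compatible E) a"
    have fin_a: "finite a" using less.prems(2) finite_E finite_subset by (auto simp: clique_complex_def)
    have XE: "X \<subseteq> E" by (auto simp: X_def common_neighbours_def)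
    show ?case
    proof (cases "a = {}")
      case True
      then have "X = E" by (simp add: X_def common_neighbours_def)
      moreover have "coned_at E (compatible E) v" if "v \<in> E" for v
        using coned_N[OF that] by (simp add: coned_at_iff)
      moreover have "connected_at E (compatible E) v w" if "v \<in> E" "w \<in> E" "\<not> compatible E v w" for v w
        using connected_N[OF that(1), of w] that by (simp add: connected_at_iff non_neighbours_subset_iff)
      ultimately show ?thesis by (simp flip: X_def)
    next
      case False
      then obtain M where M: "M \<in> a" by blast
      then have ME: "M \<in> E" using less.prems(2) by (auto simp: clique_complex_def)
      define E1 where "E1 = {J \<in> E. J \<subseteq> M}"
      define a1 where "a1 = {J \<in> a. J \<subset> M}"
      define E2 where "E2 = (\<lambda>J. J - M) ` {J \<in> E. \<not> J \<subseteq> M}"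
      define a2 where "a2 = (\<lambda>J. J - M) ` {J \<in> a. \<not> J \<subseteq> M}"
      define X1 where "X1 = common_neighbours E1 (compatible E1) a1"
      define X2 where "X2 = common_neighbours E2 (compatible E2) a2"
      have ce1: "compatible E1 x y \<longleftrightarrow> compatible E x y" if "x \<subseteq> M" "y \<subseteq> M" for x y
        using that by (auto simp: compatible_def E1_def)
      have N1: "non_neighbours X (compatible E) v = non_neighbours X1 (compatible E1) v"
        if "v \<in> X" "v \<subseteq> M" for v
        using inner_non_neighbours[OF less.prems(2) M, of v] that
        by (simp add: X_def X1_def E1_def a1_def)
      have N2: "non_neighbours X (compatible E) v \<subseteq> outer M"
        "(\<lambda>J. J - M) ` non_neighbours X (compatible E) v = non_neighbours X2 (compatible E2) (v - M)"
        if "v \<in> X" "\<not> v \<subseteq> M" for v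
        using outer_non_neighbours[OF less.prems(2) M, of v] that
        by (simp_all add: X_def X2_def E2_def a2_def)
      have c2: "compatible E2 (J - M) (K - M) \<longleftrightarrow> compatible E J K" if "J \<in> outer M" "K \<in> outer M" for J K
        unfolding E2_def using outer_compatible[OF ME that] .
      have outer_iff: "J \<in> outer M \<longleftrightarrow> J \<in> E \<and> \<not> J \<subseteq> M \<and> compatible E J M" for J
        by (auto simp: outer_def compatible_def)
      have X_outer: "v \<in> outer M" if "v \<in> X" "\<not> v \<subseteq> M" for v
        using that M by (auto simp: outer_iff X_def common_neighbours_def)
      have a_outer: "y \<in> outer M" if "y \<in> a" "\<not> y \<subseteq> M" for y
        using that M less.prems(2) by (auto simp: outer_iff clique_complex_def)
      have a1c: "a1 \<in> clique_complex E1 (compatible E1)"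
      proof -
        have "a1 \<subseteq> E1" using less.prems(2) by (auto simp: clique_complex_def a1_def E1_def)
        moreover have "compatible E1 x y" if "x \<in> a1" "y \<in> a1" "x \<noteq> y" for x y
        proof -
          have "compatible E x y" using that less.prems(2) by (simp add: clique_complex_def a1_def)
          then show ?thesis using ce1[of x y] that by (simp add: a1_def psubset_imp_subset)
        qed
        ultimately show ?thesis by (simp add: clique_complex_def)
      qed
      have a2c: "a2 \<in> clique_complex E2 (compatible E2)"
      proof -
        have "a2 \<subseteq> E2" using less.prems(2) by (auto simp: clique_complex_def a2_def E2_def)
        moreover have "compatible E2 x y" if "x \<in> a2" "y \<in> a2" "x \<noteq> y" for x y
        proof -
          obtain J K where "J \<in> a" "\<not> J \<subseteq> M" "x = J - M" "K \<in> a" "\<not> K \<subseteq> M" "y = K - M"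
            using \<open>x \<in> a2\<close> \<open>y \<in> a2\<close> by (auto simp: a2_def)
          moreover from this have "compatible E J K"
            using that(3) less.prems(2) unfolding clique_complex_def by blast
          ultimately show ?thesis using c2 a_outer by simp
        qed
        ultimately show ?thesis by (simp add: clique_complex_def)
      qed
      have card1: "card a1 < card a" using M fin_a by (intro psubset_card_mono) (auto simp: a1_def)
      have card2: "card a2 < card a"
      proof -
        have "card a2 \<le> card {J \<in> a. \<not> J \<subseteq> M}" unfolding a2_def using fin_a by (intro card_image_le) simp
        also have "\<dots> < card a" using M fin_a by (intro psubset_card_mono) auto
        finally show ?thesis .
      qed
      have IH1: "coned_at X1 (compatible E1) v" "w \<in> X1 \<Longrightarrow> v \<noteq> w \<Longrightarrow> \<not> compatible E1 v w \<Longrightarrow> connected_at X1 (compatible E1) v w"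
        if "v \<in> X1" for v w
        using less.hyps[OF card1 restriction[of M, folded E1_def] a1c] that by (auto simp flip: X1_def)
      have IH2: "coned_at X2 (compatible E2) v" "w \<in> X2 \<Longrightarrow> v \<noteq> w \<Longrightarrow> \<not> compatible E2 v w \<Longrightarrow> connected_at X2 (compatible E2) v w"
        if "v \<in> X2" for v w
        using less.hyps[OF card2 contraction[of M, folded E2_def] a2c] that by (auto simp flip: X2_def)
      have in1: "v \<in> X1" if "v \<in> X" "v \<subseteq> M" for v
        using that ce1 by (auto simp: X_def X1_def common_neighbours_def E1_def a1_def)
      have in2: "v - M \<in> X2" if v: "v \<in> X" "\<not> v \<subseteq> M" for v
      proof -
        have "v - M \<in> E2" using v by (auto simp: X_def common_neighbours_def E2_def)
        moreover have "v - M \<notin> a2"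
          using inj_on_eq_iff[OF inj_outer[OF ME] X_outer[OF v] a_outer] v(1)
          by (auto simp: a2_def X_def common_neighbours_def)
        moreover have "compatible E2 (v - M) y" if "y \<in> a2" for y
          using that c2[OF X_outer[OF v] a_outer] v(1) by (auto simp: a2_def X_def common_neighbours_def)
        ultimately show ?thesis by (simp add: X2_def common_neighbours_def)
      qed
      have "coned_at X (compatible E) v" if v: "v \<in> X" for v
      proof (cases "v \<subseteq> M")
        case True
        define W where "W = non_neighbours X1 (compatible E1) v"
        have "coned W (compatible E1)" using IH1(1)[OF in1[OF v True]] by (simp add: coned_at_iff W_def)
        moreover have "x \<subseteq> M" if "x \<in> W" for x
          using that by (auto simp: W_def non_neighbours_def X1_def common_neighbours_def E1_def)
        then have "compatible E1 x y \<longleftrightarrow> compatible E x y" if "x \<in> W" "y \<in> W" for x y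
          using that by (intro ce1)
        ultimately have "coned W (compatible E)"
          using coned_image[of "\<lambda>x. x" W "compatible E1" "compatible E"] by simp
        then show ?thesis using N1[OF v True] by (simp add: coned_at_iff W_def)
      next
        case False
        define W where "W = non_neighbours X (compatible E) v"
        have Wo: "W \<subseteq> outer M" using N2(1)[OF v False] by (simp add: W_def)
        have "coned ((\<lambda>J. J - M) ` W) (compatible E2)"
          using IH2(1)[OF in2[OF v False]] N2(2)[OF v False] by (simp add: coned_at_iff W_def)
        moreover have "inj_on (\<lambda>J. J - M) W" using inj_outer[OF ME] Wo by (rule inj_on_subset)
        moreover have "compatible E2 (x - M) (y - M) \<longleftrightarrow> compatible E x y" if "x \<in> W" "y \<in> W" for x y
          using c2 Wo that by blast
        ultimately show ?thesis
          using coned_image[of "\<lambda>J. J - M" W "compatible E2" "compatible E"] by (simp add: coned_at_iff W_def)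
      qed
      moreover have "connected_at X (compatible E) v w"
        if v: "v \<in> X" and w: "w \<in> X" and vw: "v \<noteq> w" "\<not> compatible E v w" for v w
      proof -
        define A where "A = non_neighbours X (compatible E) v"
        define B where "B = non_neighbours X (compatible E) w"
        have wA: "w \<in> A" and vB: "v \<in> B" using v w vw compatible_sym by (auto simp: A_def B_def non_neighbours_def)
        show ?thesis
        proof (cases "v \<subseteq> M")
          case True
          have "w \<in> non_neighbours X1 (compatible E1) v" using wA N1[OF v True] by (simp add: A_def)
          then have wM: "w \<subseteq> M" by (auto simp: non_neighbours_def X1_def common_neighbours_def E1_def)
          have AB: "A = non_neighbours X1 (compatible E1) v" "B = non_neighbours X1 (compatible E1) w"
            using N1[OF v True] N1[OF w wM] by (simp_all add: A_def B_def)
          have "\<not> compatible E1 v w" using vw ce1[OF True wM] by simp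
          then have "graph_connected ((A - {w}) \<union> (B - {v})) (compatible E1)"
            using IH1(2)[OF in1[OF v True] in1[OF w wM] vw(1)] by (simp add: connected_at_iff AB)
          moreover have "compatible E1 x y \<longleftrightarrow> compatible E x y"
            if "x \<in> (A - {w}) \<union> (B - {v})" "y \<in> (A - {w}) \<union> (B - {v})" for x y
            using that by (intro ce1) (auto simp: AB non_neighbours_def X1_def common_neighbours_def E1_def)
          ultimately have "graph_connected ((A - {w}) \<union> (B - {v})) (compatible E)"
            using graph_connected_image[of "\<lambda>x. x" "(A - {w}) \<union> (B - {v})" "compatible E1" "compatible E"] by simp
          then show ?thesis by (simp add: connected_at_iff A_def B_def)
        next
          case False
          have Ao: "A \<subseteq> outer M" using N2(1)[OF v False] by (simp add: A_def)
          then have wM: "\<not> w \<subseteq> M" using wA by (auto simp: outer_def)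
          have Bo: "B \<subseteq> outer M" using N2(1)[OF w wM] by (simp add: B_def)
          let ?f = "\<lambda>J. J - M" and ?Y = "(A - {w}) \<union> (B - {v})"
          have "?f ` (S - {x}) = ?f ` S - {?f x}" if "S \<subseteq> outer M" "x \<in> S" for S x
          proof -
            have "S - {x} \<subseteq> outer M" "{x} \<subseteq> outer M" using that by blast+
            from inj_on_image_set_diff[OF inj_outer[OF ME] this] show ?thesis by simp
          qed
          from this[OF Ao wA] this[OF Bo vB]
          have "?f ` (A - {w}) = ?f ` A - {?f w}" "?f ` (B - {v}) = ?f ` B - {?f v}" .
          then have img: "?f ` ?Y = (non_neighbours X2 (compatible E2) (v - M) - {w - M}) \<union>
              (non_neighbours X2 (compatible E2) (w - M) - {v - M})"
            using N2(2)[OF v False] N2(2)[OF w wM] by (simp add: image_Un A_def B_def)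
          have ne: "v - M \<noteq> w - M"
            using inj_on_eq_iff[OF inj_outer[OF ME] X_outer[OF v False] X_outer[OF w wM]] vw by simp
          have "\<not> compatible E2 (v - M) (w - M)" using c2[OF X_outer[OF v False] X_outer[OF w wM]] vw by simp
          then have "graph_connected (?f ` ?Y) (compatible E2)"
            using IH2(2)[OF in2[OF v False] in2[OF w wM] ne] by (simp add: connected_at_iff img)
          moreover have "inj_on ?f ?Y" using inj_outer[OF ME] by (rule inj_on_subset) (use Ao Bo in blast)
          moreover have "compatible E2 (x - M) (y - M) \<longleftrightarrow> compatible E x y" if "x \<in> ?Y" "y \<in> ?Y" for x y
            using that Ao Bo by (intro c2) blast+
          ultimately have "graph_connected ?Y (compatible E)"
            using graph_connected_image[of ?f ?Y "compatible E2" "compatible E"] by blast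
          then show ?thesis by (simp add: connected_at_iff A_def B_def)
        qed
      qed
      ultimately show ?thesis by (simp flip: X_def)
    qed
  qed
  then show ?thesis unfolding unobstructed_def by blast
qed

section \<open>Starrings and linear homeomorphisms\<close>

lemma simplicial_complex_subset: "simplicial_complex K \<Longrightarrow> f \<in> K \<Longrightarrow> g \<subseteq> f \<Longrightarrow> g \<in> K"
  by (auto simp: simplicial_complex_def)

lemma closed_star_iff:
  assumes "simplicial_complex K"
  shows "H \<in> disj_join (Pow f) (link f K) \<longleftrightarrow> H \<union> f \<in> K"
proof
  assume "H \<in> disj_join (Pow f) (link f K)"
  then obtain h g where "h \<subseteq> f" "g \<union> f \<in> K" "H = h \<union> g" by (auto simp: disj_join_def link_def)
  moreover from this have "H \<union> f = g \<union> f" by blast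
  ultimately show "H \<union> f \<in> K" by simp
next
  assume H: "H \<union> f \<in> K"
  then have "H - f \<in> K" using assms simplicial_complex_subset by (metis Diff_subset Un_upper1 subset_trans)
  then have "H - f \<in> link f K" using H by (auto simp: link_def)
  moreover have "H = (H \<inter> f) \<union> (H - f)" by blast
  ultimately show "H \<in> disj_join (Pow f) (link f K)" unfolding disj_join_def by blast
qed

text \<open>Replaces the joins by one membership test: \<open>H\<close> lies in the closed star of
  \<open>f\<close> iff \<open>H \<union> f \<in> K\<close>.\<close>

lemma starring_iff:
  assumes K: "simplicial_complex K" and v: "v \<notin> vertices K" and f: "f \<in> K"
  shows "H \<in> starring f v K \<longleftrightarrow> \<not> f \<subseteq> H \<and> (if v \<in> H then (H - {v}) \<union> f \<in> K else H \<in> K)"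
proof -
  have vf: "v \<notin> f" using v f by blast
  have join: "H \<in> disj_join (disj_join (boundary_complex f) (Pow {v})) (link f K) \<longleftrightarrow>
      \<not> f \<subseteq> H \<and> (H - {v}) \<union> f \<in> K"
  proof
    assume "H \<in> disj_join (disj_join (boundary_complex f) (Pow {v})) (link f K)"
    then obtain h x g where hxg: "h \<subset> f" "x \<subseteq> {v}" "g \<in> K" "g \<inter> f = {}" "g \<union> f \<in> K" "H = h \<union> x \<union> g"
      by (auto simp: disj_join_def boundary_complex_def link_def)
    have "v \<notin> g" using hxg(3) v by blast
    then have "(H - {v}) \<union> f = g \<union> f" using hxg vf by blast
    moreover have "\<not> f \<subseteq> H" using hxg vf by blast
    ultimately show "\<not> f \<subseteq> H \<and> (H - {v}) \<union> f \<in> K" using hxg by simp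
  next
    assume H: "\<not> f \<subseteq> H \<and> (H - {v}) \<union> f \<in> K"
    then have "H - {v} - f \<in> K" using K simplicial_complex_subset by (metis Diff_subset Un_upper1 subset_trans)
    then have "H - {v} - f \<in> link f K" using H by (auto simp: link_def)
    moreover have "H \<inter> f \<in> boundary_complex f" using H by (auto simp: boundary_complex_def)
    moreover have "H = ((H \<inter> f) \<union> (H \<inter> {v})) \<union> (H - {v} - f)" by blast
    ultimately show "H \<in> disj_join (disj_join (boundary_complex f) (Pow {v})) (link f K)"
      unfolding disj_join_def by blast
  qed
  have "v \<notin> H" if "H \<in> K" using that v by blast
  moreover have "H \<in> K" if "v \<notin> H" "(H - {v}) \<union> f \<in> K"
    using that simplicial_complex_subset[OF K that(2), of H] by auto
  moreover have "H \<union> f \<in> K" if "f \<subseteq> H" "H \<in> K" using that by (simp add: sup.absorb1)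
  moreover have "(H - {v}) = H" if "v \<notin> H" using that by simp
  ultimately show ?thesis
    unfolding starring_def Un_iff Diff_iff join closed_star_iff[OF K] by (cases "v \<in> H") auto
qed

lemma simplicial_complex_starring:
  assumes K: "simplicial_complex K" and v: "v \<notin> vertices K" and f: "f \<in> K" "f \<noteq> {}"
  shows "simplicial_complex (starring f v K)" "vertices (starring f v K) \<subseteq> insert v (vertices K)"
proof -
  note iff = starring_iff[OF K v f(1)]
  have fin: "finite (vertices K)" using K by (auto simp: simplicial_complex_def)
  show sub: "vertices (starring f v K) \<subseteq> insert v (vertices K)"
  proof
    fix x assume "x \<in> vertices (starring f v K)"
    then obtain H where H: "x \<in> H" "H \<in> starring f v K" by blast
    then have "(H - {v}) \<union> f \<in> K \<or> H \<in> K" using iff[of H] by (simp split: if_splits)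
    then show "x \<in> insert v (vertices K)" using H by blast
  qed
  then have "starring f v K \<subseteq> Pow (insert v (vertices K))" by blast
  then have "finite (starring f v K)" by (rule finite_subset) (use fin in simp)
  moreover have "{} \<in> starring f v K" using K f by (simp add: iff simplicial_complex_def)
  moreover have "finite H" if "H \<in> starring f v K" for H
  proof (rule finite_subset)
    show "H \<subseteq> insert v (vertices K)" using that sub by blast
  qed (use fin in simp)
  moreover have "G \<in> starring f v K" if H: "H \<in> starring f v K" and "G \<subseteq> H" for G H
  proof -
    have "\<not> f \<subseteq> G" using H that iff[of H] by blast
    moreover have "G \<in> K" if "v \<notin> G"
    proof (cases "v \<in> H")
      case True
      then have "(H - {v}) \<union> f \<in> K" using H iff[of H] by simp
      then show ?thesis using simplicial_complex_subset[OF K] that \<open>G \<subseteq> H\<close> by blast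
    next
      case False
      then show ?thesis using H iff[of H] simplicial_complex_subset[OF K _ \<open>G \<subseteq> H\<close>] by simp
    qed
    moreover have "(G - {v}) \<union> f \<in> K" if "v \<in> G"
    proof -
      have "(H - {v}) \<union> f \<in> K" using H iff[of H] that \<open>G \<subseteq> H\<close> by auto
      then show ?thesis by (rule simplicial_complex_subset[OF K]) (use \<open>G \<subseteq> H\<close> in blast)
    qed
    ultimately show ?thesis by (simp add: iff)
  qed
  ultimately show "simplicial_complex (starring f v K)" by (simp add: simplicial_complex_def)
qed

section \<open>Realisations and linear maps\<close>

lemma realization_iff:
  assumes K: "simplicial_complex K" and W: "finite W" "vertices K \<subseteq> W"
  shows "x \<in> realization K \<longleftrightarrow> (\<forall>u. 0 \<le> x u) \<and> {u. x u \<noteq> 0} \<in> K \<and> sum x W = 1"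
proof -
  have "(\<Sum>u\<in>{u. x u \<noteq> 0}. x u) = sum x W" if "{u. x u \<noteq> 0} \<in> K"
    using that W by (intro sum.mono_neutral_left) auto
  then show ?thesis by (auto simp: realization_def)
qed

definition linear_map :: "(('v \<Rightarrow> real) \<Rightarrow> ('w \<Rightarrow> real)) \<Rightarrow> bool" where
  "linear_map h \<longleftrightarrow> (\<forall>x y. h (\<lambda>u. x u + y u) = (\<lambda>w. h x w + h y w)) \<and>
     (\<forall>c x. h (\<lambda>u. c * x u) = (\<lambda>w. c * h x w))"

lemma linear_map_add: "linear_map h \<Longrightarrow> h (\<lambda>u. x u + y u) = (\<lambda>w. h x w + h y w)"
  and linear_map_scale: "linear_map h \<Longrightarrow> h (\<lambda>u. c * x u) = (\<lambda>w. c * h x w)"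
  by (simp_all add: linear_map_def)

lemma linear_map_combination:
  assumes h: "linear_map h" and S: "finite S"
  shows "h (combination S c q) = combination S c (\<lambda>p. h (q p))"
proof -
  have h0: "h (\<lambda>v. 0) = (\<lambda>w. 0)" using linear_map_scale[OF h, of 0 "\<lambda>v. 0"] by simp
  show ?thesis using S
  proof (induction S rule: finite_induct)
    case (insert p S)
    have "h (\<lambda>v. c p * q p v + (\<Sum>p\<in>S. c p * q p v)) =
        (\<lambda>w. h (\<lambda>v. c p * q p v) w + h (\<lambda>v. \<Sum>p\<in>S. c p * q p v) w)"
      by (rule linear_map_add[OF h])
    also have "h (\<lambda>v. c p * q p v) = (\<lambda>w. c p * h (q p) w)" by (rule linear_map_scale[OF h])
    finally show ?case using insert by (simp add: combination_def)
  qed (simp add: combination_def h0)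
qed

lemma linear_map_compose: "linear_map g \<Longrightarrow> linear_map h \<Longrightarrow> linear_map (h \<circ> g)"
  by (simp add: linear_map_def)

definition vertex_point :: "'v \<Rightarrow> 'v \<Rightarrow> real" where
  "vertex_point u = (\<lambda>w. of_bool (w = u))"

lemma inj_vertex_point: "inj vertex_point"
proof (rule injI)
  fix u w :: 'a assume "vertex_point u = vertex_point w"
  then have "vertex_point u u = vertex_point w u" by simp
  then show "u = w" by (simp add: vertex_point_def split: if_splits)
qed

text \<open>Provides the polytopes for \<open>piecewise_linear\<close>: the hulls of the vertex
  points of the single faces.\<close>

lemma realization_hulls:
  assumes K: "simplicial_complex K"
  shows "realization K = (\<Union>f\<in>K. finite_hull (vertex_point ` f))"
proof
  have fin: "finite (vertices K)" using K by (auto simp: simplicial_complex_def)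
  note iff = realization_iff[OF K fin order_refl]
  have comb: "combination (vertex_point ` f) c (\<lambda>p. p) = (\<lambda>w. if w \<in> f then c (vertex_point w) else 0)"
    if "finite f" for f :: "'a set" and c
  proof
    fix w
    have "combination (vertex_point ` f) c (\<lambda>p. p) w = (\<Sum>u\<in>f. c (vertex_point u) * vertex_point u w)"
      unfolding combination_def by (subst sum.reindex) (use inj_vertex_point in \<open>auto intro: inj_on_subset\<close>)
    also have "\<dots> = (\<Sum>u\<in>f. if w = u then c (vertex_point u) else 0)"
      by (intro sum.cong) (auto simp: vertex_point_def)
    also have "\<dots> = (if w \<in> f then c (vertex_point w) else 0)" using that by simp
    finally show "combination (vertex_point ` f) c (\<lambda>p. p) w = (if w \<in> f then c (vertex_point w) else 0)" .
  qed
  have reindex: "sum c (vertex_point ` f) = (\<Sum>u\<in>f. c (vertex_point u))" for c :: "('a \<Rightarrow> real) \<Rightarrow> real" and f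
    by (subst sum.reindex) (use inj_vertex_point in \<open>auto intro: inj_on_subset\<close>)
  show "realization K \<subseteq> (\<Union>f\<in>K. finite_hull (vertex_point ` f))"
  proof
    fix x assume x: "x \<in> realization K"
    define f where "f = {u. x u \<noteq> 0}"
    define c where "c p = x (inv_into UNIV vertex_point p)" for p
    have c: "c (vertex_point u) = x u" for u by (simp add: c_def inv_into_f_f[OF inj_vertex_point])
    have f: "f \<in> K" "sum x f = 1" "\<And>u. 0 \<le> x u" using x by (auto simp: realization_def f_def)
    then have "finite f" using K by (simp add: simplicial_complex_def)
    have "combination (vertex_point ` f) c (\<lambda>p. p) = x"
      unfolding comb[OF \<open>finite f\<close>] c by (auto simp: f_def)
    moreover have "convex_weights (vertex_point ` f) c"
      using f by (auto simp: convex_weights_def reindex c)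
    ultimately show "x \<in> (\<Union>f\<in>K. finite_hull (vertex_point ` f))" using f(1) unfolding finite_hull_def by blast
  qed
  show "(\<Union>f\<in>K. finite_hull (vertex_point ` f)) \<subseteq> realization K"
  proof clarify
    fix f x assume f: "f \<in> K" and "x \<in> finite_hull (vertex_point ` f)"
    then obtain c where c: "convex_weights (vertex_point ` f) c" "x = combination (vertex_point ` f) c (\<lambda>p. p)"
      by (auto simp: finite_hull_def)
    have ff: "finite f" using K f by (simp add: simplicial_complex_def)
    have x: "x = (\<lambda>w. if w \<in> f then c (vertex_point w) else 0)" using c(2) comb[OF ff] by simp
    have "{u. x u \<noteq> 0} \<in> K" by (rule simplicial_complex_subset[OF K f]) (auto simp: x)
    moreover have "sum x (vertices K) = sum x f"
      by (intro sum.mono_neutral_right fin) (use f in \<open>auto simp: x\<close>)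
    moreover have "sum x f = 1" using c(1) by (simp add: convex_weights_def reindex x)
    moreover have "\<forall>u. 0 \<le> x u" using c(1) by (auto simp: convex_weights_def x)
    ultimately show "x \<in> realization K" by (simp add: iff)
  qed
qed

text \<open>Linearity is asked of the forward map only; the inverse of a starring map involves a
  minimum and is not linear.\<close>

definition linearly_homeomorphic :: "'v set set \<Rightarrow> 'w set set \<Rightarrow> bool" where
  "linearly_homeomorphic K L \<longleftrightarrow>
     (\<exists>h h'. homeomorphism (realization K) (realization L) h h' \<and> linear_map h)"

lemma linearly_homeomorphic_trans:
  assumes "linearly_homeomorphic K L" "linearly_homeomorphic L M"
  shows "linearly_homeomorphic K M"
proof -
  obtain g g' h h' where "homeomorphism (realization K) (realization L) g g'" "linear_map g"
    "homeomorphism (realization L) (realization M) h h'" "linear_map h"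
    using assms unfolding linearly_homeomorphic_def by blast
  then show ?thesis
    using homeomorphism_compose linear_map_compose unfolding linearly_homeomorphic_def by blast
qed

lemma pl_homeomorphic_if_linearly:
  assumes K: "simplicial_complex K" and "linearly_homeomorphic K L"
  shows "pl_homeomorphic K L"
proof -
  obtain h h' where h: "homeomorphism (realization K) (realization L) h h'" "linear_map h"
    using assms by (auto simp: linearly_homeomorphic_def)
  have "piecewise_linear (realization K) h"
    unfolding piecewise_linear_def
  proof (intro exI conjI ballI)
    show "finite ((\<lambda>f. vertex_point ` f) ` K)" using K by (simp add: simplicial_complex_def)
    show fin: "finite S" if "S \<in> (\<lambda>f. vertex_point ` f) ` K" for S
      using that K by (auto simp: simplicial_complex_def)
    show "realization K = (\<Union>S\<in>(\<lambda>f. vertex_point ` f) ` K. finite_hull S)"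
      using realization_hulls[OF K] by simp
    show "affine_on_hull S h" if "S \<in> (\<lambda>f. vertex_point ` f) ` K" for S
      using linear_map_combination[OF h(2) fin[OF that]] by (simp add: affine_on_hull_def)
  qed
  then show ?thesis using h unfolding pl_homeomorphic_def by blast
qed

lemma continuous_coordinate: "continuous_on S (\<lambda>x. x (u :: 'u) :: real)"
  by (rule continuous_on_subset[OF continuous_on_product_coordinates subset_UNIV])

lemma continuous_on_const_if:
  "continuous_on S f \<Longrightarrow> continuous_on S g \<Longrightarrow> continuous_on S (\<lambda>x. if P then f x else g x)"
  by (cases P) simp_all

lemma continuous_coordinate_Min:
  assumes "finite f" "f \<noteq> {}"
  shows "continuous_on S (\<lambda>x. Min (x ` f) :: real)"
  using assms
proof (induction f rule: finite_ne_induct)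
  case (singleton u)
  then show ?case by (simp add: continuous_coordinate)
next
  case (insert u f)
  then have "Min (x ` insert u f) = min (x u) (Min (x ` f))" for x :: "'a \<Rightarrow> real" by simp
  then show ?case using insert by (simp add: continuous_coordinate continuous_on_min)
qed

text \<open>The new vertex is sent to the barycentre of the face.\<close>

lemma starring_linearly_homeomorphic:
  assumes K: "simplicial_complex K" and v: "v \<notin> vertices K" and f: "f \<in> K" "f \<noteq> {}"
  shows "linearly_homeomorphic (starring f v K) K"
proof -
  define g where "g x = (\<lambda>u. if u = v then 0 else x u + (if u \<in> f then x v / card f else 0))" for x :: "'a \<Rightarrow> real"
  define m where "m y = Min (y ` f)" for y :: "'a \<Rightarrow> real"
  \<comment> \<open>On a face of the starring some coordinate in \<open>f\<close> is 0. After
    \<open>g\<close> has spread the weight of \<open>v\<close> evenly over \<open>f\<close>, the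
    minimum on \<open>f\<close> is therefore exactly one share, and \<open>card f\<close> shares
    restore the weight.\<close>
  define g' where "g' y = (\<lambda>u. if u = v then card f * m y else y u - (if u \<in> f then m y else 0))" for y :: "'a \<Rightarrow> real"
  let ?W = "insert v (vertices K)"
  have finV: "finite (vertices K)" using K by (auto simp: simplicial_complex_def)
  have ff: "finite f" using f K by (simp add: simplicial_complex_def)
  have fV: "f \<subseteq> vertices K" using f by blast
  have vf: "v \<notin> f" using fV v by blast
  have cf: "real (card f) > 0" using f ff by (simp add: card_gt_0_iff)
  note iff = starring_iff[OF K v f(1)]
  note iffK = realization_iff[OF K finV order_refl]
  have iffL: "x \<in> realization (starring f v K) \<longleftrightarrow>
      (\<forall>u. 0 \<le> x u) \<and> {u. x u \<noteq> 0} \<in> starring f v K \<and> sum x ?W = 1" for x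
    using finV by (intro realization_iff simplicial_complex_starring[OF K v f]) simp
  have sum_f: "(\<Sum>u\<in>vertices K. if u \<in> f then c else 0) = real (card f) * c" for c :: real
  proof -
    have "(\<Sum>u\<in>vertices K. if u \<in> f then c else 0) = (\<Sum>u\<in>f. c)"
      using fV finV by (intro sum.mono_neutral_cong_right) auto
    then show ?thesis by simp
  qed
  have gK: "g x \<in> realization K" and m: "m (g x) = x v / card f"
    if "x \<in> realization (starring f v K)" for x
  proof -
    have x: "\<And>u. 0 \<le> x u" "{u. x u \<noteq> 0} \<in> starring f v K" "sum x ?W = 1" using that iffL by auto
    have "{u. g x u \<noteq> 0} \<in> K"
    proof (cases "x v = 0")
      case True
      then have "g x = x" by (auto simp: g_def)
      then show ?thesis using x(2) True by (simp add: iff)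
    next
      case False
      then have "x v > 0" using x(1)[of v] by simp
      define c where "c = x v / card f"
      have "c > 0" using \<open>x v > 0\<close> cf by (simp add: c_def)
      then have pos: "x u + c \<noteq> 0" for u using x(1)[of u] by linarith
      have g: "g x u = (if u = v then 0 else x u + (if u \<in> f then c else 0))" for u by (simp add: g_def c_def)
      have "{u. g x u \<noteq> 0} = ({u. x u \<noteq> 0} - {v}) \<union> f"
        unfolding g using pos vf by auto
      then show ?thesis using x(2) False by (simp add: iff)
    qed
    moreover have "sum (g x) (vertices K) = (\<Sum>u\<in>vertices K. x u + (if u \<in> f then x v / card f else 0))"
      using v by (intro sum.cong) (auto simp: g_def)
    then have "sum (g x) (vertices K) = 1"
      using x(3) finV v cf by (simp add: sum.distrib sum_f)
    moreover have "\<forall>u. 0 \<le> g x u" using x(1) by (simp add: g_def)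
    ultimately show "g x \<in> realization K" by (simp add: iffK)
    obtain u0 where u0: "u0 \<in> f" "x u0 = 0" using x(2) by (auto simp: iff)
    show "m (g x) = x v / card f"
      unfolding m_def
    proof (rule Min_eqI)
      show "x v / card f \<in> g x ` f" using u0 vf by (intro image_eqI[of _ _ u0]) (auto simp: g_def)
      show "x v / card f \<le> y" if "y \<in> g x ` f" for y using that x(1) vf by (auto simp: g_def)
    qed (use ff in simp)
  qed
  have g'L: "g' y \<in> realization (starring f v K)" and yv: "y v = 0" if "y \<in> realization K" for y
  proof -
    have y: "\<And>u. 0 \<le> y u" "{u. y u \<noteq> 0} \<in> K" "sum y (vertices K) = 1" using that iffK by auto
    show yv: "y v = 0" using y(2) v by blast
    have mle: "m y \<le> y u" if "u \<in> f" for u using that ff by (simp add: m_def)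
    have "m y \<in> y ` f" using ff f by (simp add: m_def)
    then obtain u0 where u0: "u0 \<in> f" "m y = y u0" by blast
    then have m0: "0 \<le> m y" using y by simp
    have "\<not> f \<subseteq> {u. g' y u \<noteq> 0}" using u0 vf by (auto simp: g'_def)
    moreover have "{u. g' y u \<noteq> 0} \<in> K" if "m y = 0"
    proof -
      have "g' y = y" using that yv by (auto simp: g'_def)
      then show ?thesis using y by simp
    qed
    moreover have "{u. g' y u \<noteq> 0} - {v} \<union> f \<in> K" if "m y \<noteq> 0"
    proof -
      have "y u \<noteq> 0" if "u \<in> f" for u using mle[OF that] m0 \<open>m y \<noteq> 0\<close> by auto
      then have "{u. g' y u \<noteq> 0} - {v} \<union> f = {u. y u \<noteq> 0}" using yv by (auto simp: g'_def)
      then show ?thesis using y by simp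
    qed
    moreover have "v \<in> {u. g' y u \<noteq> 0} \<longleftrightarrow> m y \<noteq> 0" using cf by (simp add: g'_def)
    ultimately have "{u. g' y u \<noteq> 0} \<in> starring f v K" by (auto simp: iff)
    moreover have "\<forall>u. 0 \<le> g' y u" using y(1) m0 mle by (simp add: g'_def)
    moreover have "sum (g' y) ?W = 1"
    proof -
      have "sum (g' y) (vertices K) = (\<Sum>u\<in>vertices K. y u - (if u \<in> f then m y else 0))"
        using v by (intro sum.cong) (auto simp: g'_def)
      also have "\<dots> = 1 - card f * m y" using y(3) by (simp add: sum_subtractf sum_f)
      finally show ?thesis using v finV by (simp add: g'_def)
    qed
    ultimately show "g' y \<in> realization (starring f v K)" by (simp add: iffL)
  qed
  have "homeomorphism (realization (starring f v K)) (realization K) g g'"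
  proof (rule homeomorphismI)
    show "continuous_on (realization (starring f v K)) g"
      unfolding g_def by (intro continuous_on_coordinatewise_then_product)
        (intro continuous_on_const_if continuous_on_add continuous_on_const continuous_coordinate
          continuous_on_divide, use cf in simp)
    show "continuous_on (realization K) g'"
      unfolding g'_def m_def
      by (intro continuous_on_coordinatewise_then_product continuous_on_const_if continuous_on_diff
          continuous_on_mult continuous_on_const continuous_coordinate continuous_coordinate_Min ff f(2))
    show "g' (g x) = x" if "x \<in> realization (starring f v K)" for x
      using m[OF that] cf by (auto simp: g'_def) (auto simp: g_def)
    show "g (g' y) = y" if "y \<in> realization K" for y
      using yv[OF that] cf vf by (auto simp: g_def) (auto simp: g'_def)
  qed (use gK g'L in auto)
  moreover have "linear_map g"
    by (auto simp: linear_map_def g_def fun_eq_iff add_divide_distrib algebra_simps)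
  ultimately show ?thesis unfolding linearly_homeomorphic_def by blast
qed

section \<open>Isomorphisms and realisations\<close>

lemma complex_iso_sym:
  assumes "complex_iso K L"
  shows "complex_iso L K"
proof -
  obtain \<phi> where \<phi>: "inj_on \<phi> (vertices K)" "L = (\<lambda>f. \<phi> ` f) ` K" using assms by (auto simp: complex_iso_def)
  let ?\<psi> = "inv_into (vertices K) \<phi>"
  have "?\<psi> ` \<phi> ` f = f" if "f \<in> K" for f
    using that \<phi>(1) by (intro inv_into_image_cancel) auto
  then have "(\<lambda>f. ?\<psi> ` f) ` L = K" unfolding \<phi>(2) by (simp add: image_image cong: image_cong)
  moreover have "inj_on ?\<psi> (vertices L)"
    by (rule inj_on_subset[OF inj_on_inv_into]) (auto simp: \<phi>(2))
  ultimately show ?thesis unfolding complex_iso_def by metis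
qed

lemma complex_iso_trans:
  assumes "complex_iso K L" "complex_iso L M"
  shows "complex_iso K M"
proof -
  obtain \<phi> where \<phi>: "inj_on \<phi> (vertices K)" "L = (\<lambda>f. \<phi> ` f) ` K" using assms by (auto simp: complex_iso_def)
  obtain \<psi> where \<psi>: "inj_on \<psi> (vertices L)" "M = (\<lambda>f. \<psi> ` f) ` L" using assms by (auto simp: complex_iso_def)
  have "vertices L = \<phi> ` vertices K" by (auto simp: \<phi>(2))
  then have "inj_on (\<psi> \<circ> \<phi>) (vertices K)" using \<phi>(1) \<psi>(1) by (simp add: comp_inj_on)
  moreover have "M = (\<lambda>f. (\<psi> \<circ> \<phi>) ` f) ` K" by (simp add: \<phi>(2) \<psi>(2) image_image image_comp)
  ultimately show ?thesis unfolding complex_iso_def by blast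
qed

lemma simplicial_complex_iso:
  assumes K: "simplicial_complex K" and "complex_iso K L"
  shows "simplicial_complex L"
proof -
  obtain \<phi> where \<phi>: "L = (\<lambda>f. \<phi> ` f) ` K" using assms by (auto simp: complex_iso_def)
  have "g \<in> L" if fg: "f \<in> L" "g \<subseteq> f" for f g
  proof -
    obtain f' where f': "f' \<in> K" "f = \<phi> ` f'" using fg(1) \<phi> by blast
    then obtain g' where "g' \<subseteq> f'" "g = \<phi> ` g'" using fg(2) subset_imageE by metis
    then show ?thesis using \<phi> simplicial_complex_subset[OF K f'(1)] by blast
  qed
  then show ?thesis using K by (auto simp: simplicial_complex_def \<phi>)
qed

lemma complex_iso_linearly_homeomorphic:
  assumes K: "simplicial_complex K" and iso: "complex_iso K L"
  shows "linearly_homeomorphic K L"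
proof -
  obtain \<phi> where \<phi>: "inj_on \<phi> (vertices K)" "L = (\<lambda>f. \<phi> ` f) ` K" using iso by (auto simp: complex_iso_def)
  define V where "V = vertices K"
  have inj: "inj_on \<phi> V" using \<phi>(1) by (simp add: V_def)
  define g where "g x = (\<lambda>w. if w \<in> \<phi> ` V then x (inv_into V \<phi> w) else 0)" for x :: "'a \<Rightarrow> real"
  define g' where "g' y = (\<lambda>u. if u \<in> V then y (\<phi> u) else 0)" for y :: "'b \<Rightarrow> real"
  have VL: "vertices L = \<phi> ` V" by (auto simp: \<phi>(2) V_def)
  have finV: "finite V" using K by (auto simp: simplicial_complex_def V_def)
  have iffK: "x \<in> realization K \<longleftrightarrow> (\<forall>u. 0 \<le> x u) \<and> {u. x u \<noteq> 0} \<in> K \<and> sum x V = 1" for x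
    using finV by (intro realization_iff[OF K]) (auto simp: V_def)
  have iffL: "y \<in> realization L \<longleftrightarrow> (\<forall>u. 0 \<le> y u) \<and> {u. y u \<noteq> 0} \<in> L \<and> sum y (\<phi> ` V) = 1" for y
    using finV VL by (intro realization_iff[OF simplicial_complex_iso[OF K iso]]) auto
  have g_\<phi>: "g x (\<phi> u) = x u" if "u \<in> V" for x u using that inj by (simp add: g_def)
  have "homeomorphism (realization K) (realization L) g g'"
  proof (rule homeomorphismI)
    show "continuous_on (realization K) g"
      unfolding g_def by (intro continuous_on_coordinatewise_then_product)
        (intro continuous_on_const_if continuous_on_const continuous_coordinate)
    show "continuous_on (realization L) g'"
      unfolding g'_def by (intro continuous_on_coordinatewise_then_product)
        (intro continuous_on_const_if continuous_on_const continuous_coordinate)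
    show "g ` realization K \<subseteq> realization L"
    proof clarify
      fix x assume x: "x \<in> realization K"
      then have sK: "{u. x u \<noteq> 0} \<in> K" by (simp add: iffK)
      then have sV: "{u. x u \<noteq> 0} \<subseteq> V" by (auto simp: V_def)
      have "{w. g x w \<noteq> 0} = \<phi> ` {u. x u \<noteq> 0}"
      proof
        show "{w. g x w \<noteq> 0} \<subseteq> \<phi> ` {u. x u \<noteq> 0}" using inj by (auto simp: g_def)
        show "\<phi> ` {u. x u \<noteq> 0} \<subseteq> {w. g x w \<noteq> 0}" using g_\<phi> sV by auto
      qed
      then have "{w. g x w \<noteq> 0} \<in> L" using sK \<phi>(2) by blast
      moreover have "sum (g x) (\<phi> ` V) = sum x V"
        using inj g_\<phi> by (simp add: sum.reindex)
      ultimately show "g x \<in> realization L" using x by (auto simp: iffK iffL g_def)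
    qed
    show "g' ` realization L \<subseteq> realization K"
    proof clarify
      fix y assume y: "y \<in> realization L"
      then have "{u. y u \<noteq> 0} \<in> L" by (simp add: iffL)
      then obtain f where f: "f \<in> K" "{u. y u \<noteq> 0} = \<phi> ` f" using \<phi>(2) by blast
      have "f \<subseteq> V" using f(1) by (auto simp: V_def)
      have "{u. g' y u \<noteq> 0} = f"
      proof -
        have "y (\<phi> u) \<noteq> 0 \<longleftrightarrow> u \<in> f" if "u \<in> V" for u
          using f(2) inj_on_image_mem_iff[OF inj that \<open>f \<subseteq> V\<close>] by blast
        then show ?thesis using \<open>f \<subseteq> V\<close> by (auto simp: g'_def)
      qed
      moreover have "sum (g' y) V = sum y (\<phi> ` V)" using inj by (simp add: sum.reindex g'_def)
      ultimately show "g' y \<in> realization K" using y f(1) by (auto simp: iffK iffL g'_def)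
    qed
    show "g' (g x) = x" if x: "x \<in> realization K" for x
    proof
      fix u
      have "{u. x u \<noteq> 0} \<subseteq> V" using x by (auto simp: iffK V_def)
      then show "g' (g x) u = x u" using g_\<phi> by (auto simp: g'_def)
    qed
    show "g (g' y) = y" if y: "y \<in> realization L" for y
    proof
      fix w
      have "{w. y w \<noteq> 0} \<subseteq> \<phi> ` V" using y VL by (auto simp: iffL)
      then show "g (g' y) w = y w" using inj by (auto simp: g_def g'_def)
    qed
  qed
  moreover have "linear_map g" by (auto simp: linear_map_def g_def)
  ultimately show ?thesis unfolding linearly_homeomorphic_def by blast
qed

section \<open>Spheres and the hyper-octahedron\<close>

definition linear_sphere :: "nat \<Rightarrow> 'v set set \<Rightarrow> bool" where
  "linear_sphere d K \<longleftrightarrow> simplicial_complex K \<and> linearly_homeomorphic K (boundary_complex {..<d + 2})"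

lemma combinatorial_sphere_if_linear: "linear_sphere d K \<Longrightarrow> combinatorial_sphere d K"
  by (simp add: linear_sphere_def combinatorial_sphere_def pl_homeomorphic_if_linearly)

lemma linear_sphere_starring:
  assumes "linear_sphere d K" and v: "v \<notin> vertices K" and f: "f \<in> K" "f \<noteq> {}"
  shows "linear_sphere d (starring f v K)"
proof -
  have K: "simplicial_complex K" "linearly_homeomorphic K (boundary_complex {..<d + 2})"
    using assms by (simp_all only: linear_sphere_def)
  show ?thesis unfolding linear_sphere_def
    using simplicial_complex_starring(1)[OF K(1) v f]
      linearly_homeomorphic_trans[OF starring_linearly_homeomorphic[OF K(1) v f] K(2)] by (rule conjI)
qed

lemma linear_sphere_iso:
  assumes "linear_sphere d K" and iso: "complex_iso K L"
  shows "linear_sphere d L"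
proof -
  have K: "simplicial_complex K" "linearly_homeomorphic K (boundary_complex {..<d + 2})"
    using assms by (simp_all only: linear_sphere_def)
  have L: "simplicial_complex L" using K(1) iso by (rule simplicial_complex_iso)
  show ?thesis unfolding linear_sphere_def
    using L linearly_homeomorphic_trans[OF complex_iso_linearly_homeomorphic[OF L complex_iso_sym[OF iso]] K(2)]
    by (rule conjI)
qed

lemma linear_sphere_boundary: "linear_sphere d (boundary_complex {..<d + 2})"
proof -
  have "homeomorphism S S id id" for S :: "(nat \<Rightarrow> real) set" by (simp add: homeomorphism_def)
  moreover have "linear_map id" by (simp add: linear_map_def)
  moreover have "simplicial_complex (boundary_complex {..<d + 2})"
    by (auto simp: simplicial_complex_def boundary_complex_def intro: finite_subset)
  ultimately show ?thesis unfolding linear_sphere_def linearly_homeomorphic_def by blast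
qed

text \<open>Starring the faces \<open>{0..<k}\<close> for \<open>k = m, \<dots>, 2\<close> turns the boundary of the simplex on
  \<open>{0..m}\<close> into the hyper-octahedron; \<open>(j, True)\<close> are the old vertices and \<open>(k, False)\<close> is the
  vertex starred at \<open>{0..<k}\<close>.\<close>

definition octahedral_stage :: "nat \<Rightarrow> nat \<Rightarrow> (nat \<times> bool) set set" where
  "octahedral_stage m k = {H. H \<subseteq> {0..m} \<times> {True} \<union> {k..m} \<times> {False} \<and> \<not> {..<k} \<times> {True} \<subseteq> H \<and>
     (\<forall>t\<in>{k..m}. \<not> ((t, True) \<in> H \<and> (t, False) \<in> H))}"

lemma octahedral_stage_starring:
  assumes "0 < k" "k \<le> m" and S: "simplicial_complex (octahedral_stage m (Suc k))"
  shows "starring ({..<k} \<times> {True}) (k, False) (octahedral_stage m (Suc k)) = octahedral_stage m k"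
    "(k, False) \<notin> vertices (octahedral_stage m (Suc k))"
    "{..<k} \<times> {True} \<in> octahedral_stage m (Suc k)"
proof -
  show v: "(k, False) \<notin> vertices (octahedral_stage m (Suc k))" by (auto simp: octahedral_stage_def)
  show f: "{..<k} \<times> {True} \<in> octahedral_stage m (Suc k)" using assms by (auto simp: octahedral_stage_def)
  have Suc: "{..<Suc k} \<times> {True} = insert (k, True) ({..<k} \<times> {True})" by auto
  have all: "(\<forall>t\<in>{k..m}. P t) \<longleftrightarrow> P k \<and> (\<forall>t\<in>{Suc k..m}. P t)" for P
    using \<open>k \<le> m\<close> by (auto simp: Suc_le_eq le_less)
  have sub: "{0..m} \<times> {True} \<union> {k..m} \<times> {False} = insert (k, False) ({0..m} \<times> {True} \<union> {Suc k..m} \<times> {False})"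
    using \<open>k \<le> m\<close> by auto
  show "starring ({..<k} \<times> {True}) (k, False) (octahedral_stage m (Suc k)) = octahedral_stage m k"
  proof (rule Set.set_eqI)
    fix H
    show "H \<in> starring ({..<k} \<times> {True}) (k, False) (octahedral_stage m (Suc k)) \<longleftrightarrow> H \<in> octahedral_stage m k"
    proof (cases "(k, False) \<in> H")
      case True
      have "(H - {(k, False)}) \<union> {..<k} \<times> {True} \<in> octahedral_stage m (Suc k) \<longleftrightarrow>
          H \<subseteq> insert (k, False) ({0..m} \<times> {True} \<union> {Suc k..m} \<times> {False}) \<and> (k, True) \<notin> H \<and>
          (\<forall>t\<in>{Suc k..m}. \<not> ((t, True) \<in> H \<and> (t, False) \<in> H))"
        unfolding octahedral_stage_def Suc using \<open>k \<le> m\<close> by auto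
      then show ?thesis
        using True unfolding starring_iff[OF S v f] unfolding octahedral_stage_def[of m k] all sub by auto
    next
      case False
      then show ?thesis
        unfolding starring_iff[OF S v f] unfolding octahedral_stage_def all sub Suc by auto
    qed
  qed
qed

text \<open>Downward induction on \<open>k\<close>, from the boundary of the simplex on
  \<open>m + 1\<close> vertices at \<open>k = Suc m\<close>; each step is one starring.\<close>

lemma linear_sphere_octahedral_stage:
  assumes "1 \<le> m" "1 \<le> k" "k \<le> Suc m"
  shows "linear_sphere (m - 1) (octahedral_stage m k)"
  using assms(3,2)
proof (induction k rule: inc_induct)
  case base
  have "complex_iso (boundary_complex {..<m - 1 + 2}) (octahedral_stage m (Suc m))"
    unfolding complex_iso_def
  proof (intro exI conjI)
    show "inj_on (\<lambda>j. (j, True)) (vertices (boundary_complex {..<m - 1 + 2}))" by (simp add: inj_on_def)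
    have eq: "{..<m - 1 + 2} = {..<Suc m}" using assms by auto
    have prod: "(\<lambda>j. (j, True)) ` A = A \<times> {True}" for A :: "nat set" by auto
    have "H \<in> octahedral_stage m (Suc m) \<longleftrightarrow> (\<exists>A. A \<subseteq> {..<Suc m} \<and> A \<noteq> {..<Suc m} \<and> H = A \<times> {True})" for H
    proof
      assume H: "H \<in> octahedral_stage m (Suc m)"
      then have "H = fst ` H \<times> {True}" by (force simp: octahedral_stage_def)
      moreover have "fst ` H \<subseteq> {..<Suc m}" using H by (auto simp: octahedral_stage_def)
      moreover have "fst ` H \<noteq> {..<Suc m}" using H calculation(1) by (auto simp: octahedral_stage_def)
      ultimately show "\<exists>A. A \<subseteq> {..<Suc m} \<and> A \<noteq> {..<Suc m} \<and> H = A \<times> {True}" by blast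
    next
      assume "\<exists>A. A \<subseteq> {..<Suc m} \<and> A \<noteq> {..<Suc m} \<and> H = A \<times> {True}"
      then obtain A where A: "A \<subseteq> {..<Suc m}" "A \<noteq> {..<Suc m}" "H = A \<times> {True}" by blast
      then obtain a where "a < Suc m" "a \<notin> A" by blast
      then have "\<not> {..<Suc m} \<times> {True} \<subseteq> H" using A(3) by blast
      moreover have "H \<subseteq> {0..m} \<times> {True}"
        unfolding A(3) using A(1) by (intro Sigma_mono) (auto simp: less_Suc_eq_le)
      ultimately show "H \<in> octahedral_stage m (Suc m)" by (auto simp: octahedral_stage_def)
    qed
    then show "octahedral_stage m (Suc m) = (\<lambda>f. (\<lambda>j. (j, True)) ` f) ` boundary_complex {..<m - 1 + 2}"
      unfolding eq by (intro Set.set_eqI) (simp only: boundary_complex_def prod image_iff Bex_def Diff_iff Pow_iff singleton_iff conj_assoc)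
  qed
  then show ?case by (rule linear_sphere_iso[OF linear_sphere_boundary])
next
  case (step k)
  have IH: "linear_sphere (m - 1) (octahedral_stage m (Suc k))" using step.IH by simp
  then have S: "simplicial_complex (octahedral_stage m (Suc k))" by (simp add: linear_sphere_def)
  have k: "0 < k" "k \<le> m" using step.prems step.hyps by simp_all
  note st = octahedral_stage_starring[OF k S]
  have "linear_sphere (m - 1) (starring ({..<k} \<times> {True}) (k, False) (octahedral_stage m (Suc k)))"
    by (rule linear_sphere_starring[OF IH st(2,3)]) (use k in auto)
  then show ?case by (simp only: st(1))
qed

lemma join_family_iff:
  "X \<in> join_family I K \<longleftrightarrow> fst ` X \<subseteq> I \<and> (\<forall>i\<in>I. {x. (i, x) \<in> X} \<in> K i)"
proof
  assume "X \<in> join_family I K"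
  then obtain F where F: "X = (\<Union>i\<in>I. Pair i ` F i)" "\<forall>i\<in>I. F i \<in> K i" by (auto simp: join_family_def)
  then have "{x. (i, x) \<in> X} = F i" if "i \<in> I" for i using that by auto
  then show "fst ` X \<subseteq> I \<and> (\<forall>i\<in>I. {x. (i, x) \<in> X} \<in> K i)" using F by auto
next
  assume X: "fst ` X \<subseteq> I \<and> (\<forall>i\<in>I. {x. (i, x) \<in> X} \<in> K i)"
  then have "X = (\<Union>i\<in>I. Pair i ` {x. (i, x) \<in> X})" by force
  then show "X \<in> join_family I K"
    using X unfolding join_family_def mem_Collect_eq by (intro exI[of _ "\<lambda>i. {x. (i, x) \<in> X}"]) simp
qed

lemma hyperoctahedron_boundary_iff:
  "X \<in> hyperoctahedron_boundary m \<longleftrightarrow>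
    fst ` X \<subseteq> {1..m} \<and> (\<forall>i\<in>{1..m}. \<not> ((i, True) \<in> X \<and> (i, False) \<in> X))"
proof -
  have "B \<in> zero_sphere \<longleftrightarrow> \<not> (True \<in> B \<and> False \<in> B)" for B
  proof
    assume "\<not> (True \<in> B \<and> False \<in> B)"
    then have "B = {} \<or> B = {False} \<or> B = {True}" by (metis (full_types) UNIV_bool insert_iff singleton_iff subsetI subset_singletonD)
    then show "B \<in> zero_sphere" by (auto simp: zero_sphere_def)
  qed (auto simp: zero_sphere_def)
  then show ?thesis by (simp add: hyperoctahedron_boundary_def join_family_iff)
qed

lemma linear_sphere_hyperoctahedron:
  assumes "1 \<le> m"
  shows "linear_sphere (m - 1) (hyperoctahedron_boundary m)"
proof (cases "m = 0")
  case False
  \<comment> \<open>At stage 2 the vertices \<open>(0, True)\<close> and \<open>(1, True)\<close>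
    span no face and \<open>(1, False)\<close> does not occur, so \<open>(0, True)\<close> is
    renamed to be the vertex opposite to \<open>(1, True)\<close>.\<close>
  define \<phi> :: "nat \<times> bool \<Rightarrow> nat \<times> bool" where "\<phi> x = (if x = (0, True) then (1, False) else x)" for x
  have "complex_iso (octahedral_stage m 2) (hyperoctahedron_boundary m)"
    unfolding complex_iso_def
  proof (intro exI conjI)
    show "inj_on \<phi> (vertices (octahedral_stage m 2))"
      by (auto simp: inj_on_def \<phi>_def octahedral_stage_def)
    show "hyperoctahedron_boundary m = (\<lambda>f. \<phi> ` f) ` octahedral_stage m 2"
    proof (rule Set.set_eqI)
      fix X
      have img: "x \<in> \<phi> ` f \<longleftrightarrow> x = (1, False) \<and> (0, True) \<in> f \<or> x \<noteq> (0, True) \<and> x \<in> f" for x f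
        by (auto simp: \<phi>_def image_iff)
      have two: "{..<2} \<times> {True} \<subseteq> H \<longleftrightarrow> (0, True) \<in> H \<and> (1, True) \<in> H" for H :: "(nat \<times> bool) set"
        by (auto simp: less_2_cases_iff)
      show "X \<in> hyperoctahedron_boundary m \<longleftrightarrow> X \<in> (\<lambda>f. \<phi> ` f) ` octahedral_stage m 2"
      proof
        assume X: "X \<in> hyperoctahedron_boundary m"
        define f where "f = (X - {(1, False)}) \<union> (if (1, False) \<in> X then {(0, True)} else {})"
        have range: "1 \<le> i" "i \<le> m" if "(i, b) \<in> X" for i b
          using X that unfolding hyperoctahedron_boundary_iff by force+
        then have r0: "(0, b) \<notin> X" for b by fastforce
        have opp: "\<not> ((i, True) \<in> X \<and> (i, False) \<in> X)" for i
          using X range unfolding hyperoctahedron_boundary_iff by (metis atLeastAtMost_iff)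
        have fT: "(i, True) \<in> f \<longleftrightarrow> (i, True) \<in> X \<or> i = 0 \<and> (1, False) \<in> X" for i by (auto simp: f_def)
        have fF: "(i, False) \<in> f \<longleftrightarrow> (i, False) \<in> X \<and> i \<noteq> 1" for i by (auto simp: f_def)
        have "(i, b) \<in> {0..m} \<times> {True} \<union> {2..m} \<times> {False}" if "(i, b) \<in> f" for i b
          using that range[of i b] fT fF by (cases b) (auto simp: numeral_2_eq_2 Suc_le_eq le_less)
        then have "f \<subseteq> {0..m} \<times> {True} \<union> {2..m} \<times> {False}" by (meson subrelI)
        moreover have "\<not> ((0, True) \<in> f \<and> (1, True) \<in> f)"
          using range[of 0 True] opp[of 1] unfolding fT by auto
        moreover have "\<not> ((t, True) \<in> f \<and> (t, False) \<in> f)" if "t \<in> {2..m}" for t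
          using that opp[of t] unfolding fT fF by auto
        ultimately have "f \<in> octahedral_stage m 2" by (simp add: octahedral_stage_def two)
        moreover have "X = \<phi> ` f"
        proof (rule Set.set_eqI)
          fix x :: "nat \<times> bool"
          obtain i b where x: "x = (i, b)" by (cases x)
          show "x \<in> X \<longleftrightarrow> x \<in> \<phi> ` f"
            unfolding img x using r0 fT fF by (cases b; cases i) auto
        qed
        ultimately show "X \<in> (\<lambda>f. \<phi> ` f) ` octahedral_stage m 2" by blast
      next
        assume "X \<in> (\<lambda>f. \<phi> ` f) ` octahedral_stage m 2"
        then obtain f where f: "X = \<phi> ` f" "f \<in> octahedral_stage m 2" by blast
        show "X \<in> hyperoctahedron_boundary m"
          unfolding hyperoctahedron_boundary_iff
        proof (intro conjI ballI)
          show "fst ` X \<subseteq> {1..m}"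
            using f(2) assms unfolding f(1) octahedral_stage_def by (auto simp: \<phi>_def split: if_splits)
          fix i assume i: "i \<in> {1..m}"
          show "\<not> ((i, True) \<in> X \<and> (i, False) \<in> X)"
          proof (cases "i = 1")
            case True
            have "(1, False) \<notin> f" using f(2) by (auto simp: octahedral_stage_def)
            then show ?thesis using f(2) True unfolding f(1) img octahedral_stage_def two by auto
          next
            case False
            then have "i \<in> {2..m}" using i by auto
            then show ?thesis using f(2) False unfolding f(1) img octahedral_stage_def by auto
          qed
        qed
      qed
    qed
  qed
  moreover have "linear_sphere (m - 1) (octahedral_stage m 2)"
    using assms by (intro linear_sphere_octahedral_stage) simp_all
  ultimately show ?thesis using linear_sphere_iso by metis
qed (use assms in simp)

section \<open>Clique complexes and edge starrings\<close>

lemma vertices_clique_complex: "vertices (clique_complex V R) = V"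
proof
  show "V \<subseteq> vertices (clique_complex V R)"
  proof
    fix x assume "x \<in> V"
    then have "{x} \<in> clique_complex V R" by (simp add: clique_complex_def)
    then show "x \<in> vertices (clique_complex V R)" by blast
  qed
qed (auto simp: clique_complex_def)

lemma simplicial_clique_complex:
  assumes V: "finite V"
  shows "simplicial_complex (clique_complex V R)"
  unfolding simplicial_complex_def
proof (intro conjI ballI allI impI)
  have "clique_complex V R \<subseteq> Pow V" by (auto simp: clique_complex_def)
  then show "finite (clique_complex V R)" using V finite_subset by blast
  show "finite f" if "f \<in> clique_complex V R" for f
    using that V finite_subset by (auto simp: clique_complex_def)
  show "g \<in> clique_complex V R" if "f \<in> clique_complex V R" "g \<subseteq> f" for f g
    using that by (rule clique_complex_mono)
qed (simp add: clique_complex_def)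

lemma clique_complex_image:
  assumes inj: "inj_on \<phi> V" and R: "\<And>x y. x \<in> V \<Longrightarrow> y \<in> V \<Longrightarrow> x \<noteq> y \<Longrightarrow> R' (\<phi> x) (\<phi> y) \<longleftrightarrow> R x y"
  shows "clique_complex (\<phi> ` V) R' = (\<lambda>f. \<phi> ` f) ` clique_complex V R"
proof
  have clique: "\<phi> ` f \<in> clique_complex (\<phi> ` V) R' \<longleftrightarrow> f \<in> clique_complex V R" if "f \<subseteq> V" for f
  proof -
    have "\<phi> x \<noteq> \<phi> y \<longleftrightarrow> x \<noteq> y" if "x \<in> f" "y \<in> f" for x y
      using inj that \<open>f \<subseteq> V\<close> by (simp add: inj_on_eq_iff subset_iff)
    then show ?thesis using that R by (auto simp: clique_complex_def subset_iff)
  qed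
  show "clique_complex (\<phi> ` V) R' \<subseteq> (\<lambda>f. \<phi> ` f) ` clique_complex V R"
  proof
    fix g assume g: "g \<in> clique_complex (\<phi> ` V) R'"
    then have "g \<subseteq> \<phi> ` V" by (simp add: clique_complex_def)
    then obtain f where f: "f \<subseteq> V" "g = \<phi> ` f" by (auto simp: subset_image_iff)
    then show "g \<in> (\<lambda>f. \<phi> ` f) ` clique_complex V R" using g clique by blast
  qed
  show "(\<lambda>f. \<phi> ` f) ` clique_complex V R \<subseteq> clique_complex (\<phi> ` V) R'"
  proof (rule image_subsetI)
    fix f assume "f \<in> clique_complex V R"
    then show "\<phi> ` f \<in> clique_complex (\<phi> ` V) R'" using clique[of f] by (simp add: clique_complex_def)
  qed
qed

lemma clique_complex_iso:
  assumes "inj_on \<phi> V" "\<And>x y. x \<in> V \<Longrightarrow> y \<in> V \<Longrightarrow> x \<noteq> y \<Longrightarrow> R' (\<phi> x) (\<phi> y) \<longleftrightarrow> R x y"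
    and "\<phi> ` V = V'"
  shows "complex_iso (clique_complex V R) (clique_complex V' R')"
  unfolding complex_iso_def vertices_clique_complex
  using assms(1) clique_complex_image[where V = V and \<phi> = \<phi> and R = R and R' = R', OF assms(1,2)] assms(3)
  by (intro exI[of _ \<phi>]) simp

text \<open>Edge starrings preserve flagness: the edge \<open>{p, q}\<close> is deleted, and the new
  vertex is joined to its two ends and to their common neighbours.\<close>

lemma starring_clique_complex:
  assumes V: "finite V" and pq: "p \<in> V" "q \<in> V" "p \<noteq> q" "R p q" and v: "v \<notin> V"
    and sym: "\<And>x y. R x y \<Longrightarrow> R y x" "\<And>x y. R' x y \<Longrightarrow> R' y x"
    and old: "\<And>x y. x \<in> V \<Longrightarrow> y \<in> V \<Longrightarrow> x \<noteq> y \<Longrightarrow> R' x y \<longleftrightarrow> R x y \<and> {x, y} \<noteq> {p, q}"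
    and new: "\<And>x. x \<in> V \<Longrightarrow> R' v x \<longleftrightarrow> x = p \<or> x = q \<or> R x p \<and> R x q"
  shows "starring {p, q} v (clique_complex V R) = clique_complex (insert v V) R'"
    and "{p, q} \<in> clique_complex V R"
proof -
  show e: "{p, q} \<in> clique_complex V R" using pq sym by (auto simp: clique_complex_def)
  have vK: "v \<notin> vertices (clique_complex V R)" using v by (simp add: vertices_clique_complex)
  show "starring {p, q} v (clique_complex V R) = clique_complex (insert v V) R'"
  proof (rule Set.set_eqI)
    fix H
    have old_clique: "G \<in> clique_complex V R' \<longleftrightarrow> G \<in> clique_complex V R \<and> \<not> {p, q} \<subseteq> G" for G
    proof
      assume G: "G \<in> clique_complex V R'"
      have "\<not> R' p q" using old[OF pq(1,2,3)] by simp
      then have "\<not> {p, q} \<subseteq> G" using G pq(3) by (auto simp: clique_complex_def)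
      moreover have "R x y" if "x \<in> G" "y \<in> G" "x \<noteq> y" for x y
        using that G old[of x y] by (auto simp: clique_complex_def)
      ultimately show "G \<in> clique_complex V R \<and> \<not> {p, q} \<subseteq> G" using G by (simp add: clique_complex_def)
    next
      assume G: "G \<in> clique_complex V R \<and> \<not> {p, q} \<subseteq> G"
      have "R' x y" if "x \<in> G" "y \<in> G" "x \<noteq> y" for x y
      proof -
        have "x \<in> V" "y \<in> V" "R x y" using G that by (auto simp: clique_complex_def)
        moreover have "{x, y} \<subseteq> G" using that by simp
        then have "{x, y} \<noteq> {p, q}" using G by metis
        ultimately show ?thesis using old that(3) by simp
      qed
      then show "G \<in> clique_complex V R'" using G by (simp add: clique_complex_def)
    qed
    show "H \<in> starring {p, q} v (clique_complex V R) \<longleftrightarrow> H \<in> clique_complex (insert v V) R'"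
    proof (cases "v \<in> H")
      case False
      have "H \<in> clique_complex (insert v V) R' \<longleftrightarrow> H \<in> clique_complex V R'"
        using False by (auto simp: clique_complex_def)
      then show ?thesis
        using False unfolding starring_iff[OF simplicial_clique_complex[OF V] vK e] old_clique by auto
    next
      case True
      define G where "G = H - {v}"
      have H: "H = insert v G" "v \<notin> G" using True by (auto simp: G_def)
      have "H \<in> clique_complex (insert v V) R' \<longleftrightarrow> G \<in> clique_complex V R' \<and> (\<forall>x\<in>G. R' v x)"
      proof
        assume A: "H \<in> clique_complex (insert v V) R'"
        then show "G \<in> clique_complex V R' \<and> (\<forall>x\<in>G. R' v x)"
          using H by (auto simp: clique_complex_def)
      next
        assume A: "G \<in> clique_complex V R' \<and> (\<forall>x\<in>G. R' v x)"
        then show "H \<in> clique_complex (insert v V) R'"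
          unfolding H(1) clique_complex_def using sym(2) by auto
      qed
      also have "\<dots> \<longleftrightarrow> \<not> {p, q} \<subseteq> H \<and> G \<union> {p, q} \<in> clique_complex V R"
      proof
        assume A: "G \<in> clique_complex V R' \<and> (\<forall>x\<in>G. R' v x)"
        then have G: "G \<in> clique_complex V R" "\<not> {p, q} \<subseteq> G" by (simp_all add: old_clique)
        have pqv: "p \<noteq> v" "q \<noteq> v" using pq v by auto
        have "R x p" "R x q" if "x \<in> G" "x \<noteq> p" "x \<noteq> q" for x
          using A that new[of x] G by (auto simp: clique_complex_def)
        then have "R x y" if "x \<in> G \<union> {p, q}" "y \<in> G \<union> {p, q}" "x \<noteq> y" for x y
          using that G(1) pq(4) sym(1) unfolding clique_complex_def by blast
        then have "G \<union> {p, q} \<in> clique_complex V R" using G(1) pq by (simp add: clique_complex_def)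
        then show "\<not> {p, q} \<subseteq> H \<and> G \<union> {p, q} \<in> clique_complex V R" using G(2) H pqv by auto
      next
        assume A: "\<not> {p, q} \<subseteq> H \<and> G \<union> {p, q} \<in> clique_complex V R"
        then have "G \<in> clique_complex V R" using clique_complex_mono[of "G \<union> {p, q}" V R G] by blast
        moreover have "\<not> {p, q} \<subseteq> G" using A H by blast
        moreover have "R' v x" if x: "x \<in> G" for x
        proof -
          have "x \<in> V" "x = p \<or> R x p" "x = q \<or> R x q" using A x by (auto simp: clique_complex_def)
          then show ?thesis using new[of x] by blast
        qed
        ultimately show "G \<in> clique_complex V R' \<and> (\<forall>x\<in>G. R' v x)" by (simp add: old_clique)
      qed
      finally show ?thesis
        using True unfolding starring_iff[OF simplicial_clique_complex[OF V] vK e] by (simp add: G_def)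
    qed
  qed
qed

lemma starring_image:
  assumes K: "simplicial_complex K" and v: "v \<notin> vertices K" and f: "f \<in> K"
    and inj: "inj_on \<phi> (insert v (vertices K))"
  shows "starring (\<phi> ` f) (\<phi> v) ((\<lambda>f. \<phi> ` f) ` K) = (\<lambda>f. \<phi> ` f) ` starring f v K"
    and "\<phi> v \<notin> vertices ((\<lambda>f. \<phi> ` f) ` K)"
proof -
  let ?W = "insert v (vertices K)"
  have injK: "inj_on \<phi> (vertices K)" using inj by (rule inj_on_subset) blast
  have iso: "complex_iso K ((\<lambda>f. \<phi> ` f) ` K)" using injK unfolding complex_iso_def by blast
  have VL: "vertices ((\<lambda>f. \<phi> ` f) ` K) = \<phi> ` vertices K" by blast
  show v': "\<phi> v \<notin> vertices ((\<lambda>f. \<phi> ` f) ` K)"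
    unfolding VL using inj v by auto
  have f': "\<phi> ` f \<in> (\<lambda>f. \<phi> ` f) ` K" using f by blast
  note iff' = starring_iff[OF simplicial_complex_iso[OF K iso] v' f']
  note iff = starring_iff[OF K v f]
  have fW: "f \<subseteq> ?W" using f by blast
  have mem: "\<phi> ` X \<in> (\<lambda>f. \<phi> ` f) ` K \<longleftrightarrow> X \<in> K" if "X \<subseteq> ?W" for X
  proof
    assume "\<phi> ` X \<in> (\<lambda>f. \<phi> ` f) ` K"
    then obtain Y where Y: "Y \<in> K" "\<phi> ` X = \<phi> ` Y" by blast
    then have "Y \<subseteq> ?W" by blast
    then have "X = Y" using inj_on_image_eq_iff[OF inj that] Y(2) by blast
    then show "X \<in> K" using Y by simp
  qed blast
  have key: "\<phi> ` H \<in> starring (\<phi> ` f) (\<phi> v) ((\<lambda>f. \<phi> ` f) ` K) \<longleftrightarrow> H \<in> starring f v K" if H: "H \<subseteq> ?W" for H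
  proof -
    have "x \<in> H" if "\<phi> ` f \<subseteq> \<phi> ` H" "x \<in> f" for x
      using inj_on_image_mem_iff[OF inj _ H, of x] that fW by blast
    then have "\<phi> ` f \<subseteq> \<phi> ` H \<longleftrightarrow> f \<subseteq> H" by blast
    moreover have "\<phi> v \<in> \<phi> ` H \<longleftrightarrow> v \<in> H" using inj_on_image_mem_iff[OF inj _ H] by simp
    moreover have "(\<phi> ` H - {\<phi> v}) \<union> \<phi> ` f = \<phi> ` ((H - {v}) \<union> f)"
    proof -
      have "\<phi> ` (H - {v}) = \<phi> ` H - \<phi> ` {v}"
        using H by (intro inj_on_image_set_diff[OF inj]) auto
      then show ?thesis by (simp add: image_Un)
    qed
    moreover have "(H - {v}) \<union> f \<subseteq> ?W" using H fW by blast
    ultimately show ?thesis unfolding iff iff' using mem[OF H] mem[of "(H - {v}) \<union> f"] by simp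
  qed
  show "starring (\<phi> ` f) (\<phi> v) ((\<lambda>f. \<phi> ` f) ` K) = (\<lambda>f. \<phi> ` f) ` starring f v K"
  proof
    show "starring (\<phi> ` f) (\<phi> v) ((\<lambda>f. \<phi> ` f) ` K) \<subseteq> (\<lambda>f. \<phi> ` f) ` starring f v K"
    proof
      fix H' assume H': "H' \<in> starring (\<phi> ` f) (\<phi> v) ((\<lambda>f. \<phi> ` f) ` K)"
      have "H' \<subseteq> \<phi> ` ?W"
      proof (cases "\<phi> v \<in> H'")
        case True
        then have "(H' - {\<phi> v}) \<union> \<phi> ` f \<in> (\<lambda>f. \<phi> ` f) ` K" using H' iff'[of H'] by simp
        then show ?thesis by blast
      next
        case False
        then have "H' \<in> (\<lambda>f. \<phi> ` f) ` K" using H' iff'[of H'] by simp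
        then show ?thesis by blast
      qed
      then obtain H where H: "H \<subseteq> ?W" "H' = \<phi> ` H" by (rule subset_imageE)
      then show "H' \<in> (\<lambda>f. \<phi> ` f) ` starring f v K" using key[OF H(1)] H' by blast
    qed
    show "(\<lambda>f. \<phi> ` f) ` starring f v K \<subseteq> starring (\<phi> ` f) (\<phi> v) ((\<lambda>f. \<phi> ` f) ` K)"
    proof (rule image_subsetI)
      fix H assume H: "H \<in> starring f v K"
      have "H \<subseteq> ?W"
      proof (cases "v \<in> H")
        case True
        then have "(H - {v}) \<union> f \<in> K" using H iff[of H] by simp
        then show ?thesis by blast
      next
        case False
        then have "H \<in> K" using H iff[of H] by simp
        then show ?thesis by blast
      qed
      then show "\<phi> ` H \<in> starring (\<phi> ` f) (\<phi> v) ((\<lambda>f. \<phi> ` f) ` K)" using key H by blast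
    qed
  qed
qed

lemma unobstructed_image:
  assumes inj: "inj_on \<phi> V" and R: "\<And>x y. x \<in> V \<Longrightarrow> y \<in> V \<Longrightarrow> R' (\<phi> x) (\<phi> y) \<longleftrightarrow> R x y"
    and un: "unobstructed V R"
  shows "unobstructed (\<phi> ` V) R'"
  unfolding unobstructed_def
proof (rule ballI)
  fix a' assume a': "a' \<in> clique_complex (\<phi> ` V) R'"
  obtain a where a: "a \<in> clique_complex V R" "a' = \<phi> ` a"
    using a' clique_complex_image[OF inj, of R' R] R by blast
  define L where "L = common_neighbours V R a"
  have aV: "a \<subseteq> V" using a(1) by (simp add: clique_complex_def)
  have LV: "L \<subseteq> V" by (auto simp: L_def common_neighbours_def)
  have L': "common_neighbours (\<phi> ` V) R' a' = \<phi> ` L"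
  proof -
    have "\<phi> x \<notin> \<phi> ` a \<longleftrightarrow> x \<notin> a" if "x \<in> V" for x using inj_on_image_mem_iff[OF inj that aV] by simp
    then show ?thesis using R aV unfolding common_neighbours_def L_def a(2) by (auto simp: subset_iff)
  qed
  have N: "non_neighbours (\<phi> ` L) R' (\<phi> v) = \<phi> ` non_neighbours L R v" if "v \<in> L" for v
    using that LV R inj_on_eq_iff[OF inj] by (auto simp: non_neighbours_def subset_iff)
  have NV: "non_neighbours L R v \<subseteq> V" for v using LV by (auto simp: non_neighbours_def)
  have un': "coned_at L R v" "w \<in> L \<Longrightarrow> v \<noteq> w \<Longrightarrow> \<not> R v w \<Longrightarrow> connected_at L R v w" if "v \<in> L" for v w
    using un a(1) that by (auto simp: unobstructed_def L_def)
  have "coned_at (\<phi> ` L) R' (\<phi> v)" if v: "v \<in> L" for v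
    unfolding coned_at_iff N[OF v]
    using coned_image[of \<phi> "non_neighbours L R v" R' R] inj_on_subset[OF inj NV] R NV un'(1)[OF v]
    by (metis coned_at_iff subsetD)
  moreover have "connected_at (\<phi> ` L) R' (\<phi> v) (\<phi> w)"
    if v: "v \<in> L" and w: "w \<in> L" and vw: "\<phi> v \<noteq> \<phi> w" "\<not> R' (\<phi> v) (\<phi> w)" for v w
  proof -
    let ?A = "non_neighbours L R v - {w}" and ?B = "non_neighbours L R w - {v}"
    have d: "\<phi> ` X - {\<phi> x} = \<phi> ` (X - {x})" if "X \<subseteq> V" "x \<in> V" for X x
    proof -
      have "\<phi> ` (X - {x}) = \<phi> ` X - \<phi> ` {x}" by (rule inj_on_image_set_diff[OF inj]) (use that in auto)
      then show ?thesis by simp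
    qed
    have "w \<in> V" "v \<in> V" using v w LV by auto
    then have eq: "(non_neighbours (\<phi> ` L) R' (\<phi> v) - {\<phi> w}) \<union> (non_neighbours (\<phi> ` L) R' (\<phi> w) - {\<phi> v}) = \<phi> ` (?A \<union> ?B)"
      unfolding N[OF v] N[OF w] by (simp add: d NV image_Un)
    have "\<not> R v w" using vw R \<open>v \<in> V\<close> \<open>w \<in> V\<close> by simp
    then have conn: "graph_connected (?A \<union> ?B) R"
      using un'(2)[OF v w] vw(1) by (auto simp: connected_at_iff)
    have Y: "?A \<union> ?B \<subseteq> V" using NV by blast
    show ?thesis
      unfolding connected_at_iff eq
      unfolding graph_connected_def
    proof (intro allI impI)
      fix P assume step: "\<forall>x\<in>\<phi> ` (?A \<union> ?B). \<forall>y\<in>\<phi> ` (?A \<union> ?B). P x \<longrightarrow> R' x y \<longrightarrow> P y"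
        and ex: "\<exists>x\<in>\<phi> ` (?A \<union> ?B). P x"
      obtain x where x: "x \<in> ?A \<union> ?B" "P (\<phi> x)" using ex by blast
      have "P (\<phi> y)" if "y \<in> ?A \<union> ?B" for y
      proof (rule graph_connected_propagate[where P = "\<lambda>z. P (\<phi> z)", OF conn x that])
        fix s t assume st: "s \<in> ?A \<union> ?B" "t \<in> ?A \<union> ?B" "P (\<phi> s)" "R s t"
        then have "R' (\<phi> s) (\<phi> t)" using R Y by blast
        then show "P (\<phi> t)" using step st by blast
      qed
      then show "\<forall>x\<in>\<phi> ` (?A \<union> ?B). P x" by blast
    qed
  qed
  ultimately show "(\<forall>v\<in>common_neighbours (\<phi> ` V) R' a'. coned_at (common_neighbours (\<phi> ` V) R' a') R' v) \<and>
      (\<forall>v\<in>common_neighbours (\<phi> ` V) R' a'. \<forall>w\<in>common_neighbours (\<phi> ` V) R' a'. v \<noteq> w \<longrightarrow> \<not> R' v w \<longrightarrow>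
        connected_at (common_neighbours (\<phi> ` V) R' a') R' v w)"
    unfolding L' by blast
qed

text \<open>Adjacent to everything, \<open>T\<close> is never among the non-neighbours of another
  vertex, and both conditions speak of non-neighbours only.\<close>

lemma unobstructed_remove_cone_point:
  assumes un: "unobstructed V R" and T: "\<And>x. x \<in> V \<Longrightarrow> R x T"
  shows "unobstructed (V - {T}) R"
  unfolding unobstructed_def
proof (rule ballI)
  fix a assume a: "a \<in> clique_complex (V - {T}) R"
  define L where "L = common_neighbours V R a"
  have aV: "a \<in> clique_complex V R" using a by (auto simp: clique_complex_def)
  have L': "common_neighbours (V - {T}) R a = L - {T}" by (auto simp: common_neighbours_def L_def)
  have N: "non_neighbours (L - {T}) R v = non_neighbours L R v" if "v \<in> L" for v
    using that T by (auto simp: non_neighbours_def L_def common_neighbours_def)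
  have un': "coned_at L R v" "w \<in> L \<Longrightarrow> v \<noteq> w \<Longrightarrow> \<not> R v w \<Longrightarrow> connected_at L R v w" if "v \<in> L" for v w
    using un aV that by (auto simp: unobstructed_def L_def)
  have "coned_at (L - {T}) R v" if "v \<in> L - {T}" for v
    using un'(1)[of v] that by (simp add: coned_at_iff N)
  moreover have "connected_at (L - {T}) R v w" if "v \<in> L - {T}" "w \<in> L - {T}" "v \<noteq> w" "\<not> R v w" for v w
    using un'(2)[of v w] that by (simp add: connected_at_iff N)
  ultimately show "(\<forall>v\<in>common_neighbours (V - {T}) R a. coned_at (common_neighbours (V - {T}) R a) R v) \<and>
      (\<forall>v\<in>common_neighbours (V - {T}) R a. \<forall>w\<in>common_neighbours (V - {T}) R a. v \<noteq> w \<longrightarrow> \<not> R v w \<longrightarrow>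
        connected_at (common_neighbours (V - {T}) R a) R v w)"
    unfolding L' by blast
qed

section \<open>Adding a member to a building set\<close>

text \<open>The largest member \<open>T\<close> is compatible with all others, so keeping it would
  give a cone. It still counts in \<open>compatible E\<close>, where it forbids pairs whose union is
  \<open>T\<close>.\<close>

definition nested_complex :: "'a set set \<Rightarrow> 'a set \<Rightarrow> 'a set set set" where
  "nested_complex E T = clique_complex (E - {T}) (compatible E)"

text \<open>Adding \<open>M\<close> spoils compatibility only for pairs with union \<open>M\<close>.
  A member inside \<open>M\<close> lies in \<open>A\<close> or in \<open>B\<close>, so the only such
  incomparable pair is \<open>{A, B}\<close>. The non-neighbours of \<open>M\<close> are determined
  by those of \<open>A\<close> and \<open>B\<close>.\<close>

lemma nested_complex_starring:
  assumes E: "building_set lt E" and E': "building_set lt (insert M E)"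
    and M: "M \<notin> E" and AB: "A \<in> E" "B \<in> E" "A \<inter> B = {}" "M = A \<union> B"
    and T: "T \<in> E" "\<And>J. J \<in> E \<Longrightarrow> J \<subseteq> T"
  shows "starring {A, B} M (nested_complex E T) = nested_complex (insert M E) T"
    "{A, B} \<in> nested_complex E T" "M \<notin> vertices (nested_complex E T)" "A \<noteq> B"
proof -
  interpret building_set lt E by (rule E)
  interpret E': building_set lt "insert M E" by (rule E')
  have ne: "A \<noteq> {}" "B \<noteq> {}" using AB nonempty by metis+
  show "A \<noteq> B" using ne AB(3) by blast
  have AT: "A \<noteq> T" "B \<noteq> T" using T(2)[OF AB(1)] T(2)[OF AB(2)] ne AB(3) by blast+
  have MT: "M \<noteq> T" using M T by blast
  \<comment> \<open>A member inside \<open>M\<close> meeting both parts would glue them together,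
    although \<open>M\<close> is new.\<close>
  have merge: "M \<in> E" if J: "J \<in> E" "J \<subseteq> M" "J \<inter> A \<noteq> {}" "J \<inter> B \<noteq> {}" for J
  proof -
    have "J \<union> A \<in> E" using union[OF J(1) AB(1)] J by blast
    then have "(J \<union> A) \<union> B \<in> E" by (rule union[OF _ AB(2)]) (use J in blast)
    moreover have "(J \<union> A) \<union> B = M" using J AB by blast
    ultimately show ?thesis by simp
  qed
  have old: "compatible (insert M E) J K \<longleftrightarrow> compatible E J K \<and> {J, K} \<noteq> {A, B}"
    if J: "J \<in> E" and K: "K \<in> E" for J K
  proof
    assume c: "compatible (insert M E) J K"
    have "{J, K} \<noteq> {A, B}"
    proof
      assume "{J, K} = {A, B}"
      then have "J = A \<and> K = B \<or> J = B \<and> K = A" by (auto simp: doubleton_eq_iff)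
      then show False using c ne AB by (auto simp: compatible_def)
    qed
    then show "compatible E J K \<and> {J, K} \<noteq> {A, B}" using c by (auto simp: compatible_def)
  next
    assume c: "compatible E J K \<and> {J, K} \<noteq> {A, B}"
    show "compatible (insert M E) J K"
    proof (rule ccontr)
      assume nc: "\<not> compatible (insert M E) J K"
      then have JK: "J \<union> K = M" using c by (auto simp: compatible_def)
      have one: "X \<subseteq> A \<or> X \<subseteq> B" if "X \<in> E" "X \<subseteq> M" for X
        using merge[OF that] M that AB(4) by blast
      have "J \<subseteq> A \<or> J \<subseteq> B" "K \<subseteq> A \<or> K \<subseteq> B" using one[OF J] one[OF K] JK by blast+
      then have "J = A \<and> K = B \<or> J = B \<and> K = A" using JK AB ne by blast
      then show False using c by (auto simp: doubleton_eq_iff)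
    qed
  qed
  have new: "compatible (insert M E) M K \<longleftrightarrow> K = A \<or> K = B \<or> compatible E K A \<and> compatible E K B"
    if K: "K \<in> E" for K
  proof
    assume c: "compatible (insert M E) M K"
    have half: "compatible E K X" if X: "X = A \<and> Y = B \<or> X = B \<and> Y = A" "K \<noteq> Y" for X Y
    proof (rule ccontr)
      assume nc: "\<not> compatible E K X"
      have XY: "X \<in> E" "Y \<in> E" "X \<inter> Y = {}" "M = X \<union> Y" "X \<noteq> {}" "Y \<noteq> {}" using X AB ne by auto
      have KX: "K \<union> X \<in> E" "\<not> K \<subseteq> X" "\<not> X \<subseteq> K" using nc by (auto simp: compatible_def)
      consider "M \<subseteq> K" | "K \<subseteq> M" | "\<not> M \<subseteq> K" "\<not> K \<subseteq> M" "M \<union> K \<notin> insert M E"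
        using c by (auto simp: compatible_def)
      then show False
      proof cases
        case 1 then show False using KX XY by blast
      next
        case 2
        have "K \<inter> Y \<noteq> {}" using 2 KX XY by blast
        then have "(K \<union> X) \<union> Y \<in> E" by (intro union[OF KX(1) XY(2)]) blast
        moreover have "(K \<union> X) \<union> Y = M" using 2 XY by blast
        ultimately show False using M by simp
      next
        case 3
        have "(K \<union> X) \<union> M \<in> insert M E"
          by (rule E'.union) (use KX XY in auto)
        moreover have "(K \<union> X) \<union> M = M \<union> K" using XY by blast
        ultimately show False using 3 by simp
      qed
    qed
    show "K = A \<or> K = B \<or> compatible E K A \<and> compatible E K B" using half by blast
  next
    assume c: "K = A \<or> K = B \<or> compatible E K A \<and> compatible E K B"
    show "compatible (insert M E) M K"
    proof (rule ccontr)
      assume nc: "\<not> compatible (insert M E) M K"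
      then have n: "\<not> M \<subseteq> K" "\<not> K \<subseteq> M" by (auto simp: compatible_def)
      then have KAB: "K \<noteq> A" "K \<noteq> B" "compatible E K A" "compatible E K B" using c AB(4) by blast+
      have MK: "M \<union> K \<in> E" using nc n by (auto simp: compatible_def)
      have meet: False if X: "X = A \<and> Y = B \<or> X = B \<and> Y = A" "K \<inter> X \<noteq> {}" for X Y
      proof -
        have XY: "X \<in> E" "Y \<in> E" "X \<inter> Y = {}" "M = X \<union> Y" "X \<noteq> {}" "Y \<noteq> {}" "compatible E K X" "compatible E K Y"
          using X AB ne KAB by auto
        have "K \<union> X \<in> E" using union[OF K XY(1)] X(2) by blast
        then have XK: "X \<subseteq> K" using XY(7) n XY(4) by (auto simp: compatible_def)
        then have nY: "\<not> Y \<subseteq> K" "\<not> K \<subseteq> Y" using n XY by blast+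
        then have "K \<union> Y \<notin> E" using XY(8) by (auto simp: compatible_def)
        moreover have "K \<union> Y = M \<union> K" using XK XY(4) by blast
        ultimately show False using MK by simp
      qed
      have disj: "K \<inter> A = {}" "K \<inter> B = {}" using meet by blast+
      have Kne: "K \<noteq> {}" using K nonempty by metis
      \<comment> \<open>\<open>K\<close>, \<open>A\<close> and \<open>B\<close> are now pairwise
        disjoint with no union in \<open>E\<close>, while their total union is a member.\<close>
      have "\<exists>X\<in>{K, A, B}. M \<union> K \<subseteq> X"
      proof (rule inside_one[OF _ _ MK])
        show "{K, A, B} \<subseteq> E" using K AB by simp
        have p: "K \<union> A \<notin> E" "K \<union> B \<notin> E"
          using KAB disj Kne ne unfolding compatible_def by blast+
        then show "X \<union> Y \<notin> E" if "X \<in> {K, A, B}" "Y \<in> {K, A, B}" "X \<noteq> Y" for X Y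
          using that M AB(4) by (auto simp: Un_commute)
        show "M \<union> K \<subseteq> \<Union>{K, A, B}" using AB(4) by blast
      qed
      then show False using disj Kne ne AB(4) by blast
    qed
  qed
  have V: "finite (E - {T})" using finite_E by simp
  have "compatible E A B" using M AB by (simp add: compatible_def)
  have mem: "A \<in> E - {T}" "B \<in> E - {T}" "M \<notin> E - {T}" using AB AT M by simp_all
  have old': "compatible (insert M E) J K \<longleftrightarrow> compatible E J K \<and> {J, K} \<noteq> {A, B}"
    if "J \<in> E - {T}" "K \<in> E - {T}" "J \<noteq> K" for J K using old that by simp
  have new': "compatible (insert M E) M K \<longleftrightarrow> K = A \<or> K = B \<or> compatible E K A \<and> compatible E K B"
    if "K \<in> E - {T}" for K using new that by simp
  note st = starring_clique_complex[OF V mem(1,2) \<open>A \<noteq> B\<close> \<open>compatible E A B\<close> mem(3) compatible_sym compatible_sym old' new']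
  have ins: "insert M E - {T} = insert M (E - {T})" using MT by blast
  show "starring {A, B} M (nested_complex E T) = nested_complex (insert M E) T" "{A, B} \<in> nested_complex E T"
    unfolding nested_complex_def ins
    using st by blast+
  show "M \<notin> vertices (nested_complex E T)" using M by (simp add: nested_complex_def vertices_clique_complex)
qed

section \<open>Sequences of edge starrings\<close>

definition nested_sphere :: "nat set \<Rightarrow> nat \<Rightarrow> nat set set set \<Rightarrow> bool" where
  "nested_sphere T d K \<longleftrightarrow> linear_sphere d K \<and>
     (\<exists>E. building_set (<) E \<and> T \<in> E \<and> (\<forall>J\<in>E. J \<subseteq> T) \<and> K = nested_complex E T)"

text \<open>Only the building set of the target is recorded; that of the source is known from the
  preceding step or from the initial \<open>nested_sphere\<close>.\<close>

definition edge_step :: "nat set \<Rightarrow> nat set set set \<Rightarrow> nat set set set \<Rightarrow> bool" where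
  "edge_step T K K' \<longleftrightarrow>
     (\<exists>E. building_set (<) E \<and> T \<in> E \<and> (\<forall>J\<in>E. J \<subseteq> T) \<and> K' = nested_complex E T) \<and>
     (\<exists>e v. e \<in> K \<and> card e = 2 \<and> v \<notin> vertices K \<and> K' = starring e v K)"

lemma edge_step_sphere:
  assumes "edge_step T K K'" "linear_sphere d K"
  shows "nested_sphere T d K'"
proof -
  obtain e v where ev: "e \<in> K" "card e = 2" "v \<notin> vertices K" "K' = starring e v K"
    using assms(1) by (auto simp: edge_step_def)
  have "e \<noteq> {}" using ev(2) by auto
  then have "linear_sphere d K'" using linear_sphere_starring[OF assms(2) ev(3,1)] ev(4) by simp
  then show ?thesis using assms(1) by (auto simp: nested_sphere_def edge_step_def)
qed

lemma edge_steps_sphere: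
  assumes "(edge_step T)\<^sup>*\<^sup>* K K'" "nested_sphere T d K"
  shows "nested_sphere T d K'"
  using assms
proof (induction rule: rtranclp_induct)
  case (step K' K'')
  have "linear_sphere d K'" using step.IH step.prems by (simp add: nested_sphere_def)
  then show ?case by (rule edge_step_sphere[OF step.hyps(2)])
qed

text \<open>Vertices are finite sets of naturals, whereas \<open>stellar_sequence\<close> works with
  naturals; \<open>set_encode\<close> is injective on finite sets.\<close>

lemma nested_sphere_encoded:
  assumes "nested_sphere T d K"
  shows "inj_on set_encode (vertices K)" "combinatorial_sphere d ((\<lambda>f. set_encode ` f) ` K)"
    "trivial_T2 ((\<lambda>f. set_encode ` f) ` K)"
proof -
  obtain E where E: "building_set (<) E" "T \<in> E" "\<forall>J\<in>E. J \<subseteq> T" "K = nested_complex E T"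
    using assms by (auto simp: nested_sphere_def)
  interpret building_set "(<)" E by (rule E)
  have V: "vertices K = E - {T}" by (simp add: E(4) nested_complex_def vertices_clique_complex)
  then show inj: "inj_on set_encode (vertices K)"
    using finite_member by (intro inj_on_subset[OF inj_on_set_encode]) auto
  have iso: "complex_iso K ((\<lambda>f. set_encode ` f) ` K)" using inj unfolding complex_iso_def by blast
  show "combinatorial_sphere d ((\<lambda>f. set_encode ` f) ` K)"
    using assms iso linear_sphere_iso combinatorial_sphere_if_linear by (metis nested_sphere_def)
  define R where "R x y = compatible E (set_decode x) (set_decode y)" for x y
  have dec: "set_decode (set_encode J) = J" if "J \<in> E" for J using that finite_member by simp
  have R: "R (set_encode J) (set_encode L) \<longleftrightarrow> compatible E J L" if "J \<in> E - {T}" "L \<in> E - {T}" for J L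
    using that dec by (simp add: R_def)
  have injE: "inj_on set_encode (E - {T})" using inj V by simp
  have eq: "(\<lambda>f. set_encode ` f) ` K = clique_complex (set_encode ` (E - {T})) R"
    unfolding E(4) nested_complex_def
    by (rule clique_complex_image[OF injE, symmetric]) (simp add: R)
  interpret F: flag_complex "set_encode ` (E - {T})" R
    by unfold_locales (use finite_E compatible_sym in \<open>auto simp: R_def\<close>)
  have "unobstructed (E - {T}) (compatible E)"
  proof (rule unobstructed_remove_cone_point[OF building_set_unobstructed[OF E(1)]])
    show "compatible E J T" if "J \<in> E" for J using E(3) that by (auto simp: compatible_def)
  qed
  then have "unobstructed (set_encode ` (E - {T})) R"
    by (rule unobstructed_image[OF injE, rotated]) (rule R)
  then show "trivial_T2 ((\<lambda>f. set_encode ` f) ` K)" unfolding eq by (rule F.trivial_T2)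
qed

lemma edge_subdivision_through_steps:
  assumes steps: "(edge_step T)\<^sup>*\<^sup>* K K'" and K: "nested_sphere T d K"
    and X: "complex_iso X K" and Y: "complex_iso K' Y"
  shows "edge_subdivision_through (\<lambda>L. combinatorial_sphere d L \<and> trivial_T2 L) X Y"
proof -
  obtain N where "(edge_step T ^^ N) K K'" using steps rtranclp_imp_relpowp by metis
  then obtain F where F: "F 0 = K" "F N = K'" "\<And>i. i < N \<Longrightarrow> edge_step T (F i) (F (Suc i))"
    unfolding relpowp_fun_conv by blast
  have sphere: "nested_sphere T d (F i)" if "i \<le> N" for i
    using that
  proof (induction i)
    case (Suc i)
    then have "linear_sphere d (F i)" by (simp add: nested_sphere_def)
    moreover have "edge_step T (F i) (F (Suc i))" using F(3)[of i] Suc.prems by simp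
    ultimately show ?case using edge_step_sphere by blast
  qed (simp add: F K)
  have "\<exists>e. i < N \<longrightarrow> e \<in> F i \<and> card e = 2 \<and> (\<exists>v. v \<notin> vertices (F i) \<and> F (Suc i) = starring e v (F i))" for i
    using F(3)[of i] unfolding edge_step_def by blast
  then obtain e where e: "e i \<in> F i" "card (e i) = 2" "\<exists>v. v \<notin> vertices (F i) \<and> F (Suc i) = starring (e i) v (F i)"
    if "i < N" for i by metis
  define L where "L i = (\<lambda>f. set_encode ` f) ` F i" for i
  define f where "f i = set_encode ` e i" for i
  have iso: "complex_iso (F i) (L i)" if "i \<le> N" for i
    using nested_sphere_encoded(1)[OF sphere[OF that]] unfolding complex_iso_def L_def by blast
  have card_f: "card (f i) = 2" if "i < N" for i
  proof -
    have "inj_on set_encode (e i)"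
      by (rule inj_on_subset[OF nested_sphere_encoded(1)[OF sphere[of i]]]) (use e that in auto)
    then show ?thesis using e(2)[OF that] by (simp add: f_def card_image)
  qed
  have starred: "\<exists>v. v \<notin> vertices (L i) \<and> L (Suc i) = starring (f i) v (L i)" if i: "i < N" for i
  proof -
    obtain v where v: "v \<notin> vertices (F i)" "F (Suc i) = starring (e i) v (F i)" using e(3)[OF i] by blast
    have Fi: "simplicial_complex (F i)" using sphere[of i] i by (simp add: nested_sphere_def linear_sphere_def)
    have inj: "inj_on set_encode (vertices (F i))" "inj_on set_encode (vertices (F (Suc i)))"
      using nested_sphere_encoded(1)[OF sphere] i by auto
    \<comment> \<open>The new vertex is not known to be a finite set from its choice alone. As a
      vertex of the next nested complex it is one, and \<open>set_encode\<close> is injective there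
      too.\<close>
    have "v \<in> vertices (F (Suc i))"
    proof -
      have "{v} \<in> starring (e i) v (F i)"
        unfolding starring_iff[OF Fi v(1) e(1)[OF i]]
        using e(1,2)[OF i] v(1) by (auto simp: card_2_iff)
      then show ?thesis using v(2) by blast
    qed
    have fin: "finite J" if j: "j \<le> N" and J: "J \<in> vertices (F j)" for j J
    proof -
      obtain E where E: "building_set (<) E" "F j = nested_complex E T"
        using sphere[OF j] by (auto simp: nested_sphere_def)
      have "J \<in> E" using J unfolding E(2) nested_complex_def vertices_clique_complex by simp
      then show ?thesis using building_set.finite_member[OF E(1)] by simp
    qed
    have "inj_on set_encode (insert v (vertices (F i)))"
      by (rule inj_on_subset[OF inj_on_set_encode]) (use fin[of "Suc i"] fin[of i] i \<open>v \<in> vertices (F (Suc i))\<close> in auto)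
    note st = starring_image[OF Fi v(1) e(1)[OF i] this]
    show ?thesis using st v(2) unfolding L_def f_def by (intro exI[of _ "set_encode v"]) simp
  qed
  have "stellar_sequence N L f X Y"
    unfolding stellar_sequence_def
  proof (intro conjI allI impI)
    show "complex_iso X (L 0)" using complex_iso_trans[OF X] iso[of 0] F(1) by simp
    show "complex_iso (L N) Y" using complex_iso_trans[OF complex_iso_sym Y] iso[of N] F(2) by simp
    fix i assume i: "i < N"
    show "f i \<in> L i" using e(1)[OF i] by (simp add: f_def L_def)
    show "f i \<noteq> {}" using card_f[OF i] by auto
    show "\<exists>v. v \<notin> vertices (L i) \<and> L (Suc i) = starring (f i) v (L i)" by (rule starred[OF i])
  qed
  moreover have "\<forall>i\<le>N. combinatorial_sphere d (L i) \<and> trivial_T2 (L i)"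
    using nested_sphere_encoded(2,3)[OF sphere] by (simp add: L_def)
  ultimately show ?thesis using card_f unfolding edge_subdivision_through_def by blast
qed

lemma stellar_subdivision_if_edge:
  "edge_subdivision_through Q X Y \<Longrightarrow> stellar_subdivision X Y"
  by (auto simp: edge_subdivision_through_def stellar_subdivision_def)

section \<open>Intervals without cuts\<close>

text \<open>A cut \<open>c\<close> separates \<open>c\<close> from \<open>c + 1\<close>; the initial intervals are always present.\<close>

definition uncut :: "nat \<Rightarrow> nat set \<Rightarrow> nat \<Rightarrow> nat \<Rightarrow> bool" where
  "uncut N S a b \<longleftrightarrow> 1 \<le> a \<and> a \<le> b \<and> b \<le> N \<and> (a = 1 \<or> (\<forall>c\<in>S. \<not> (a \<le> c \<and> c < b)))"

definition intervals :: "nat \<Rightarrow> nat set \<Rightarrow> nat set set" where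
  "intervals N S = {{a..b} | a b. uncut N S a b}"

lemma intervals_iff: "a \<le> b \<Longrightarrow> {a..b} \<in> intervals N S \<longleftrightarrow> uncut N S a b"
  unfolding intervals_def by (auto simp: Icc_eq_Icc)

lemma intervalsE:
  assumes "J \<in> intervals N S"
  obtains a b where "J = {a..b}" "uncut N S a b" "a \<le> b" "b \<le> N" "1 \<le> a"
  using assms by (auto simp: intervals_def uncut_def)

lemma intervals_antimono: "S' \<subseteq> S \<Longrightarrow> intervals N S \<subseteq> intervals N S'"
  by (force simp: intervals_def uncut_def)

lemma finite_intervals: "finite (intervals N S)"
proof (rule finite_subset)
  show "intervals N S \<subseteq> Pow {1..N}" by (auto simp: intervals_def uncut_def)
qed simp

lemma overlapping_union:
  fixes a :: nat
  assumes "a \<le> b" "a' \<le> b'" "{a..b} \<inter> {a'..b'} \<noteq> {}"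
  shows "{a..b} \<union> {a'..b'} = {min a a'..max b b'}"
  using assms by auto

lemma intervals_union:
  assumes J: "J \<in> intervals N S" and K: "K \<in> intervals N S" and JK: "J \<inter> K \<noteq> {}"
  shows "J \<union> K \<in> intervals N S"
proof -
  obtain a b where ab: "J = {a..b}" "uncut N S a b" "a \<le> b" using J by (rule intervalsE)
  obtain a' b' where ab': "K = {a'..b'}" "uncut N S a' b'" "a' \<le> b'" using K by (rule intervalsE)
  have meet: "a \<le> b'" "a' \<le> b" using JK ab ab' by auto
  have eq: "J \<union> K = {min a a'..max b b'}" using overlapping_union ab ab' JK by simp
  have "uncut N S (min a a') (max b b')"
    unfolding uncut_def
  proof (intro conjI)
    show "min a a' = 1 \<or> (\<forall>c\<in>S. \<not> (min a a' \<le> c \<and> c < max b b'))"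
    proof (cases "min a a' = 1")
      case False
      then have ne: "a \<noteq> 1" "a' \<noteq> 1" using ab ab' by (auto simp: uncut_def min_def split: if_splits)
      have "\<not> (min a a' \<le> c \<and> c < max b b')" if "c \<in> S" for c
      proof -
        have "\<not> (a \<le> c \<and> c < b)" "\<not> (a' \<le> c \<and> c < b')" using ab(2) ab'(2) ne that by (auto simp: uncut_def)
        then show ?thesis using meet by linarith
      qed
      then show ?thesis by blast
    qed simp
  qed (use ab ab' in \<open>auto simp: uncut_def\<close>)
  then show ?thesis unfolding eq using ab ab' by (subst intervals_iff) (auto simp: uncut_def)
qed

text \<open>Describes the stages between having the cut \<open>c\<close> and having removed it:
  \<open>U\<close> holds intervals already restored. That everything above a member of
  \<open>U\<close> is present gives the closure under unions.\<close>

lemma building_set_intervals: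
  assumes c: "c \<in> S" and U: "U \<subseteq> intervals N (S - {c})"
    and up: "\<And>J K. J \<in> U \<Longrightarrow> K \<in> intervals N (S - {c}) \<Longrightarrow> J \<subseteq> K \<Longrightarrow> K \<in> intervals N S \<union> U"
  shows "building_set (<) (intervals N S \<union> U)"
proof
  let ?E = "intervals N S \<union> U"
  have sub: "?E \<subseteq> intervals N (S - {c})" using U intervals_antimono[of "S - {c}" S] by blast
  show "finite ?E" using finite_subset[OF sub finite_intervals] .
  show "finite J" if "J \<in> ?E" for J using that sub by (auto simp: intervals_def)
  show "{} \<notin> ?E" using sub by (auto simp: intervals_def uncut_def)
  show "J \<union> K \<in> ?E" if JK: "J \<in> ?E" "K \<in> ?E" "J \<inter> K \<noteq> {}" for J K
  proof -
    have un: "J \<union> K \<in> intervals N (S - {c})" using intervals_union[of J N "S - {c}" K] JK sub by blast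
    consider "J \<in> intervals N S" "K \<in> intervals N S" | "J \<in> U" | "K \<in> U" using JK by blast
    then show ?thesis
    proof cases
      case 1 then show ?thesis using intervals_union JK(3) by blast
    next
      case 2 then show ?thesis using up[OF 2 un] by blast
    next
      case 3 then show ?thesis using up[OF 3 un] by blast
    qed
  qed
  show "\<exists>A\<in>?E. \<exists>B\<in>?E. A \<inter> B = {} \<and> M = A \<union> B" if M: "M \<in> ?E" "\<And>x. M \<noteq> {x}" for M
  proof -
    obtain a b where ab: "M = {a..b}" "uncut N (S - {c}) a b" "a \<le> b" "b \<le> N" "1 \<le> a"
      using M(1) sub by (meson intervalsE subsetD)
    have "a \<noteq> b" using M(2)[of a] ab(1) by auto
    then have lt: "a < b" using ab by simp
    have split: ?thesis if "uncut N S a d" "uncut N S (Suc d) b" for d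
    proof -
      have d: "a \<le> d" "Suc d \<le> b" using that by (auto simp: uncut_def)
      then have "{a..d} \<in> ?E" "{Suc d..b} \<in> ?E" using that by (simp_all add: intervals_iff)
      moreover have "{a..d} \<inter> {Suc d..b} = {}" "M = {a..d} \<union> {Suc d..b}" using d ab(1) by auto
      ultimately show ?thesis by blast
    qed
    show ?thesis
    proof (cases "uncut N S a b")
      case True
      \<comment> \<open>Splitting off the last point works also for an initial interval that crosses
        cuts, as the rest is again initial.\<close>
      then show ?thesis using lt by (intro split[of "b - 1"]) (auto simp: uncut_def)
    next
      case False
      then obtain d where d: "d \<in> S" "a \<le> d" "d < b" "a \<noteq> 1" using ab(3-5) by (auto simp: uncut_def)
      have only: "x = c" if "x \<in> S" "a \<le> x" "x < b" for x using ab(2) d(4) that by (auto simp: uncut_def)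
      have "d = c" using only d(1-3) by blast
      then have acb: "a \<le> c" "c < b" using d by simp_all
      have "\<not> (a \<le> x \<and> x < c)" "\<not> (Suc c \<le> x \<and> x < b)" if "x \<in> S" for x
        using only[OF that] acb by auto
      \<comment> \<open>A member absent from \<open>intervals N S\<close> crosses the cut
        \<open>c\<close> and no other, so its parts on both sides of \<open>c\<close> are
        present.\<close>
      then have "uncut N S a c" "uncut N S (Suc c) b" unfolding uncut_def using acb ab(4,5) by auto
      then show ?thesis by (rule split)
    qed
  qed
  show "y \<in> J" if "J \<in> ?E" "x \<in> J" "z \<in> J" "y \<in> \<Union>?E" "x < y" "y < z" for J x y z
  proof -
    have "J \<in> intervals N (S - {c})" using that(1) sub by blast
    then obtain a b where "J = {a..b}" by (rule intervalsE)
    then show ?thesis using that(2,3,5,6) by simp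
  qed
qed auto

lemma intervals_top:
  assumes "1 \<le> N"
  shows "{1..N} \<in> intervals N S" "J \<in> intervals N S \<Longrightarrow> J \<subseteq> {1..N}"
  using assms by (auto simp: intervals_iff uncut_def elim!: intervalsE)

text \<open>The cut is removed by adding the missing intervals across it, the largest ones first.\<close>

lemma remove_cut_from:
  assumes N: "1 \<le> N" and c: "c \<in> S" and U: "U \<subseteq> intervals N (S - {c})"
    and up: "\<And>J K. J \<in> U \<Longrightarrow> K \<in> intervals N (S - {c}) \<Longrightarrow> J \<subseteq> K \<Longrightarrow> K \<in> intervals N S \<union> U"
  shows "(edge_step {1..N})\<^sup>*\<^sup>* (nested_complex (intervals N S \<union> U) {1..N})
    (nested_complex (intervals N (S - {c})) {1..N})"
  using U up
proof (induction "card (intervals N (S - {c}) - (intervals N S \<union> U))" arbitrary: U rule: less_induct)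
  case less
  let ?B = "intervals N S" and ?B' = "intervals N (S - {c})" and ?T = "{1..N}"
  have BB': "?B \<subseteq> ?B'" by (rule intervals_antimono) blast
  show ?case
  proof (cases "?B' - (?B \<union> U) = {}")
    case True
    then have "?B \<union> U = ?B'" using less.prems(1) BB' by blast
    then show ?thesis by simp
  next
    case False
    have fin: "finite (?B' - (?B \<union> U))" using finite_intervals by simp
    then have "Max (card ` (?B' - (?B \<union> U))) \<in> card ` (?B' - (?B \<union> U))" using False by (intro Max_in) simp_all
    then obtain M where "M \<in> ?B' - (?B \<union> U)" "card M = Max (card ` (?B' - (?B \<union> U)))" by force
    then have M: "M \<in> ?B' - (?B \<union> U)" "\<And>K. K \<in> ?B' - (?B \<union> U) \<Longrightarrow> card K \<le> card M"
      using fin by simp_all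
    obtain a b where ab: "M = {a..b}" "uncut N (S - {c}) a b" "a \<le> b"
      using M(1) by (meson DiffD1 intervalsE)
    then have "\<not> uncut N S a b" using M(1) by (simp add: intervals_iff)
    then obtain d where d: "d \<in> S" "a \<le> d" "d < b" "a \<noteq> 1" using ab(2) unfolding uncut_def by blast
    have "d = c" using ab(2) d unfolding uncut_def by blast
    then have acb: "a \<le> c" "c < b" "a \<noteq> 1" using d by simp_all
    define U' where "U' = insert M U"
    have U': "U' \<subseteq> ?B'" using less.prems(1) M(1) by (auto simp: U'_def)
    \<comment> \<open>An absent interval properly above \<open>M\<close> would have more points than
      \<open>M\<close>, which has the most among the absent ones.\<close>
    have up': "K \<in> ?B \<union> U'" if "J \<in> U'" "K \<in> ?B'" "J \<subseteq> K" for J K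
    proof (cases "J = M")
      case True
      show ?thesis
      proof (rule ccontr)
        assume K: "K \<notin> ?B \<union> U'"
        then have "M \<subset> K" using that True by (auto simp: U'_def)
        moreover have "finite K" using that(2) by (auto simp: intervals_def)
        ultimately have "card M < card K" by (simp add: psubset_card_mono)
        then show False using M(2)[of K] K that(2) by (simp add: U'_def)
      qed
    next
      case False
      then show ?thesis using less.prems(2)[of J K] that by (auto simp: U'_def)
    qed
    have ins: "?B \<union> U' = insert M (?B \<union> U)" by (simp add: U'_def)
    have E: "building_set (<) (?B \<union> U)" using c less.prems(1) less.prems(2) by (rule building_set_intervals)
    have E': "building_set (<) (insert M (?B \<union> U))"
      unfolding ins[symmetric] using c U' up' by (rule building_set_intervals)
    \<comment> \<open>The ends of the edge to be starred are the parts of \<open>M\<close> on the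
      two sides of the cut; neither crosses a cut of \<open>S\<close>.\<close>
    have parts: "{a..c} \<in> ?B \<union> U" "{Suc c..b} \<in> ?B \<union> U"
      using ab acb by (auto simp: intervals_iff uncut_def)
    have MU: "M \<notin> ?B \<union> U" using M(1) by simp
    have disj: "{a..c} \<inter> {Suc c..b} = {}" "M = {a..c} \<union> {Suc c..b}" using acb ab(1) by auto
    have T: "?T \<in> ?B \<union> U" using intervals_top(1)[OF N, of S] by blast
    have sub_T: "J \<subseteq> ?T" if "J \<in> ?B \<union> U" for J
      using intervals_top(2)[OF N, of J "S - {c}"] less.prems(1) that BB' by blast
    have T': "?T \<in> insert M (?B \<union> U)" "\<forall>J\<in>insert M (?B \<union> U). J \<subseteq> ?T"
      using intervals_top[OF N, of S] intervals_top(2)[OF N, of _ "S - {c}"] U' BB' unfolding ins[symmetric] by blast+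
    note st = nested_complex_starring[OF E E' MU parts disj T sub_T]
    have "edge_step ?T (nested_complex (?B \<union> U) ?T) (nested_complex (insert M (?B \<union> U)) ?T)"
      unfolding edge_step_def
    proof (intro conjI)
      show "\<exists>E. building_set (<) E \<and> ?T \<in> E \<and> (\<forall>J\<in>E. J \<subseteq> ?T) \<and>
          nested_complex (insert M (?B \<union> U)) ?T = nested_complex E ?T"
        using E' T' by blast
      show "\<exists>e v. e \<in> nested_complex (?B \<union> U) ?T \<and> card e = 2 \<and> v \<notin> vertices (nested_complex (?B \<union> U) ?T) \<and>
          nested_complex (insert M (?B \<union> U)) ?T = starring e v (nested_complex (?B \<union> U) ?T)"
        using st by (intro exI[of _ "{{a..c}, {Suc c..b}}"] exI[of _ M]) simp
    qed
    moreover have "(edge_step ?T)\<^sup>*\<^sup>* (nested_complex (?B \<union> U') ?T) (nested_complex ?B' ?T)"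
    proof (rule less.hyps[OF _ U' up'])
      have "?B' - (?B \<union> U') \<subset> ?B' - (?B \<union> U)" using M(1) by (auto simp: U'_def)
      then show "card (?B' - (?B \<union> U')) < card (?B' - (?B \<union> U))" using fin by (simp add: psubset_card_mono)
    qed
    ultimately show ?thesis unfolding ins by (rule converse_rtranclp_into_rtranclp)
  qed
qed

lemma remove_cut:
  assumes "1 \<le> N" "c \<in> S"
  shows "(edge_step {1..N})\<^sup>*\<^sup>* (nested_complex (intervals N S) {1..N})
    (nested_complex (intervals N (S - {c})) {1..N})"
  using remove_cut_from[OF assms, of "{}"] by simp

lemma remove_cuts:
  assumes N: "1 \<le> N" and S: "finite S" "S' \<subseteq> S"
  shows "(edge_step {1..N})\<^sup>*\<^sup>* (nested_complex (intervals N S) {1..N})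
    (nested_complex (intervals N S') {1..N})"
  using S
proof (induction "card (S - S')" arbitrary: S rule: less_induct)
  case less
  show ?case
  proof (cases "S = S'")
    case False
    then obtain c where c: "c \<in> S" "c \<notin> S'" using less.prems by blast
    have "card (S - {c} - S') < card (S - S')"
      by (rule psubset_card_mono) (use less.prems c in auto)
    then have "(edge_step {1..N})\<^sup>*\<^sup>* (nested_complex (intervals N (S - {c})) {1..N})
        (nested_complex (intervals N S') {1..N})"
      by (rule less.hyps) (use less.prems c in auto)
    then show ?thesis using remove_cut[OF N c(1)] by (meson rtranclp_trans)
  qed simp
qed

section \<open>Joins of dual associahedra\<close>

lemma assoc_complex_clique:
  "assoc_complex n = clique_complex (diagonals n) (\<lambda>d e. \<not> crossing d e)"
proof -
  have "\<not> crossing d d" for d by (cases d) simp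
  then have "(\<forall>d\<in>F. \<forall>e\<in>F. \<not> crossing d e) \<longleftrightarrow> (\<forall>d\<in>F. \<forall>e\<in>F. d \<noteq> e \<longrightarrow> \<not> crossing d e)" for F by metis
  then show ?thesis by (simp add: assoc_complex_def clique_complex_def)
qed

lemma join_family_clique:
  "join_family I (\<lambda>i. clique_complex (V i) (R i)) =
    clique_complex (Sigma I V) (\<lambda>x y. fst x \<noteq> fst y \<or> R (fst x) (snd x) (snd y))"
proof (rule Set.set_eqI)
  fix X
  show "X \<in> join_family I (\<lambda>i. clique_complex (V i) (R i)) \<longleftrightarrow>
      X \<in> clique_complex (Sigma I V) (\<lambda>x y. fst x \<noteq> fst y \<or> R (fst x) (snd x) (snd y))"
  proof
    assume "X \<in> join_family I (\<lambda>i. clique_complex (V i) (R i))"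
    then have X: "fst ` X \<subseteq> I" "\<And>i. i \<in> I \<Longrightarrow> {x. (i, x) \<in> X} \<in> clique_complex (V i) (R i)"
      by (auto simp: join_family_iff)
    have "X \<subseteq> Sigma I V"
    proof clarify
      fix i x assume ix: "(i, x) \<in> X"
      then have "i \<in> I" using X(1) by force
      then show "i \<in> I \<and> x \<in> V i" using X(2)[of i] ix by (auto simp: clique_complex_def)
    qed
    moreover have "fst x \<noteq> fst y \<or> R (fst x) (snd x) (snd y)" if "x \<in> X" "y \<in> X" "x \<noteq> y" for x y
    proof -
      have "fst x \<in> I" using X(1) that by blast
      then show ?thesis using X(2)[of "fst x"] that
        by (cases x; cases y) (auto simp: clique_complex_def)
    qed
    ultimately show "X \<in> clique_complex (Sigma I V) (\<lambda>x y. fst x \<noteq> fst y \<or> R (fst x) (snd x) (snd y))"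
      by (simp add: clique_complex_def)
  next
    assume "X \<in> clique_complex (Sigma I V) (\<lambda>x y. fst x \<noteq> fst y \<or> R (fst x) (snd x) (snd y))"
    then have X: "X \<subseteq> Sigma I V" "\<And>x y. x \<in> X \<Longrightarrow> y \<in> X \<Longrightarrow> x \<noteq> y \<Longrightarrow> fst x \<noteq> fst y \<or> R (fst x) (snd x) (snd y)"
      by (simp_all add: clique_complex_def)
    have "R i x y" if "(i, x) \<in> X" "(i, y) \<in> X" "x \<noteq> y" for i x y
      using X(2)[OF that(1,2)] that(3) by simp
    then show "X \<in> join_family I (\<lambda>i. clique_complex (V i) (R i))"
      using X(1) by (auto simp: join_family_iff clique_complex_def)
  qed
qed

text \<open>The bound \<open>Suc b\<close> includes disjoint intervals that touch: crossing
  diagonals may have disjoint intervals.\<close>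

lemma union_interval_iff:
  fixes a b a' b' :: nat
  assumes "a \<le> b" "a' \<le> b'" "a < a'" "b < b'"
  shows "{a..b} \<union> {a'..b'} \<in> intervals N S \<longleftrightarrow> a' \<le> Suc b \<and> uncut N S a b'"
proof (cases "a' \<le> Suc b")
  case True
  then have "{a..b} \<union> {a'..b'} = {a..b'}" using assms by auto
  then show ?thesis using True assms by (simp add: intervals_iff)
next
  case False
  have "{a..b} \<union> {a'..b'} \<noteq> {x..y}" for x y
  proof
    assume eq: "{a..b} \<union> {a'..b'} = {x..y}"
    then have "a \<in> {x..y}" "b' \<in> {x..y}" using assms by auto
    then have "Suc b \<in> {x..y}" using assms by auto
    then show False using False assms unfolding eq[symmetric] by auto
  qed
  then show ?thesis using False unfolding intervals_def by blast
qed

lemma compatible_intervals_iff: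
  assumes "a \<le> b" "a' \<le> b'"
  shows "compatible (intervals N S) {a..b} {a'..b'} \<longleftrightarrow>
    \<not> (a < a' \<and> a' \<le> Suc b \<and> b < b' \<and> uncut N S a b') \<and> \<not> (a' < a \<and> a \<le> Suc b' \<and> b' < b \<and> uncut N S a' b)"
proof -
  consider "a \<le> a'" "b' \<le> b" | "a' \<le> a" "b \<le> b'" | "a < a'" "b < b'" | "a' < a" "b' < b" by linarith
  then show ?thesis
  proof cases
    case 1 then show ?thesis by (auto simp: compatible_def)
  next
    case 2 then show ?thesis by (auto simp: compatible_def)
  next
    case 3
    then have "\<not> {a..b} \<subseteq> {a'..b'}" "\<not> {a'..b'} \<subseteq> {a..b}" using assms by auto
    then show ?thesis using 3 union_interval_iff[OF assms 3] by (auto simp: compatible_def)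
  next
    case 4
    then have "\<not> {a..b} \<subseteq> {a'..b'}" "\<not> {a'..b'} \<subseteq> {a..b}" using assms by auto
    then show ?thesis using 4 union_interval_iff[OF assms(2,1) 4] by (auto simp: compatible_def Un_commute)
  qed
qed

text \<open>The polygons of the join are placed along one polygon: they share the vertex \<open>1\<close>, and the
  other vertices of the \<open>i\<close>-th polygon are shifted by \<open>offset r i\<close>, so that consecutive polygons
  overlap in a triangle.  The diagonal \<open>(a, b)\<close> becomes the interval of the vertices it cuts off,
  shifted by one.\<close>

definition offset :: "(nat \<Rightarrow> nat) \<Rightarrow> nat \<Rightarrow> nat" where
  "offset r i = (\<Sum>j\<in>{1..<i}. r j - 3)"

text \<open>The other intervals of the block \<open>i\<close>, apart from the initial ones, lie
  between \<open>offset r i + 2\<close> and \<open>offset r (Suc i) + 1\<close>. The cuts separate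
  these ranges; no cut comes before the first.\<close>

definition join_cuts :: "nat \<Rightarrow> (nat \<Rightarrow> nat) \<Rightarrow> nat set" where
  "join_cuts m r = (\<lambda>i. Suc (offset r i)) ` {2..m}"

lemma offset_Suc: "1 \<le> i \<Longrightarrow> offset r (Suc i) = offset r i + (r i - 3)"
  by (simp add: offset_def)

lemma offset_mono: "i \<le> j \<Longrightarrow> offset r i \<le> offset r j"
  unfolding offset_def by (intro sum_mono2) auto

lemma offset_1 [simp]: "offset r (Suc 0) = 0"
  by (simp add: offset_def)

lemma offset_block:
  "z < offset r (Suc m) \<Longrightarrow> \<exists>i\<in>{1..m}. offset r i \<le> z \<and> z < offset r (Suc i)"
proof (induction m)
  case (Suc m)
  show ?case
  proof (cases "z < offset r (Suc m)")
    case True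
    then show ?thesis using Suc.IH by fastforce
  next
    case False
    then show ?thesis using Suc.prems by (intro bexI[of _ "Suc m"]) auto
  qed
qed simp

definition arc_lower :: "(nat \<Rightarrow> nat) \<Rightarrow> nat \<Rightarrow> nat \<Rightarrow> nat" where
  "arc_lower r i a = (if a = 1 then 1 else a + offset r i)"

definition arc_upper :: "(nat \<Rightarrow> nat) \<Rightarrow> nat \<Rightarrow> nat \<Rightarrow> nat" where
  "arc_upper r i b = b + offset r i - 2"

definition arc_interval :: "(nat \<Rightarrow> nat) \<Rightarrow> nat \<times> nat \<times> nat \<Rightarrow> nat set" where
  "arc_interval r x = (case x of (i, a, b) \<Rightarrow> {arc_lower r i a..arc_upper r i b})"

lemma arc_bounds:
  assumes r: "4 \<le> r i" and i: "1 \<le> i" and d: "(a, b) \<in> diagonals (r i)"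
  shows "1 \<le> arc_lower r i a" "arc_lower r i a \<le> arc_upper r i b"
    "arc_upper r i b \<le> Suc (offset r (Suc i))"
    "a = 1 \<Longrightarrow> offset r i < arc_upper r i b \<and> arc_upper r i b \<le> offset r (Suc i)"
    "a \<noteq> 1 \<Longrightarrow> offset r i + 2 \<le> arc_lower r i a"
  using d r by (auto simp: diagonals_def arc_lower_def arc_upper_def offset_Suc[OF i])

text \<open>The cuts up to index \<open>i\<close> lie before the range of the block, and the later
  ones are not before its last point.\<close>

lemma uncut_block:
  assumes "1 \<le> i" "a' \<noteq> 1 \<Longrightarrow> offset r i + 2 \<le> a'" "b' \<le> Suc (offset r (Suc i))" "1 \<le> a'" "a' \<le> b'" "b' \<le> N"
  shows "uncut N (join_cuts m r) a' b'"
proof -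
  have "\<not> (a' \<le> c \<and> c < b')" if c: "c \<in> join_cuts m r" and a': "a' \<noteq> 1" for c
  proof -
    obtain j where j: "c = Suc (offset r j)" using c by (auto simp: join_cuts_def)
    show ?thesis
    proof (cases "j \<le> i")
      case True
      then show ?thesis using offset_mono[of j i r] assms(2)[OF a'] j by simp
    next
      case False
      then show ?thesis using offset_mono[of "Suc i" j r] assms(3) j by simp
    qed
  qed
  then show ?thesis using assms by (auto simp: uncut_def)
qed

text \<open>An initial interval belongs to the block in which it ends, any other one to the range
  that contains it. Within a block compatibility is non-crossing by comparison of end points;
  between blocks the cuts make everything compatible.\<close>

lemma join_assoc_iso:
  assumes m: "1 \<le> m" and r: "\<And>i. i \<in> {1..m} \<Longrightarrow> 4 \<le> r i" and N: "N = Suc (offset r (Suc m))"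
  shows "complex_iso (join_family {1..m} (\<lambda>i. assoc_complex (r i)))
    (nested_complex (intervals N (join_cuts m r)) {1..N})"
proof -
  let ?S = "join_cuts m r" and ?V = "Sigma {1..m} (\<lambda>i. diagonals (r i))"
  let ?l = "arc_lower r" and ?u = "arc_upper r"
  have bd: "1 \<le> ?l i a" "?l i a \<le> ?u i b" "?u i b \<le> Suc (offset r (Suc i))"
    "a = 1 \<Longrightarrow> offset r i < ?u i b \<and> ?u i b \<le> offset r (Suc i)" "a \<noteq> 1 \<Longrightarrow> offset r i + 2 \<le> ?l i a"
    "?u i b \<le> N" "a = 1 \<Longrightarrow> ?l i a = 1" "1 \<le> a" "a + 2 \<le> b"
    if "(i, a, b) \<in> ?V" for i a b
  proof -
    have i: "1 \<le> i" "i \<le> m" "4 \<le> r i" "(a, b) \<in> diagonals (r i)" using that r by auto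
    note ab = arc_bounds[of r i a b, OF i(3,1,4)]
    show "1 \<le> ?l i a" "?l i a \<le> ?u i b" "?u i b \<le> Suc (offset r (Suc i))"
      "a = 1 \<Longrightarrow> offset r i < ?u i b \<and> ?u i b \<le> offset r (Suc i)" "a \<noteq> 1 \<Longrightarrow> offset r i + 2 \<le> ?l i a"
      using ab by simp_all
    show "?u i b \<le> N" using ab(3) offset_mono[of "Suc i" "Suc m" r] i N by simp
    show "a = 1 \<Longrightarrow> ?l i a = 1" by (simp add: arc_lower_def)
    show "1 \<le> a" "a + 2 \<le> b" using i(4) by (auto simp: diagonals_def)
  qed
  have same_block: "i = j" if x: "(i, a, b) \<in> ?V" and y: "(j, a', b') \<in> ?V"
    and eq: "?l i a = ?l j a'" "?u i b = ?u j b'" for i a b j a' b'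
  proof -
    have less: False if x: "(i, a, b) \<in> ?V" and y: "(j, a', b') \<in> ?V" and ij: "i < j"
      and eq: "?l i a = ?l j a'" "?u i b = ?u j b'" for i a b j a' b'
    proof -
      have o: "offset r (Suc i) \<le> offset r j" using ij by (intro offset_mono) simp
      show False
      proof (cases "a' = 1")
        case True
        then have "?l i a = 1" using bd(7)[OF y] eq by simp
        then have "a = 1" using bd(5)[OF x] by fastforce
        then show False using bd(4)[OF x] bd(4)[OF y True] eq o by simp
      next
        case False
        then show False using bd(3)[OF x] bd(5)[OF y False] bd(2)[OF x] eq o by simp
      qed
    qed
    show ?thesis using less[OF x y _ eq] less[OF y x _ eq(1)[symmetric] eq(2)[symmetric]] by (cases i j rule: linorder_cases) auto
  qed
  have lower_less: "?l i a < ?l i a' \<longleftrightarrow> a < a'" if "1 \<le> a" "1 \<le> a'" for i a a'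
    using that by (auto simp: arc_lower_def)
  have upper_less: "?u i b < ?u i b' \<longleftrightarrow> b < b'" if "3 \<le> b" "3 \<le> b'" for i b b'
    using that by (auto simp: arc_upper_def)
  have inj: "inj_on (arc_interval r) ?V"
  proof (rule inj_onI)
    fix x y assume x: "x \<in> ?V" and y: "y \<in> ?V" and eq: "arc_interval r x = arc_interval r y"
    obtain i a b j a' b' where xy: "x = (i, a, b)" "y = (j, a', b')" by (cases x, cases y) auto
    have e: "?l i a = ?l j a'" "?u i b = ?u j b'"
      using eq bd(2)[of i a b] x xy by (auto simp: arc_interval_def Icc_eq_Icc)
    have ij: "i = j" using same_block e x y xy by blast
    have "a = a'" using lower_less[of a a' i] lower_less[of a' a i] bd(8)[of i a b] bd(8)[of j a' b'] e x y xy ij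
      by (metis less_irrefl linorder_cases)
    moreover have "b = b'"
    proof -
      have "3 \<le> b" "3 \<le> b'" using bd(8,9)[of i a b] bd(8,9)[of j a' b'] x y xy by auto
      then show ?thesis using upper_less[of b b' i] upper_less[of b' b i] e ij by (metis less_irrefl linorder_cases)
    qed
    ultimately show "x = y" using xy ij by simp
  qed
  have image: "arc_interval r ` ?V = intervals N ?S - {{1..N}}"
  proof
    show "arc_interval r ` ?V \<subseteq> intervals N ?S - {{1..N}}"
    proof (rule image_subsetI)
      fix x assume x: "x \<in> ?V"
      obtain i a b where xi: "x = (i, a, b)" by (cases x)
      note b = bd[OF x[unfolded xi]]
      have i: "1 \<le> i" "i \<le> m" using x xi by auto
      have "uncut N ?S (?l i a) (?u i b)"
        by (rule uncut_block[OF i(1)]) (use b in auto)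
      moreover have "{?l i a..?u i b} \<noteq> {1..N}"
      proof
        assume "{?l i a..?u i b} = {1..N}"
        then have e: "?l i a = 1" "?u i b = N" using b(2) by (auto simp: Icc_eq_Icc)
        then have "a = 1" using b(5) by fastforce
        then show False using b(4) e(2) N offset_mono[of "Suc i" "Suc m" r] i by simp
      qed
      ultimately show "arc_interval r x \<in> intervals N ?S - {{1..N}}"
        using b(2) by (simp add: xi arc_interval_def intervals_iff)
    qed
    show "intervals N ?S - {{1..N}} \<subseteq> arc_interval r ` ?V"
    proof
      fix J assume J: "J \<in> intervals N ?S - {{1..N}}"
      then obtain x y where xy: "J = {x..y}" "uncut N ?S x y" "x \<le> y" "y \<le> N" "1 \<le> x"
        by (meson DiffD1 intervalsE)
      show "J \<in> arc_interval r ` ?V"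
      proof (cases "x = 1")
        case True
        then have "y < N" using J xy by (cases "y = N") auto
        \<comment> \<open>\<open>offset_block\<close> works with half-open ranges from 0: an initial
          interval is located by \<open>y - 1\<close>, any other one by
          \<open>x - 2\<close>.\<close>
        then have "y - 1 < offset r (Suc m)" using N xy by simp
        then obtain i where i: "i \<in> {1..m}" "offset r i \<le> y - 1" "y - 1 < offset r (Suc i)"
          using offset_block by blast
        have "(1, y + 2 - offset r i) \<in> diagonals (r i)"
          using i r[OF i(1)] True xy offset_Suc[of i r] by (auto simp: diagonals_def)
        moreover have "arc_interval r (i, 1, y + 2 - offset r i) = J"
          using i True xy by (auto simp: arc_interval_def arc_lower_def arc_upper_def)
        ultimately show ?thesis using i(1) by (intro image_eqI[of _ _ "(i, 1, y + 2 - offset r i)"]) auto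
      next
        case False
        then have "x - 2 < offset r (Suc m)" using N xy by simp
        then obtain i where i: "i \<in> {1..m}" "offset r i \<le> x - 2" "x - 2 < offset r (Suc i)"
          using offset_block by blast
        have "y \<le> Suc (offset r (Suc i))"
        proof (rule ccontr)
          assume y: "\<not> ?thesis"
          have "i \<noteq> m" using y xy(4) N by auto
          then have "Suc i \<in> {2..m}" using i(1) by auto
          then have "Suc (offset r (Suc i)) \<in> ?S" by (auto simp: join_cuts_def)
          then have "\<not> (x \<le> Suc (offset r (Suc i)) \<and> Suc (offset r (Suc i)) < y)"
            using xy(2) False by (auto simp: uncut_def)
          then show False using y i(3) by simp
        qed
        then have "(x - offset r i, y + 2 - offset r i) \<in> diagonals (r i)"
          using i r[OF i(1)] False xy offset_Suc[of i r] by (auto simp: diagonals_def)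
        moreover have "arc_interval r (i, x - offset r i, y + 2 - offset r i) = J"
          using i False xy by (auto simp: arc_interval_def arc_lower_def arc_upper_def)
        ultimately show ?thesis using i(1)
          by (intro image_eqI[of _ _ "(i, x - offset r i, y + 2 - offset r i)"]) auto
      qed
    qed
  qed
  have adj: "compatible (intervals N ?S) (arc_interval r x) (arc_interval r y) \<longleftrightarrow>
      fst x \<noteq> fst y \<or> \<not> crossing (snd x) (snd y)" if x: "x \<in> ?V" and y: "y \<in> ?V" for x y
  proof -
    obtain i a b j a' b' where xy: "x = (i, a, b)" "y = (j, a', b')" by (cases x, cases y) auto
    note bx = bd[OF x[unfolded xy]] and bY = bd[OF y[unfolded xy]]
    have comp: "compatible (intervals N ?S) (arc_interval r x) (arc_interval r y) \<longleftrightarrow>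
      \<not> (?l i a < ?l j a' \<and> ?l j a' \<le> Suc (?u i b) \<and> ?u i b < ?u j b' \<and> uncut N ?S (?l i a) (?u j b')) \<and>
      \<not> (?l j a' < ?l i a \<and> ?l i a \<le> Suc (?u j b') \<and> ?u j b' < ?u i b \<and> uncut N ?S (?l j a') (?u i b))"
      unfolding xy arc_interval_def prod.case using bx(2) bY(2) by (rule compatible_intervals_iff)
    \<comment> \<open>To touch an interval of the later block without being nested, one of the
      earlier block has to end exactly at the cut before the later one. Then it is not initial, and
      the union crosses that cut.\<close>
    have far: "\<not> (?l i a < ?l j a' \<and> ?l j a' \<le> Suc (?u i b) \<and> ?u i b < ?u j b' \<and> uncut N ?S (?l i a) (?u j b'))"
      "\<not> (?l j a' < ?l i a \<and> ?l i a \<le> Suc (?u j b') \<and> ?u j b' < ?u i b)"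
      if x: "(i, a, b) \<in> ?V" and y: "(j, a', b') \<in> ?V" and ij: "i < j" for i a b j a' b'
    proof -
      note bx = bd[OF x] and bY = bd[OF y]
      have o: "offset r (Suc i) \<le> offset r j" using ij by (intro offset_mono) simp
      show "\<not> (?l i a < ?l j a' \<and> ?l j a' \<le> Suc (?u i b) \<and> ?u i b < ?u j b' \<and> uncut N ?S (?l i a) (?u j b'))"
      proof
        assume h: "?l i a < ?l j a' \<and> ?l j a' \<le> Suc (?u i b) \<and> ?u i b < ?u j b' \<and> uncut N ?S (?l i a) (?u j b')"
        have "a' \<noteq> 1" using h bx(1) bY(7) by auto
        then have u: "?u i b = Suc (offset r j)" using bY(5) bx(3) h o by simp
        then have "a \<noteq> 1" using bx(4) o by auto
        then have "?l i a \<noteq> 1" using bx(5) by fastforce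
        moreover have "Suc (offset r j) \<in> ?S" unfolding join_cuts_def by (rule imageI) (use ij x y in auto)
        ultimately have "\<not> (?l i a \<le> Suc (offset r j) \<and> Suc (offset r j) < ?u j b')"
          using h by (auto simp: uncut_def)
        then show False using h u bx(2) by simp
      qed
      show "\<not> (?l j a' < ?l i a \<and> ?l i a \<le> Suc (?u j b') \<and> ?u j b' < ?u i b)"
        using bx(2,3) bY(4,5) o by (cases "a' = 1") auto
    qed
    consider "i = j" | "i < j" | "j < i" by linarith
    then show ?thesis
    proof cases
      case 1
      have u: "uncut N ?S (?l i a) (?u i b')" if "?l i a \<le> ?u i b'"
        by (rule uncut_block[of i]) (use x xy bx bY 1 that in auto)
      have u': "uncut N ?S (?l i a') (?u i b)" if "?l i a' \<le> ?u i b"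
        by (rule uncut_block[of i]) (use x xy bx bY 1 that in auto)
      have less: "?l i a < ?l i a' \<longleftrightarrow> a < a'" "?l i a' < ?l i a \<longleftrightarrow> a' < a"
        "?u i b < ?u i b' \<longleftrightarrow> b < b'" "?u i b' < ?u i b \<longleftrightarrow> b' < b"
        using bx(8,9) bY(8,9) by (simp_all add: lower_less upper_less)
      have le: "?l i a' \<le> Suc (?u i b) \<longleftrightarrow> a' < b" if "a < a'"
        using that bx(8,9) by (auto simp: arc_lower_def arc_upper_def)
      have le': "?l i a \<le> Suc (?u i b') \<longleftrightarrow> a < b'" if "a' < a"
        using that bY(8,9) by (auto simp: arc_lower_def arc_upper_def)
      show ?thesis
        unfolding comp using 1 less le le' u u' bx(2) bY(2) xy
        by (auto simp del: One_nat_def)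
    next
      case 2
      then show ?thesis unfolding comp using far[of i a b j a' b'] x y xy by auto
    next
      case 3
      then show ?thesis unfolding comp using far[of j a' b' i a b] x y xy by auto
    qed
  qed
  show ?thesis
    unfolding nested_complex_def assoc_complex_clique join_family_clique
    using inj adj image by (intro clique_complex_iso[of "arc_interval r"]) auto
qed

lemma assoc_iso_join: "complex_iso (assoc_complex n) (join_family {1..1::nat} (\<lambda>i. assoc_complex n))"
  unfolding assoc_complex_clique join_family_clique
  by (rule clique_complex_iso[of "Pair 1"]) (auto simp: inj_on_def)

text \<open>A square has the two diagonals \<open>(1, 3)\<close> and \<open>(2, 4)\<close>, and they
  cross.\<close>

lemma hyperoctahedron_iso_join:
  "complex_iso (hyperoctahedron_boundary m) (join_family {1..m} (\<lambda>i. assoc_complex 4))"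
proof -
  define \<phi> :: "nat \<times> bool \<Rightarrow> nat \<times> nat \<times> nat" where "\<phi> x = (fst x, if snd x then (2, 4) else (1, 3))" for x
  have diag: "diagonals 4 = {(1, 3), (2, 4)}" by (auto simp: diagonals_def)
  have hyper: "hyperoctahedron_boundary m = clique_complex ({1..m} \<times> UNIV) (\<lambda>x y. fst x \<noteq> fst y)"
  proof (rule Set.set_eqI)
    fix X
    show "X \<in> hyperoctahedron_boundary m \<longleftrightarrow> X \<in> clique_complex ({1..m} \<times> UNIV) (\<lambda>x y. fst x \<noteq> fst y)"
      unfolding hyperoctahedron_boundary_iff clique_complex_def mem_Collect_eq
    proof (intro conj_cong)
      show "fst ` X \<subseteq> {1..m} \<longleftrightarrow> X \<subseteq> {1..m} \<times> UNIV" by force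
      assume "X \<subseteq> {1..m} \<times> (UNIV :: bool set)"
      then have i: "i \<in> {1..m}" if "(i, s) \<in> X" for i s using that by blast
      show "(\<forall>i\<in>{1..m}. \<not> ((i, True) \<in> X \<and> (i, False) \<in> X)) \<longleftrightarrow>
          (\<forall>x\<in>X. \<forall>y\<in>X. x \<noteq> y \<longrightarrow> fst x \<noteq> fst y)"
      proof (intro iffI ballI impI notI)
        fix x y assume X: "\<forall>i\<in>{1..m}. \<not> ((i, True) \<in> X \<and> (i, False) \<in> X)"
          and xy: "x \<in> X" "y \<in> X" "x \<noteq> y" "fst x = fst y"
        obtain k s t where "x = (k, s)" "y = (k, t)" using xy(4) by (cases x; cases y) auto
        then show False using X i[of k] xy(1-3) by (cases s; cases t) auto
      next
        fix k assume "\<forall>x\<in>X. \<forall>y\<in>X. x \<noteq> y \<longrightarrow> fst x \<noteq> fst y" "(k, True) \<in> X \<and> (k, False) \<in> X"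
        then show False by fastforce
      qed
    qed
  qed
  show ?thesis
    unfolding assoc_complex_clique join_family_clique hyper
  proof (rule clique_complex_iso[of \<phi>])
    show "inj_on \<phi> ({1..m} \<times> UNIV)" by (auto simp: inj_on_def \<phi>_def split: if_splits)
    show "\<phi> ` ({1..m} \<times> UNIV) = Sigma {1..m} (\<lambda>i. diagonals 4)"
      by (auto simp: \<phi>_def diag image_iff split: if_splits)
    show "(fst (\<phi> x) \<noteq> fst (\<phi> y) \<or> \<not> crossing (snd (\<phi> x)) (snd (\<phi> y))) = (fst x \<noteq> fst y)"
      if "x \<noteq> y" for x y
      using that by (cases x; cases y) (auto simp: \<phi>_def)
  qed
qed

theorem corollary6p4:
  fixes n m :: nat and r :: "nat \<Rightarrow> nat"
  assumes "1 \<le> m"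
    and "\<And>i. i \<in> {1..m} \<Longrightarrow> 4 \<le> r i \<and> r i < n"
    and "(\<Sum>i=1..m. r i) = n + 3 * (m - 1)"
  shows "stellar_subdivision (join_family {1..m} (\<lambda>i. assoc_complex (r i))) (assoc_complex n) \<and>
         stellar_subdivision (hyperoctahedron_boundary (n - 3)) (assoc_complex n) \<and>
         stellar_subdivision (hyperoctahedron_boundary (n - 3)) (join_family {1..m} (\<lambda>i. assoc_complex (r i))) \<and>
         edge_subdivision_through (\<lambda>L. combinatorial_sphere (n - 4) L \<and> trivial_T2 L)
           (join_family {1..m} (\<lambda>i. assoc_complex (r i))) (assoc_complex n) \<and>
         edge_subdivision_through (\<lambda>L. combinatorial_sphere (n - 4) L \<and> trivial_T2 L)
           (hyperoctahedron_boundary (n - 3)) (assoc_complex n) \<and>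
         edge_subdivision_through (\<lambda>L. combinatorial_sphere (n - 4) L \<and> trivial_T2 L)
           (hyperoctahedron_boundary (n - 3)) (join_family {1..m} (\<lambda>i. assoc_complex (r i)))"
proof -
  define N where "N = n - 2"
  let ?C = "\<lambda>S. nested_complex (intervals N S) {1..N}"
  have n: "4 < n" using assms(2)[of 1] assms(1) by auto
  have N: "1 \<le> N" "n - 3 = N - 1" "n - 4 = N - 1 - 1" "1 \<le> N - 1" using n by (simp_all add: N_def)
  have r: "4 \<le> r i" if "i \<in> {1..m}" for i using assms(2)[OF that] by simp
  \<comment> \<open>In terms of offsets, the hypothesis on the sum says that the blocks have
    \<open>n - 3\<close> points altogether.\<close>
  have "offset r (Suc m) + 3 * m = (\<Sum>i=1..m. r i)"
  proof -
    have "(\<Sum>i=1..m. r i) = (\<Sum>i=1..m. (r i - 3) + 3)" using r by (intro sum.cong) fastforce+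
    also have "\<dots> = (\<Sum>i=1..m. r i - 3) + 3 * m" by (simp add: sum.distrib)
    finally show ?thesis by (simp add: offset_def atLeastLessThanSuc_atLeastAtMost)
  qed
  then have off: "offset r (Suc m) = n - 3" using assms(1,3) by (cases m) auto
  have join: "complex_iso (join_family {1..m} (\<lambda>i. assoc_complex (r i))) (?C (join_cuts m r))"
    by (rule join_assoc_iso[OF assms(1) r]) (use off n N_def in auto)
  have off4: "offset (\<lambda>i. 4) i = i - 1" for i by (simp add: offset_def)
  have "complex_iso (join_family {1..N - 1} (\<lambda>i. assoc_complex 4)) (?C (join_cuts (N - 1) (\<lambda>i. 4)))"
    by (rule join_assoc_iso[of "N - 1" "\<lambda>i. 4"]) (use N off4 in auto)
  then have hyper: "complex_iso (hyperoctahedron_boundary (n - 3)) (?C (join_cuts (N - 1) (\<lambda>i. 4)))"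
    unfolding N(2) by (rule complex_iso_trans[OF hyperoctahedron_iso_join])
  have "complex_iso (join_family {1..1::nat} (\<lambda>i. assoc_complex n)) (?C (join_cuts 1 (\<lambda>i. n)))"
    by (rule join_assoc_iso[of 1 "\<lambda>i. n"]) (use n N_def offset_Suc[of 1 "\<lambda>i. n"] in auto)
  then have "complex_iso (assoc_complex n) (?C {})"
    using complex_iso_trans[OF assoc_iso_join] by (simp add: join_cuts_def)
  then have assoc: "complex_iso (?C {}) (assoc_complex n)" by (rule complex_iso_sym)
  \<comment> \<open>Squares are blocks of one point, which puts cuts everywhere except after 1,
    where only initial intervals could be affected.\<close>
  have hyper_cuts: "join_cuts (N - 1) (\<lambda>i. 4) = {2..N - 1}"
    unfolding join_cuts_def off4 by force
  \<comment> \<open>From \<open>r i \<ge> 4\<close> every block has at least one point, so the cuts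
    stay away from both ends.\<close>
  have cuts: "join_cuts m r \<subseteq> {2..N - 1}"
  proof
    fix c assume "c \<in> join_cuts m r"
    then obtain i where i: "i \<in> {2..m}" "c = Suc (offset r i)" by (auto simp: join_cuts_def)
    have "offset r 1 + 1 \<le> offset r (Suc 1)" using offset_Suc[of 1 r] r[of 1] i by simp
    moreover have "offset r (Suc 1) \<le> offset r i" using i by (intro offset_mono) simp
    moreover have "offset r i + 1 \<le> offset r (Suc i)" using offset_Suc[of i r] r[of i] i by simp
    moreover have "offset r (Suc i) \<le> offset r (Suc m)" using i by (intro offset_mono) simp
    ultimately show "c \<in> {2..N - 1}" using i off N by simp
  qed
  have steps: "(edge_step {1..N})\<^sup>*\<^sup>* (?C {2..N - 1}) (?C (join_cuts m r))"
    "(edge_step {1..N})\<^sup>*\<^sup>* (?C {2..N - 1}) (?C {})" "(edge_step {1..N})\<^sup>*\<^sup>* (?C (join_cuts m r)) (?C {})"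
    by (rule remove_cuts[OF N(1)]; use cuts finite_subset[OF cuts] in simp)+
  have "linear_sphere (n - 4) (?C {2..N - 1})"
    unfolding N(3) by (rule linear_sphere_iso[OF linear_sphere_hyperoctahedron[OF N(4)] hyper[unfolded N(2) hyper_cuts]])
  moreover have "building_set (<) (intervals N {2..N - 1})"
  proof -
    \<comment> \<open>A dummy cut at 0 separates nothing and serves as the cut to be removed, also
      for \<open>N = 2\<close>, where \<open>{2..N - 1}\<close> is empty.\<close>
    have "building_set (<) (intervals N (insert 0 {2..N - 1}) \<union> {})" by (rule building_set_intervals[of 0]) auto
    moreover have "intervals N (insert 0 {2..N - 1}) = intervals N {2..N - 1}"
      by (auto simp: intervals_def uncut_def)
    ultimately show ?thesis by simp
  qed
  ultimately have start: "nested_sphere {1..N} (n - 4) (?C {2..N - 1})"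
    using intervals_top[OF N(1)] unfolding nested_sphere_def by blast
  \<comment> \<open>The join is recognised as a sphere by its chain from the hyper-octahedron; this
    starts the chain from the join to the complex of the \<open>n\<close>-gon.\<close>
  have mid: "nested_sphere {1..N} (n - 4) (?C (join_cuts m r))"
    using steps(1) start by (rule edge_steps_sphere)
  note edge = edge_subdivision_through_steps[OF steps(3) mid join assoc]
    edge_subdivision_through_steps[OF steps(2) start hyper[unfolded hyper_cuts] assoc]
    edge_subdivision_through_steps[OF steps(1) start hyper[unfolded hyper_cuts] complex_iso_sym[OF join]]
  show ?thesis by (intro conjI edge edge[THEN stellar_subdivision_if_edge])
qed

end
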